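(* Let $1\le \ell<k$ be integers, and suppose that $\beta\in\operatorname{Acc}(\Pi^k_\ell)\cap[0,1)$. Then $\Phi_{k,\ell}(\beta)\in\operatorname{Acc}(\Pi^k_\ell)$, where $\Phi_{k,\ell}(x)=1-\left(1+(1-x)^{-1/(k-\ell)}\right)^{-(k-\ell)}$. Consequently, for all integers $k\ge 3$ and $1\le\ell<k$, the set $\operatorname{Acc}(\Pi^k_\ell)$ is infinite.
   Context: A $k$-graph $H$ is a finite $k$-uniform hypergraph; it is non-empty if it has at least one edge. A $k$-graph is $F$-free if it contains no (not necessarily induced) subgraph isomorphic to $F$. For $1\le \ell<k$ and an $\ell$-set $S\subseteq V(H)$, $d_H(S)$ is the number of edges of $H$ containing $S$, and $\delta_\ell(H)$ is the minimum of $d_H(S)$ over all $\ell$-sets $S\subseteq V(H)$. For a non-empty $k$-graph $F$, $\mathrm{ex}_\ell(n,F)$ is the largest value of $\delta_\ell(H)$ over all $n$-vertex $F$-free $k$-graphs $H$, and the $\ell$-degree Turán density is $\pi_\ell(F)=\lim_{n\to\infty}\mathrm{ex}_\ell(n,F)/\binom{n-\ell}{k-\ell}$ (the limit is known to exist). The single $\ell$-degree Turán spectrum is $\Pi^k_\ell=\{\pi_\ell(F): F \text{ a single non-empty } k\text{-graph}\}$. $\operatorname{Acc}(\Pi^k_\ell)\subseteq[0,1]$ denotes the set of accumulation points (limit points) of $\Pi^k_\ell$. *)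

theory Defs
  imports "HOL-Analysis.Analysis"
begin

type_synonym 'a hypergraph = "'a set \<times> 'a set set"

abbreviation verts :: "'a hypergraph \<Rightarrow> 'a set" where
  "verts \<equiv> fst"

abbreviation edges :: "'a hypergraph \<Rightarrow> 'a set set" where
  "edges \<equiv> snd"

definition kgraph :: "nat \<Rightarrow> 'a hypergraph \<Rightarrow> bool" where
  "kgraph k H \<longleftrightarrow> finite (verts H) \<and> (\<forall>e\<in>edges H. e \<subseteq> verts H \<and> card e = k)"

definition subhypergraph :: "'a hypergraph \<Rightarrow> 'a hypergraph \<Rightarrow> bool" where
  "subhypergraph H' H \<longleftrightarrow> verts H' \<subseteq> verts H \<and> edges H' \<subseteq> edges H"

definition hg_isomorphic :: "'a hypergraph \<Rightarrow> 'b hypergraph \<Rightarrow> bool" where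
  "hg_isomorphic F G \<longleftrightarrow>
     (\<exists>f. bij_betw f (verts F) (verts G) \<and> edges G = (\<lambda>e. f ` e) ` edges F)"

definition hg_free :: "'b hypergraph \<Rightarrow> 'a hypergraph \<Rightarrow> bool" where
  "hg_free F H \<longleftrightarrow> (\<nexists>H'. subhypergraph H' H \<and> hg_isomorphic F H')"

definition hg_degree :: "'a hypergraph \<Rightarrow> 'a set \<Rightarrow> nat" where
  "hg_degree H S = card {e \<in> edges H. S \<subseteq> e}"

text \<open>Only meaningful when \<open>H\<close> has at least \<open>l\<close> vertices, since otherwise the minimum is
  over the empty set; the densities below depend only on large vertex numbers.\<close>

definition min_degree :: "nat \<Rightarrow> 'a hypergraph \<Rightarrow> nat" where
  "min_degree l H = Min {hg_degree H S | S. S \<subseteq> verts H \<and> card S = l}"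

text \<open>Every finite hypergraph is isomorphic to one whose vertices are natural numbers, so
  letting \<open>H\<close> here, and \<open>F\<close> in \<open>turan_spectrum\<close>, range over such hypergraphs loses nothing.\<close>

definition ex_degree :: "nat \<Rightarrow> nat \<Rightarrow> nat \<Rightarrow> 'b hypergraph \<Rightarrow> nat" where
  "ex_degree k l n F =
     Max {min_degree l H | H :: nat hypergraph. kgraph k H \<and> card (verts H) = n \<and> hg_free F H}"

definition turan_density :: "nat \<Rightarrow> nat \<Rightarrow> 'b hypergraph \<Rightarrow> real" where
  "turan_density k l F =
     lim (\<lambda>n. real (ex_degree k l n F) / real ((n - l) choose (k - l)))"

definition turan_spectrum :: "nat \<Rightarrow> nat \<Rightarrow> real set" where
  "turan_spectrum k l =
     {turan_density k l F | F :: nat hypergraph. kgraph k F \<and> edges F \<noteq> {}}"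

definition Acc :: "real set \<Rightarrow> real set" where
  "Acc A = {x. x islimpt A}"

definition Phi :: "nat \<Rightarrow> nat \<Rightarrow> real \<Rightarrow> real" where
  "Phi k l x = 1 - (1 + (1 - x) powr (- 1 / real (k - l))) powr (- real (k - l))"

end

theory Submission
  imports Defs "HOL-Analysis.Analysis"
begin

text \<open>
  Containment is first made flexible. Random samples of bounded size inherit the minimum \<open>l\<close>-degree of
  a large hypergraph, so extremal values at large sizes carry over to all sizes and the limit
  defining the density exists. Counting the samples that receive the same homomorphism from \<open>F\<close>
  produces blow-ups, so embeddings may be replaced by homomorphisms: the density of \<open>F\<close> is at most \<open>d\<close>
  as soon as \<open>F\<close> maps to all hypergraphs on \<open>N\<close> vertices that are dense with a slightly smaller
  constant, where \<open>N\<close> does not depend on \<open>F\<close> (\<open>density_le_if_hom_forced\<close>).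

  The map \<open>Phi\<close> then comes from an operation on hypergraphs. In \<open>Phi_tree k F\<close> the children of every
  node of a tree form a copy of \<open>F\<close> and every branch is an edge. The extremal hypergraphs for the tree
  have a part that carries an extremal hypergraph for \<open>F\<close> and a part without edges, while all sets
  that meet both parts are edges; optimising the sizes of the parts gives the value of \<open>Phi\<close> at the
  density of \<open>F\<close> (\<open>Phi_tree_density\<close>). So the spectrum below \<open>1\<close> is closed under \<open>Phi\<close>, which is
  continuous and strictly increasing, and accumulation points go to accumulation points. Since \<open>Phi\<close>
  moves every number in \<open>{0..<1}\<close> up, one accumulation point below \<open>1\<close> yields infinitely many.

  Such a point is found in one of two ways, depending on \<open>m = k - l\<close>. If \<open>m \<le> l\<close>, it is \<open>0\<close>. In a dense
  hypergraph the link of every \<open>l\<close>-set contains a complete \<open>m\<close>-partite hypergraph with parts of size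
  \<open>l\<close>. Viewing \<open>l\<close>-sets as states and the parts as their children, the finite automaton that follows
  all dense hypergraphs on \<open>N\<close> vertices at once is a hypergraph of arbitrarily small density. Its density is
  positive, because a homomorphism to the hypergraph of the \<open>k\<close>-sets with sum \<open>1\<close> modulo \<open>q\<close> would
  solve a linear system that has no solution for suitable \<open>q\<close> (\<open>zero_accumulates\<close>).

  If \<open>l < m\<close>, the point is \<open>1 / 2\<close>. Attaching a copy of an \<open>m\<close>-uniform \<open>Q\<close> to the link of every \<open>l\<close>-set,
  \<open>D\<close> times in succession, gives \<open>(l + m)\<close>-uniform hypergraphs whose densities tend to the ordinary
  density of \<open>Q\<close> as \<open>D\<close> grows: the lower bound assigns random levels below \<open>D\<close> to the \<open>l\<close>-sets and lets
  the lowest \<open>l\<close>-set of an edge decide, so that every round of attaching uses up one level. Hence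
  accumulation points for \<open>l = 0\<close> lift to all larger edges (\<open>lift_accumulation\<close>). Starting from a
  triangle, the densities for \<open>k = 3\<close> and \<open>l = 1\<close> are strictly below their limit \<open>1 / 2\<close>, because almost
  all links in a hypergraph of density near \<open>1 / 2\<close> contain a triangle unless an excessively dense part
  is left over (\<open>half_accumulates\<close>). As \<open>l = 0\<close> and \<open>l = 1\<close> define the same densities, repeated lifting
  reaches all remaining pairs.
\<close>

section \<open>Homomorphisms, embeddings and dense hypergraphs\<close>

definition hg_hom :: "'a hypergraph \<Rightarrow> 'b hypergraph \<Rightarrow> bool" where
  "hg_hom F H \<longleftrightarrow> (\<exists>f. f ` verts F \<subseteq> verts H \<and> (\<forall>e\<in>edges F. f ` e \<in> edges H))"

definition hg_emb :: "'a hypergraph \<Rightarrow> 'b hypergraph \<Rightarrow> bool" where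
  "hg_emb F H \<longleftrightarrow> (\<exists>f. inj_on f (verts F) \<and> f ` verts F \<subseteq> verts H \<and> (\<forall>e\<in>edges F. f ` e \<in> edges H))"

text \<open>Degrees are compared with the number of all ordered \<open>(k - l)\<close>-tuples of vertices. In the limit
  this agrees with the binomial normalisation, and it makes a degree the probability that a random
  tuple completes \<open>S\<close> to an edge. For \<open>l = 0\<close> it is the density of the edge set.\<close>

definition ldense :: "nat \<Rightarrow> nat \<Rightarrow> real \<Rightarrow> 'a hypergraph \<Rightarrow> bool" where
  "ldense k l d H \<longleftrightarrow> (\<forall>S. S \<subseteq> verts H \<and> card S = l \<longrightarrow>
     d * real (card (verts H)) ^ (k - l) \<le> fact (k - l) * real (hg_degree H S))"

lemma kgraph_finite: "kgraph k H \<Longrightarrow> finite (verts H)"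
  by (simp add: kgraph_def)

lemma kgraph_edge: "kgraph k H \<Longrightarrow> e \<in> edges H \<Longrightarrow> e \<subseteq> verts H \<and> card e = k"
  by (simp add: kgraph_def)

lemma kgraph_finite_edges: "kgraph k H \<Longrightarrow> finite (edges H)"
  by (rule finite_subset[of _ "Pow (verts H)"]) (auto simp: kgraph_def)

lemma emb_imp_hom: "hg_emb F H \<Longrightarrow> hg_hom F H"
  by (auto simp: hg_emb_def hg_hom_def)

lemma emb_trans: "hg_emb F G \<Longrightarrow> hg_emb G H \<Longrightarrow> hg_emb F H"
proof -
  assume "hg_emb F G" "hg_emb G H"
  then obtain f g where f: "inj_on f (verts F)" "f ` verts F \<subseteq> verts G" "\<forall>e\<in>edges F. f ` e \<in> edges G"
    and g: "inj_on g (verts G)" "g ` verts G \<subseteq> verts H" "\<forall>e\<in>edges G. g ` e \<in> edges H"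
    by (auto simp: hg_emb_def)
  show ?thesis unfolding hg_emb_def
    by (rule exI[of _ "g \<circ> f"])
      (use f g in \<open>auto simp flip: image_image intro!: comp_inj_on intro: inj_on_subset\<close>)
qed

lemma hg_free_iff_no_emb:
  assumes "kgraph k F"
  shows "hg_free F H \<longleftrightarrow> \<not> hg_emb F H"
proof -
  have "(\<exists>H'. subhypergraph H' H \<and> hg_isomorphic F H') \<longleftrightarrow> hg_emb F H"
  proof
    assume "\<exists>H'. subhypergraph H' H \<and> hg_isomorphic F H'"
    then obtain H' f where "subhypergraph H' H" "bij_betw f (verts F) (verts H')"
      "edges H' = (\<lambda>e. f ` e) ` edges F" by (auto simp: hg_isomorphic_def)
    then show "hg_emb F H"
      unfolding hg_emb_def subhypergraph_def bij_betw_def by (intro exI[of _ f]) auto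
  next
    assume "hg_emb F H"
    then obtain f where f: "inj_on f (verts F)" "f ` verts F \<subseteq> verts H" "\<forall>e\<in>edges F. f ` e \<in> edges H"
      by (auto simp: hg_emb_def)
    show "\<exists>H'. subhypergraph H' H \<and> hg_isomorphic F H'"
      by (rule exI[of _ "(f ` verts F, (\<lambda>e. f ` e) ` edges F)"])
        (use f in \<open>auto simp: subhypergraph_def hg_isomorphic_def bij_betw_def\<close>)
  qed
  then show ?thesis by (simp add: hg_free_def)
qed

definition hg_map :: "('a \<Rightarrow> 'b) \<Rightarrow> 'a hypergraph \<Rightarrow> 'b hypergraph" where
  "hg_map f H = (f ` verts H, (\<lambda>e. f ` e) ` edges H)"

lemma hg_map_kgraph:
  assumes "kgraph k H" "inj_on f (verts H)"
  shows "kgraph k (hg_map f H)"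
  using assms unfolding kgraph_def hg_map_def
  by (auto simp: card_image inj_on_subset)

lemma hg_map_emb: "inj_on f (verts H) \<Longrightarrow> hg_emb H (hg_map f H)"
  unfolding hg_emb_def hg_map_def by (intro exI[of _ f]) auto

lemma hg_map_emb_back:
  assumes "kgraph k H" "inj_on f (verts H)"
  shows "hg_emb (hg_map f H) H"
proof -
  let ?g = "inv_into (verts H) f"
  have "?g ` f ` e = e" if "e \<in> edges H" for e
    using assms that by (metis inv_into_image_cancel kgraph_edge)
  then show ?thesis
    unfolding hg_emb_def hg_map_def
    by (intro exI[of _ ?g]) (use assms in \<open>auto intro!: inj_on_inv_into\<close>)
qed

text \<open>Most estimates below count the completions of \<open>S\<close> rather than the edges around it.\<close>

lemma degree_eq_card_completions:
  assumes "kgraph k H" "S \<subseteq> verts H" "card S = l" "l \<le> k"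
  shows "hg_degree H S = card {M. M \<subseteq> verts H - S \<and> card M = k - l \<and> S \<union> M \<in> edges H}"
proof -
  have fin: "finite S" using assms kgraph_finite finite_subset by blast
  have "bij_betw (\<lambda>e. e - S) {e \<in> edges H. S \<subseteq> e} {M. M \<subseteq> verts H - S \<and> card M = k - l \<and> S \<union> M \<in> edges H}"
  proof (rule bij_betw_byWitness[where f'="\<lambda>M. S \<union> M"])
    show "\<forall>e\<in>{e \<in> edges H. S \<subseteq> e}. S \<union> (e - S) = e" by auto
    show "\<forall>M\<in>{M. M \<subseteq> verts H - S \<and> card M = k - l \<and> S \<union> M \<in> edges H}. S \<union> M - S = M" by auto
    show "(\<lambda>e. e - S) ` {e \<in> edges H. S \<subseteq> e} \<subseteq> {M. M \<subseteq> verts H - S \<and> card M = k - l \<and> S \<union> M \<in> edges H}"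
      using assms fin kgraph_edge[OF assms(1)]
      by (auto simp: card_Diff_subset Un_absorb1)
    show "(\<union>) S ` {M. M \<subseteq> verts H - S \<and> card M = k - l \<and> S \<union> M \<in> edges H} \<subseteq> {e \<in> edges H. S \<subseteq> e}"
      by auto
  qed
  then show ?thesis unfolding hg_degree_def by (rule bij_betw_same_card)
qed

section \<open>Counting\<close>

lemma fact_choose_le_power: "fact m * real (n choose m) \<le> real n ^ m"
proof -
  have "real ((n choose m) * fact m) \<le> real (n ^ m)"
    using binomial_fact_pow by (simp only: of_nat_le_iff)
  then show ?thesis by (simp add: mult.commute)
qed

lemma fact_choose_eq_prod: "fact m * real (n choose m) = (\<Prod>i<m. real n - real i)"
  by (simp add: binomial_gbinomial gbinomial_mult_fact atLeast0LessThan)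

lemma power_le_fact_choose:
  assumes "m \<le> n"
  shows "(real n - real m) ^ m \<le> fact m * real (n choose m)"
proof -
  have "(\<Prod>i<m. real n - real m) \<le> (\<Prod>i<m. real n - real i)"
    by (rule prod_mono) (use assms in auto)
  then show ?thesis by (simp add: fact_choose_eq_prod)
qed

lemma choose_asymptotics:
  "(\<lambda>n. fact m * real ((n - l) choose m) / real n ^ m) \<longlonglongrightarrow> 1"
proof (rule tendsto_sandwich)
  show "\<forall>\<^sub>F n in sequentially. (1 - real (l + m) / real n) ^ m \<le> fact m * real ((n - l) choose m) / real n ^ m"
    using eventually_gt_at_top[of "l + m"]
  proof eventually_elim
    case (elim n)
    have "(1 - real (l + m) / real n) ^ m = (real (n - l) - real m) ^ m / real n ^ m"
      using elim by (simp add: power_divide[symmetric] of_nat_diff diff_divide_distrib add_divide_distrib diff_diff_eq)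
    also have "\<dots> \<le> fact m * real ((n - l) choose m) / real n ^ m"
      using power_le_fact_choose[of m "n - l"] elim by (intro divide_right_mono) auto
    finally show ?case .
  qed
  show "\<forall>\<^sub>F n in sequentially. fact m * real ((n - l) choose m) / real n ^ m \<le> 1"
    using eventually_gt_at_top[of 0]
  proof eventually_elim
    case (elim n)
    have "fact m * real ((n - l) choose m) \<le> real (n - l) ^ m" by (rule fact_choose_le_power)
    also have "\<dots> \<le> real n ^ m" by (intro power_mono) auto
    finally show ?case using elim by (simp add: divide_simps)
  qed
  have "(\<lambda>n. real (l + m) / real n) \<longlonglongrightarrow> 0" by (rule lim_const_over_n)
  then have "(\<lambda>n. (1 - real (l + m) / real n) ^ m) \<longlonglongrightarrow> (1 - 0) ^ m"
    by (intro tendsto_intros)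
  then show "(\<lambda>n. (1 - real (l + m) / real n) ^ m) \<longlonglongrightarrow> 1" by simp
qed simp

lemma card_funcs_onto_edge:
  assumes "finite M" "finite V" "e \<subseteq> V" "card e = card M"
  shows "card {z \<in> M \<rightarrow>\<^sub>E V. z ` M = e} = fact (card M)"
proof -
  have fe: "finite e" using assms finite_subset by blast
  have "{z \<in> M \<rightarrow>\<^sub>E V. z ` M = e} = {z \<in> M \<rightarrow>\<^sub>E e. inj_on z M}"
  proof (intro set_eqI iffI)
    fix z assume z: "z \<in> {z \<in> M \<rightarrow>\<^sub>E V. z ` M = e}"
    then have "inj_on z M" using assms by (intro eq_card_imp_inj_on) auto
    then show "z \<in> {z \<in> M \<rightarrow>\<^sub>E e. inj_on z M}" using z by (auto simp: PiE_def)
  next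
    fix z assume z: "z \<in> {z \<in> M \<rightarrow>\<^sub>E e. inj_on z M}"
    then have "z ` M = e" using assms fe by (intro card_subset_eq) (auto simp: card_image)
    then show "z \<in> {z \<in> M \<rightarrow>\<^sub>E V. z ` M = e}" using z assms(3) by (auto simp: PiE_def)
  qed
  also have "card \<dots> = (\<Prod>i = 0..<card M. card e - i)"
    using card_inj_on_subset_funcset[OF assms(1) fe order_refl] by simp
  also have "\<dots> = fact (card M)"
    unfolding assms(4) fact_prod_rev by simp
  finally show ?thesis .
qed

lemma card_funcs_onto_edges:
  assumes "finite M" "finite V" "\<And>e. e \<in> E \<Longrightarrow> e \<subseteq> V \<and> card e = card M"
  shows "card {z \<in> M \<rightarrow>\<^sub>E V. z ` M \<in> E} = fact (card M) * card E"
proof -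
  have finE: "finite E" by (rule finite_subset[of _ "Pow V"]) (use assms in auto)
  have "{z \<in> M \<rightarrow>\<^sub>E V. z ` M \<in> E} = (\<Union>e\<in>E. {z \<in> M \<rightarrow>\<^sub>E V. z ` M = e})" by auto
  also have "card \<dots> = (\<Sum>e\<in>E. card {z \<in> M \<rightarrow>\<^sub>E V. z ` M = e})"
    by (rule card_UN_disjoint) (use finE assms in \<open>auto intro!: finite_subset[OF _ finite_PiE[of M "\<lambda>_. V"]]\<close>)
  also have "\<dots> = (\<Sum>e\<in>E. fact (card M))"
    by (intro sum.cong card_funcs_onto_edge) (use assms in auto)
  finally show ?thesis by simp
qed

section \<open>Random hypergraphs given by independent local choices\<close>

lemma override_on_PiE:
  "\<omega> \<in> PiE I W \<Longrightarrow> \<omega>' \<in> PiE I W \<Longrightarrow> override_on \<omega> \<omega>' J \<in> PiE I W"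
  by (auto simp: override_on_def PiE_def Pi_def extensional_def)

text \<open>Exchanging the coordinates in \<open>J\<close> between two independent samples permutes the pairs of samples
  and preserves averages over them.\<close>

lemma resampling_invariance:
  fixes g :: "('i \<Rightarrow> 'w) \<Rightarrow> ('i \<Rightarrow> 'w) \<Rightarrow> real"
  shows "(\<Sum>\<omega>\<in>PiE I W. \<Sum>\<omega>'\<in>PiE I W. g (override_on \<omega> \<omega>' J) (override_on \<omega>' \<omega> J))
    = (\<Sum>\<omega>\<in>PiE I W. \<Sum>\<omega>'\<in>PiE I W. g \<omega> \<omega>')"
proof -
  let ?s = "\<lambda>(\<omega>, \<omega>'). (override_on \<omega> \<omega>' J, override_on \<omega>' \<omega> J)"
  have inv: "?s (?s x) = x" for x :: "('i \<Rightarrow> 'w) \<times> ('i \<Rightarrow> 'w)"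
    by (cases x) (auto simp: override_on_def fun_eq_iff)
  have "(\<Sum>x\<in>PiE I W \<times> PiE I W. (\<lambda>(a, b). g a b) (?s x)) = (\<Sum>x\<in>PiE I W \<times> PiE I W. (\<lambda>(a, b). g a b) x)"
    by (rule sum.reindex_bij_witness[of _ ?s ?s]) (use inv in \<open>auto intro!: override_on_PiE\<close>)
  then show ?thesis by (simp add: sum.cartesian_product case_prod_beta)
qed

lemma resampling_mean:
  fixes g :: "('i \<Rightarrow> 'w) \<Rightarrow> real"
  shows "(\<Sum>\<omega>\<in>PiE I W. \<Sum>\<omega>'\<in>PiE I W. g (override_on \<omega> \<omega>' J)) = real (card (PiE I W)) * (\<Sum>\<omega>\<in>PiE I W. g \<omega>)"
proof -
  have "(\<Sum>\<omega>\<in>PiE I W. \<Sum>\<omega>'\<in>PiE I W. g (override_on \<omega> \<omega>' J)) = (\<Sum>\<omega>\<in>PiE I W. \<Sum>\<omega>'\<in>PiE I W. g \<omega>)"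
    using resampling_invariance[of "\<lambda>a b. g a"] by simp
  then show ?thesis by (simp add: sum_distrib_left)
qed

text \<open>Resampling the block \<open>J r\<close> replaces the last factor by its conditional mean and leaves the other
  factors alone.\<close>

lemma expected_product_le:
  fixes y :: "nat \<Rightarrow> ('i \<Rightarrow> 'w) \<Rightarrow> real"
  assumes fin: "finite (PiE I W)" and ne: "PiE I W \<noteq> {}"
    and loc: "\<And>i j \<omega> \<omega>'. i < r \<Longrightarrow> j < r \<Longrightarrow> i \<noteq> j \<Longrightarrow> y i (override_on \<omega> \<omega>' (J j)) = y i \<omega>"
    and mean: "\<And>j \<omega>. j < r \<Longrightarrow> \<omega> \<in> PiE I W \<Longrightarrow>
      (\<Sum>\<omega>'\<in>PiE I W. y j (override_on \<omega> \<omega>' (J j))) \<le> q * real (card (PiE I W))"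
    and pos: "\<And>j \<omega>. 0 \<le> y j \<omega>" and q: "0 \<le> q"
  shows "(\<Sum>\<omega>\<in>PiE I W. \<Prod>j<r. y j \<omega>) \<le> q ^ r * real (card (PiE I W))"
  using loc mean
proof (induction r)
  case 0
  then show ?case by simp
next
  case (Suc r)
  let ?\<Omega> = "PiE I W"
  have IH: "(\<Sum>\<omega>\<in>?\<Omega>. \<Prod>j<r. y j \<omega>) \<le> q ^ r * real (card ?\<Omega>)"
    using Suc by simp
  have eq: "(\<Prod>j<Suc r. y j (override_on \<omega> \<omega>' (J r))) = (\<Prod>j<r. y j \<omega>) * y r (override_on \<omega> \<omega>' (J r))" for \<omega> \<omega>'
  proof -
    have "(\<Prod>j<r. y j (override_on \<omega> \<omega>' (J r))) = (\<Prod>j<r. y j \<omega>)"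
      by (rule prod.cong) (use Suc.prems(1) in auto)
    then show ?thesis by simp
  qed
  have "real (card ?\<Omega>) * (\<Sum>\<omega>\<in>?\<Omega>. \<Prod>j<Suc r. y j \<omega>)
      = (\<Sum>\<omega>\<in>?\<Omega>. \<Sum>\<omega>'\<in>?\<Omega>. \<Prod>j<Suc r. y j (override_on \<omega> \<omega>' (J r)))"
    by (rule resampling_mean[symmetric])
  also have "\<dots> = (\<Sum>\<omega>\<in>?\<Omega>. (\<Prod>j<r. y j \<omega>) * (\<Sum>\<omega>'\<in>?\<Omega>. y r (override_on \<omega> \<omega>' (J r))))"
    unfolding eq by (simp add: sum_distrib_left)
  also have "\<dots> \<le> (\<Sum>\<omega>\<in>?\<Omega>. (\<Prod>j<r. y j \<omega>) * (q * real (card ?\<Omega>)))"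
    by (intro sum_mono mult_left_mono prod_nonneg) (use Suc.prems pos in auto)
  also have "\<dots> = q * real (card ?\<Omega>) * (\<Sum>\<omega>\<in>?\<Omega>. \<Prod>j<r. y j \<omega>)"
    by (simp add: sum_distrib_left mult.commute)
  also have "\<dots> \<le> q * real (card ?\<Omega>) * (q ^ r * real (card ?\<Omega>))"
    using IH q by (intro mult_left_mono) auto
  finally have "real (card ?\<Omega>) * (\<Sum>\<omega>\<in>?\<Omega>. \<Prod>j<Suc r. y j \<omega>) \<le> real (card ?\<Omega>) * (q ^ Suc r * real (card ?\<Omega>))"
    by (simp add: mult_ac)
  moreover have "real (card ?\<Omega>) > 0" using fin ne by (simp add: card_gt_0_iff)
  ultimately show ?case by (simp only: mult_le_cancel_left_pos)
qed

text \<open>The exponential moment factorises as in the usual proof of Chernoff's bound, since the events are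
  independent once the coordinates outside all blocks \<open>J j\<close> are fixed.\<close>

lemma chernoff_lower_tail:
  fixes X :: "nat \<Rightarrow> ('i \<Rightarrow> 'w) \<Rightarrow> bool"
  assumes fin: "finite (PiE I W)" and ne: "PiE I W \<noteq> {}"
    and loc: "\<And>i j \<omega> \<omega>'. i < r \<Longrightarrow> j < r \<Longrightarrow> i \<noteq> j \<Longrightarrow> X i (override_on \<omega> \<omega>' (J j)) = X i \<omega>"
    and mean: "\<And>j \<omega>. j < r \<Longrightarrow> \<omega> \<in> PiE I W \<Longrightarrow>
      d * real (card (PiE I W)) \<le> real (card {\<omega>' \<in> PiE I W. X j (override_on \<omega> \<omega>' (J j))})"
    and d: "0 \<le> d" "d \<le> 1" and \<eta>: "0 < \<eta>" "\<eta> \<le> 1"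
  shows "real (card {\<omega> \<in> PiE I W. real (card {j. j < r \<and> X j \<omega>}) < (d - \<eta>) * real r})
    \<le> exp (- (\<eta>\<^sup>2 / 4) * real r) * real (card (PiE I W))"
proof -
  let ?\<Omega> = "PiE I W"
  \<comment> \<open>This \<open>t\<close> minimises \<open>t\<^sup>2 - \<eta> * t\<close>, the exponent that results from \<open>exp (- t) \<le> 1 - t + t\<^sup>2\<close>.\<close>
  define t where "t = \<eta> / 2"
  have t: "0 < t" "t \<le> 1" using \<eta> by (auto simp: t_def)
  define y where "y j \<omega> = (if X j \<omega> then exp (- t) else 1)" for j \<omega>
  define q where "q = 1 - d * (1 - exp (- t))"
  have et: "exp (- t) \<le> 1 - t + t\<^sup>2"
  proof -
    have "exp (- t) = 1 / exp t" by (simp add: exp_minus field_simps)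
    also have "\<dots> \<le> 1 / (1 + t)"
      using t exp_ge_add_one_self[of t] by (intro divide_left_mono) (auto intro!: mult_pos_pos)
    also have "\<dots> \<le> 1 - t + t\<^sup>2"
    proof -
      have "(1 + t) * (1 - t + t\<^sup>2) = 1 + t ^ 3" by (simp add: algebra_simps power2_eq_square power3_eq_cube)
      then have "1 \<le> (1 - t + t\<^sup>2) * (1 + t)" using t by (simp add: mult.commute)
      then show ?thesis using t by (simp add: divide_le_eq)
    qed
    finally show ?thesis .
  qed
  have q0: "0 \<le> q"
  proof -
    have "d * (1 - exp (- t)) \<le> 1 * 1" by (intro mult_mono) (use d t in auto)
    then show ?thesis by (simp add: q_def)
  qed
  have "(\<Sum>\<omega>\<in>?\<Omega>. \<Prod>j<r. y j \<omega>) \<le> q ^ r * real (card ?\<Omega>)"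
  proof (rule expected_product_le[where J = J])
    fix j \<omega> assume j: "j < r" "\<omega> \<in> ?\<Omega>"
    let ?A = "{\<omega>' \<in> ?\<Omega>. X j (override_on \<omega> \<omega>' (J j))}"
    have "(\<Sum>\<omega>'\<in>?\<Omega>. y j (override_on \<omega> \<omega>' (J j)))
        = (\<Sum>\<omega>'\<in>?\<Omega>. 1 - (1 - exp (- t)) * (if X j (override_on \<omega> \<omega>' (J j)) then 1 else 0))"
      by (rule sum.cong) (auto simp: y_def)
    also have "\<dots> = real (card ?\<Omega>) - (1 - exp (- t)) * real (card ?A)"
      using fin by (simp add: sum_subtractf sum_distrib_left[symmetric] sum.If_cases Int_def)
    also have "\<dots> \<le> real (card ?\<Omega>) - (1 - exp (- t)) * (d * real (card ?\<Omega>))"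
      using mean[OF j] t by (intro diff_left_mono mult_left_mono) auto
    finally show "(\<Sum>\<omega>'\<in>?\<Omega>. y j (override_on \<omega> \<omega>' (J j))) \<le> q * real (card ?\<Omega>)"
      by (simp add: q_def algebra_simps)
  qed (use fin ne loc q0 in \<open>auto simp: y_def\<close>)
  moreover have "real (card {\<omega> \<in> ?\<Omega>. real (card {j. j < r \<and> X j \<omega>}) < (d - \<eta>) * real r}) * exp (- t * ((d - \<eta>) * real r))
     \<le> (\<Sum>\<omega>\<in>?\<Omega>. \<Prod>j<r. y j \<omega>)" (is "real (card ?B) * _ \<le> _")
  proof -
    have yv: "(\<Prod>j<r. y j \<omega>) = exp (- t * real (card {j. j < r \<and> X j \<omega>}))" for \<omega>
    proof -
      have "(\<Prod>j<r. y j \<omega>) = (\<Prod>j\<in>{j. j < r \<and> X j \<omega>}. exp (- t))"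
        unfolding y_def by (subst prod.If_cases) (auto simp: lessThan_def Int_def)
      also have "\<dots> = exp (- t * real (card {j. j < r \<and> X j \<omega>}))"
        by (simp add: exp_of_nat_mult[symmetric] mult.commute)
      finally show ?thesis .
    qed
    have "real (card ?B) * exp (- t * ((d - \<eta>) * real r)) = (\<Sum>\<omega>\<in>?B. exp (- t * ((d - \<eta>) * real r)))"
      by simp
    also have "\<dots> \<le> (\<Sum>\<omega>\<in>?B. \<Prod>j<r. y j \<omega>)"
      unfolding yv using t by (intro sum_mono) auto
    also have "\<dots> \<le> (\<Sum>\<omega>\<in>?\<Omega>. \<Prod>j<r. y j \<omega>)"
      using fin by (intro sum_mono2) (auto simp: y_def intro!: prod_nonneg)
    finally show ?thesis .
  qed
  ultimately have bound: "real (card ?B) * exp (- t * ((d - \<eta>) * real r)) \<le> q ^ r * real (card ?\<Omega>)" by linarith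
  moreover have "q ^ r \<le> exp (- d * (t - t\<^sup>2)) ^ r"
  proof (intro power_mono)
    have "q \<le> exp (- (d * (1 - exp (- t))))"
      unfolding q_def using exp_ge_add_one_self[of "- (d * (1 - exp (- t)))"] by simp
    also have "\<dots> \<le> exp (- (d * (t - t\<^sup>2)))"
      using et d by (simp) (intro mult_left_mono, auto)
    finally show "q \<le> exp (- d * (t - t\<^sup>2))" by simp
  qed (fact q0)
  moreover have "exp (- d * (t - t\<^sup>2)) ^ r = exp (- d * (t - t\<^sup>2) * real r)"
    by (simp add: exp_of_nat_mult[symmetric] mult.commute)
  ultimately have "q ^ r * real (card ?\<Omega>) \<le> exp (- d * (t - t\<^sup>2) * real r) * real (card ?\<Omega>)"
    by (intro mult_right_mono) auto
  with bound have "real (card ?B) * exp (- t * ((d - \<eta>) * real r)) \<le> exp (- d * (t - t\<^sup>2) * real r) * real (card ?\<Omega>)"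
    by linarith
  then have "real (card ?B) * exp (- t * ((d - \<eta>) * real r)) * exp (t * ((d - \<eta>) * real r))
     \<le> exp (- d * (t - t\<^sup>2) * real r) * real (card ?\<Omega>) * exp (t * ((d - \<eta>) * real r))"
    by (intro mult_right_mono) auto
  moreover have "exp (- t * ((d - \<eta>) * real r)) * exp (t * ((d - \<eta>) * real r)) = 1"
    by (simp add: exp_add[symmetric])
  ultimately have "real (card ?B) \<le> exp (- d * (t - t\<^sup>2) * real r) * real (card ?\<Omega>) * exp (t * ((d - \<eta>) * real r))"
    by (simp only: mult.assoc)
  also have "\<dots> = exp (- d * (t - t\<^sup>2) * real r + t * ((d - \<eta>) * real r)) * real (card ?\<Omega>)"
    by (simp only: exp_add mult_ac)
  also have "\<dots> \<le> exp (- (\<eta>\<^sup>2 / 4) * real r) * real (card ?\<Omega>)"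
  proof (intro mult_right_mono)
    have "d * t\<^sup>2 \<le> 1 * t\<^sup>2" using d by (intro mult_right_mono) auto
    moreover have "- d * (t - t\<^sup>2) + t * (d - \<eta>) = d * t\<^sup>2 - 2 * t\<^sup>2" "\<eta>\<^sup>2 / 4 = t\<^sup>2"
      by (simp_all add: t_def power2_eq_square field_simps)
    ultimately have "- d * (t - t\<^sup>2) + t * (d - \<eta>) \<le> - (\<eta>\<^sup>2 / 4)" by linarith
    then have "(- d * (t - t\<^sup>2) + t * (d - \<eta>)) * real r \<le> - (\<eta>\<^sup>2 / 4) * real r"
      by (intro mult_right_mono) auto
    then show "exp (- d * (t - t\<^sup>2) * real r + t * ((d - \<eta>) * real r)) \<le> exp (- (\<eta>\<^sup>2 / 4) * real r)"
      by (simp add: algebra_simps)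
  qed auto
  finally show ?thesis .
qed

lemma permutation_moving_subset:
  assumes "finite U" "A \<subseteq> U" "B \<subseteq> U" "card A = card B"
  obtains p where "p permutes U" "p ` A = B"
proof -
  have fin: "finite A" "finite B" "finite (U - A)" "finite (U - B)"
    using assms finite_subset by auto
  obtain f where f: "bij_betw f A B" using finite_same_card_bij fin assms by blast
  have "card (U - A) = card (U - B)" using assms fin by (simp add: card_Diff_subset)
  then obtain g where g: "bij_betw g (U - A) (U - B)" using finite_same_card_bij fin by blast
  define p where "p x = (if x \<in> A then f x else if x \<in> U then g x else x)" for x
  have "bij_betw p A B" using f by (rule bij_betw_cong[THEN iffD1, rotated]) (simp add: p_def)
  moreover have "bij_betw p (U - A) (U - B)"
    using g by (rule bij_betw_cong[THEN iffD1, rotated]) (simp add: p_def)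
  ultimately have "bij_betw p (A \<union> (U - A)) (B \<union> (U - B))"
    by (rule bij_betw_combine) auto
  then have "bij_betw p U U" using assms by (simp add: Un_absorb1)
  then have "p permutes U"
    by (rule bij_imp_permutes) (use assms in \<open>auto simp: p_def\<close>)
  moreover have "p ` A = B" using \<open>bij_betw p A B\<close> by (simp add: bij_betw_def)
  ultimately show thesis by (rule that)
qed

text \<open>Permutations act transitively on the subsets of each size, so a random permutation moves \<open>B\<close> to a
  uniformly distributed subset.\<close>

lemma average_over_permutations:
  fixes g :: "'a set \<Rightarrow> real"
  assumes "finite U" "B \<subseteq> U"
  shows "real (card U choose card B) * (\<Sum>p | p permutes U. g (p ` B))
    = fact (card U) * (\<Sum>M | M \<subseteq> U \<and> card M = card B. g M)"
proof -
  let ?\<M> = "{M. M \<subseteq> U \<and> card M = card B}" and ?P = "{p. p permutes U}"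
  have indep: "(\<Sum>p\<in>?P. g (p ` M)) = (\<Sum>p\<in>?P. g (p ` B))" if M: "M \<in> ?\<M>" for M
  proof -
    obtain s where s: "s permutes U" "s ` B = M"
      using permutation_moving_subset[of U B M] assms M by auto
    have "(\<Sum>p\<in>?P. g (p ` B)) = (\<Sum>p\<in>?P. g ((p \<circ> s) ` B))"
      using sum_permutations_compose_right[OF s(1), of "\<lambda>p. g (p ` B)"] .
    also have "\<dots> = (\<Sum>p\<in>?P. g (p ` M))" by (simp add: s(2) flip: image_image)
    finally show ?thesis by simp
  qed
  have move: "(\<Sum>M\<in>?\<M>. g (p ` M)) = (\<Sum>M\<in>?\<M>. g M)" if p: "p \<in> ?P" for p
  proof (rule sum.reindex_bij_witness[of _ "\<lambda>M. inv p ` M" "\<lambda>M. p ` M"])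
    have p': "p permutes U" using p by simp
    have ip: "inv p permutes U" using permutes_inv[OF p'] .
    have a: "p x = x \<or> x \<in> U" "inv p x = x \<or> x \<in> U" "x \<in> U \<Longrightarrow> p x \<in> U" "x \<in> U \<Longrightarrow> inv p x \<in> U" for x
      using p' ip permutes_in_image[OF p'] permutes_in_image[OF ip] by (auto simp: permutes_def)
    fix M assume M: "M \<in> ?\<M>"
    show "inv p ` p ` M = M" by (simp add: image_comp permutes_inv_o[OF p'])
    show "p ` inv p ` M = M" by (simp add: image_comp permutes_inv_o[OF p'])
    have "card (p ` M) = card M" "card (inv p ` M) = card M"
      using permutes_inj[OF p'] permutes_inj[OF ip] by (auto intro!: card_image intro: inj_on_subset)
    then show "p ` M \<in> ?\<M>" "inv p ` M \<in> ?\<M>" using M a by auto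
  qed auto
  have "real (card U choose card B) * (\<Sum>p\<in>?P. g (p ` B)) = (\<Sum>M\<in>?\<M>. \<Sum>p\<in>?P. g (p ` M))"
    using indep by (simp add: n_subsets[OF assms(1)])
  also have "\<dots> = (\<Sum>p\<in>?P. \<Sum>M\<in>?\<M>. g (p ` M))" by (rule sum.swap)
  also have "\<dots> = (\<Sum>p\<in>?P. \<Sum>M\<in>?\<M>. g M)" by (rule sum.cong[OF refl]) (rule move)
  finally show ?thesis using card_permutations[OF refl assms(1)] by simp
qed

text \<open>Every coordinate \<open>i\<close> of the random experiment sits on a vertex set \<open>supp i\<close>, and
  whether \<open>e\<close> is an edge is decided by the coordinates inside \<open>e\<close>. Once the coordinates inside
  an \<open>l\<close>-set \<open>S\<close> are fixed, the edges \<open>S \<union> M\<close> for pairwise disjoint \<open>M\<close> are independent, so a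
  family of about \<open>N / m\<close> disjoint \<open>M\<close> behaves well outside an exponentially small set. Averaging
  over all permutations of the vertices outside \<open>S\<close> passes from one such family to all \<open>m\<close>-sets,
  and exponential decay leaves room for the union over all \<open>l\<close>-sets.\<close>

lemma random_local_hypergraph:
  fixes I :: "'i set" and W :: "'i \<Rightarrow> 'w set" and supp :: "'i \<Rightarrow> nat set"
    and ind :: "nat set \<Rightarrow> ('i \<Rightarrow> 'w) \<Rightarrow> bool"
  assumes fin: "finite (PiE I W)" and ne: "PiE I W \<noteq> {}" and m: "0 < m"
    and loc: "\<And>e \<omega> \<omega>'. e \<subseteq> {..<N} \<Longrightarrow> card e = l + m \<Longrightarrow> (\<And>i. supp i \<subseteq> e \<Longrightarrow> \<omega> i = \<omega>' i)
      \<Longrightarrow> ind e \<omega> = ind e \<omega>'"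
    and mean: "\<And>S M \<omega>. S \<subseteq> {..<N} \<Longrightarrow> M \<subseteq> {..<N} \<Longrightarrow> S \<inter> M = {} \<Longrightarrow> card S = l \<Longrightarrow> card M = m
      \<Longrightarrow> \<omega> \<in> PiE I W \<Longrightarrow> d * real (card (PiE I W))
        \<le> real (card {\<omega>' \<in> PiE I W. ind (S \<union> M) (override_on \<omega> \<omega>' {i. supp i \<subseteq> S \<union> M \<and> \<not> supp i \<subseteq> S})})"
    and d: "d \<le> 1" and \<epsilon>: "0 < \<epsilon>" "\<epsilon> \<le> 1"
    and num: "real N ^ l * (2 / \<epsilon>) * exp (- (\<epsilon>\<^sup>2 / 16) * real ((N - l) div m)) \<le> \<delta>"
  shows "real (card {\<omega> \<in> PiE I W. \<exists>S \<subseteq> {..<N}. card S = l \<and>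
      real (card {M. M \<subseteq> {..<N} - S \<and> card M = m \<and> ind (S \<union> M) \<omega>}) < (d - \<epsilon>) * real ((N - l) choose m)})
    \<le> \<delta> * real (card (PiE I W))"
proof -
  let ?\<Omega> = "PiE I W"
  define r where "r = (N - l) div m"
  define bad where "bad S = {\<omega> \<in> ?\<Omega>. real (card {M. M \<subseteq> {..<N} - S \<and> card M = m \<and> ind (S \<union> M) \<omega>})
     < (d - \<epsilon>) * real ((N - l) choose m)}" for S
  have finO: "finite ?\<Omega>" by (fact fin)
  have bad_le: "real (card (bad S)) \<le> (2 / \<epsilon>) * exp (- (\<epsilon>\<^sup>2 / 16) * real r) * real (card ?\<Omega>)"
    if S: "S \<subseteq> {..<N}" "card S = l" for S
  proof (cases "d - \<epsilon> \<le> 0")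
    case True
    have False if "\<omega> \<in> bad S" for \<omega>
    proof -
      have "real (card {M. M \<subseteq> {..<N} - S \<and> card M = m \<and> ind (S \<union> M) \<omega>}) < (d - \<epsilon>) * real ((N - l) choose m)"
        using that by (simp add: bad_def)
      moreover have "(d - \<epsilon>) * real ((N - l) choose m) \<le> 0" using True by (simp add: mult_le_0_iff)
      ultimately show False by linarith
    qed
    then have "bad S = {}" by auto
    then show ?thesis using \<epsilon> by simp
  next
    case False
    define U where "U = {..<N} - S"
    have finS: "finite S" using S finite_subset by blast
    have U: "finite U" "card U = N - l" using S finS by (auto simp: U_def card_Diff_subset)
    obtain b where b: "bij_betw b {0..<N - l} U" using ex_bij_betw_nat_finite[OF U(1)] U(2) by auto
    define B where "B j = b ` {j * m..<j * m + m}" for j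
    have rng: "{j * m..<j * m + m} \<subseteq> {0..<N - l}" if "j < r" for j
    proof -
      have "Suc j * m \<le> r * m" using that by (intro mult_le_mono1) auto
      also have "\<dots> \<le> N - l" by (simp add: r_def)
      finally show ?thesis by (simp add: add.commute)
    qed
    have B: "B j \<subseteq> U" "card (B j) = m" if "j < r" for j
    proof -
      have "B j \<subseteq> b ` {0..<N - l}" unfolding B_def by (rule image_mono[OF rng[OF that]])
      then show "B j \<subseteq> U" using b by (simp add: bij_betw_def)
      have "inj_on b {j * m..<j * m + m}"
        by (rule inj_on_subset[OF bij_betw_imp_inj_on[OF b] rng[OF that]])
      then show "card (B j) = m" by (simp add: B_def card_image)
    qed
    have Bdisj: "B i \<inter> B j = {}" if "i < r" "j < r" "i \<noteq> j" for i j
    proof -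
      have "{i * m..<i * m + m} \<inter> {j * m..<j * m + m} = {}"
      proof (rule ccontr)
        assume "{i * m..<i * m + m} \<inter> {j * m..<j * m + m} \<noteq> {}"
        then obtain x where "x \<in> {i * m..<i * m + m}" "x \<in> {j * m..<j * m + m}" by blast
        then have "i * m \<le> x" "x < i * m + m" "j * m \<le> x" "x < j * m + m" by auto
        then have "x div m = i" "x div m = j" using m by (auto intro!: div_nat_eqI simp: mult.commute)
        then show False using that by simp
      qed
      then show ?thesis
        using inj_on_image_Int[OF bij_betw_imp_inj_on[OF b] rng[OF that(1)] rng[OF that(2)]]
        unfolding B_def by (metis image_empty)
    qed
    define Y where "Y p \<omega> = real (card {j. j < r \<and> ind (S \<union> p ` B j) \<omega>})" for p \<omega>
    define P where "P = {p. p permutes U}"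
    have finP: "finite P" "card P = fact (N - l)" unfolding P_def by (rule finite_permutations[OF U(1)], rule card_permutations[OF U(2) U(1)])
    have pB: "p ` B j \<subseteq> U" "card (p ` B j) = m" if "j < r" "p \<in> P" for p j
    proof -
      have p: "p permutes U" using that by (simp add: P_def)
      show "p ` B j \<subseteq> U" using image_mono[OF B(1)[OF that(1)], of p] unfolding permutes_image[OF p] .
      have "inj_on p (B j)" using permutes_inj[OF p] by (rule inj_on_subset) simp
      then show "card (p ` B j) = m" using B(2)[OF that(1)] by (metis card_image)
    qed
    have tail: "real (card {\<omega> \<in> ?\<Omega>. Y p \<omega> < (d - \<epsilon> / 2) * real r}) \<le> exp (- (\<epsilon>\<^sup>2 / 16) * real r) * real (card ?\<Omega>)"
      if p: "p \<in> P" for p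
    proof -
      define J where "J j = {i. supp i \<subseteq> S \<union> p ` B j \<and> \<not> supp i \<subseteq> S}" for j
      have "real (card {\<omega> \<in> ?\<Omega>. real (card {j. j < r \<and> ind (S \<union> p ` B j) \<omega>}) < (d - \<epsilon> / 2) * real r})
        \<le> exp (- ((\<epsilon> / 2)\<^sup>2 / 4) * real r) * real (card ?\<Omega>)"
      proof (rule chernoff_lower_tail[where J = J])
        fix i j and \<omega> \<omega>' :: "'i \<Rightarrow> 'w" assume ij: "i < r" "j < r" "i \<noteq> j"
        have disj: "p ` B i \<inter> p ` B j = {}"
          using Bdisj[OF ij] B ij p permutes_inj[of p U] unfolding P_def
          by (metis image_Int image_empty mem_Collect_eq)
        show "ind (S \<union> p ` B i) (override_on \<omega> \<omega>' (J j)) = ind (S \<union> p ` B i) \<omega>"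
        proof (rule loc)
          show "S \<union> p ` B i \<subseteq> {..<N}" using S pB[OF ij(1) p] by (auto simp: U_def)
          show "card (S \<union> p ` B i) = l + m"
            using S finS pB[OF ij(1) p] U(1) finite_subset[OF pB(1)[OF ij(1) p] U(1)]
            by (subst card_Un_disjoint) (auto simp: U_def)
          fix x assume "supp x \<subseteq> S \<union> p ` B i"
          then have "x \<notin> J j" using disj unfolding J_def by blast
          then show "override_on \<omega> \<omega>' (J j) x = \<omega> x" by simp
        qed
      next
        fix j \<omega> assume "j < r" "\<omega> \<in> ?\<Omega>"
        then show "d * real (card ?\<Omega>) \<le> real (card {\<omega>' \<in> ?\<Omega>. ind (S \<union> p ` B j) (override_on \<omega> \<omega>' (J j))})"
          unfolding J_def using S pB[OF \<open>j < r\<close> p] by (intro mean) (auto simp: U_def)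
      qed (use fin ne d \<epsilon> False in auto)
      then show ?thesis by (simp add: Y_def power2_eq_square)
    qed
    \<comment> \<open>For a bad \<open>\<omega>\<close> the average of \<open>Y p \<omega>\<close> over \<open>p\<close> is below \<open>(d - \<epsilon>) * r\<close>, so a fraction \<open>\<epsilon> / 2\<close> of
      the permutations see less than \<open>(d - \<epsilon> / 2) * r\<close>.\<close>
    have many: "\<epsilon> / 2 * fact (N - l) \<le> real (card {p \<in> P. Y p \<omega> < (d - \<epsilon> / 2) * real r})"
      if \<omega>: "\<omega> \<in> bad S" for \<omega>
    proof (cases "r = 0")
      case True
      have "(N - l) choose m = 0" using True m by (auto simp: r_def binomial_eq_0_iff div_eq_0_iff)
      then have "(d - \<epsilon>) * real ((N - l) choose m) = 0" by (simp only: of_nat_0 mult_zero_right)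
      moreover have "real (card {M. M \<subseteq> {..<N} - S \<and> card M = m \<and> ind (S \<union> M) \<omega>}) < (d - \<epsilon>) * real ((N - l) choose m)"
        using \<omega> unfolding bad_def by blast
      ultimately have False by linarith
      then show ?thesis ..
    next
      case r0: False
      define C where "C = real ((N - l) choose m)"
      define deg where "deg = real (card {M. M \<subseteq> U \<and> card M = m \<and> ind (S \<union> M) \<omega>})"
      have C0: "C > 0" using r0 m by (auto simp: C_def r_def div_eq_0_iff)
      have "C * (\<Sum>p\<in>P. Y p \<omega>) = C * (\<Sum>p\<in>P. \<Sum>j<r. if ind (S \<union> p ` B j) \<omega> then 1 else 0)"
        unfolding Y_def by (simp add: sum.If_cases lessThan_def Int_def)
      also have "\<dots> = (\<Sum>j<r. C * (\<Sum>p\<in>P. if ind (S \<union> p ` B j) \<omega> then 1 else 0))"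
        by (subst sum.swap) (simp add: sum_distrib_left)
      also have "\<dots> = (\<Sum>j<r. fact (N - l) * deg)"
      proof (rule sum.cong)
        fix j assume "j \<in> {..<r}"
        then have "j < r" by simp
        have "C * (\<Sum>p\<in>P. if ind (S \<union> p ` B j) \<omega> then 1 else 0)
          = fact (N - l) * (\<Sum>M | M \<subseteq> U \<and> card M = m. if ind (S \<union> M) \<omega> then 1 else 0)"
          using average_over_permutations[OF U(1) B(1)[OF \<open>j < r\<close>], of "\<lambda>M. if ind (S \<union> M) \<omega> then 1 else 0"]
            B(2)[OF \<open>j < r\<close>] U(2) by (simp add: C_def P_def)
        also have "(\<Sum>M | M \<subseteq> U \<and> card M = m. if ind (S \<union> M) \<omega> then 1 else 0) = deg"
          using U(1) by (simp add: deg_def sum.If_cases Int_def conj_assoc)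
        finally show "C * (\<Sum>p\<in>P. if ind (S \<union> p ` B j) \<omega> then 1 else 0) = fact (N - l) * deg" .
      qed simp
      finally have sumY: "C * (\<Sum>p\<in>P. Y p \<omega>) = real r * (fact (N - l) * deg)" by simp
      have "deg < (d - \<epsilon>) * C" using \<omega> by (simp add: bad_def deg_def C_def U_def)
      then have "real r * (fact (N - l) * deg) < real r * (fact (N - l) * ((d - \<epsilon>) * C))"
        using r0 by (simp del: of_nat_fact)
      then have "C * (\<Sum>p\<in>P. Y p \<omega>) < C * (real r * fact (N - l) * (d - \<epsilon>))"
        by (simp add: sumY mult_ac)
      then have lt: "(\<Sum>p\<in>P. Y p \<omega>) < real r * fact (N - l) * (d - \<epsilon>)"
        using C0 by (simp only: mult_less_cancel_left_pos)
      let ?G = "{p \<in> P. \<not> Y p \<omega> < (d - \<epsilon> / 2) * real r}" and ?Bp = "{p \<in> P. Y p \<omega> < (d - \<epsilon> / 2) * real r}"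
      have "real (card ?G) * ((d - \<epsilon> / 2) * real r) \<le> (\<Sum>p\<in>?G. Y p \<omega>)"
        using sum_mono[of ?G "\<lambda>_. (d - \<epsilon> / 2) * real r" "\<lambda>p. Y p \<omega>"] by auto
      also have "\<dots> \<le> (\<Sum>p\<in>P. Y p \<omega>)" using finP by (intro sum_mono2) (auto simp: Y_def)
      finally have "real (card ?G) * ((d - \<epsilon> / 2) * real r) < real r * fact (N - l) * (d - \<epsilon>)" using lt by linarith
      then have "real r * (real (card ?G) * (d - \<epsilon> / 2)) < real r * (fact (N - l) * (d - \<epsilon>))" by (simp add: mult_ac)
      then have G: "real (card ?G) * (d - \<epsilon> / 2) < fact (N - l) * (d - \<epsilon>)"
        using r0 by (simp del: of_nat_fact)
      have "card (?G \<union> ?Bp) = card ?G + card ?Bp"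
        using finP(1) by (intro card_Un_disjoint) auto
      moreover have "?G \<union> ?Bp = P" by blast
      ultimately have "real (card P) = real (card ?G) + real (card ?Bp)" by (simp only: of_nat_add)
      moreover have "real (card P) = fact (N - l)" unfolding finP(2) by simp
      ultimately have eq: "real (card ?Bp) = fact (N - l) - real (card ?G)" by linarith
      have "\<epsilon> / 2 * fact (N - l) \<le> (d - \<epsilon> / 2) * real (card ?Bp)"
        unfolding eq using G by (simp add: algebra_simps)
      also have "\<dots> \<le> 1 * real (card ?Bp)" using d \<epsilon> by (intro mult_right_mono) auto
      finally show ?thesis by simp
    qed
    have "\<epsilon> / 2 * fact (N - l) * real (card (bad S)) = (\<Sum>\<omega>\<in>bad S. \<epsilon> / 2 * fact (N - l))" by simp
    also have "\<dots> \<le> (\<Sum>\<omega>\<in>bad S. real (card {p \<in> P. Y p \<omega> < (d - \<epsilon> / 2) * real r}))"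
      using many by (intro sum_mono)
    also have "\<dots> \<le> (\<Sum>\<omega>\<in>?\<Omega>. real (card {p \<in> P. Y p \<omega> < (d - \<epsilon> / 2) * real r}))"
      using finO by (intro sum_mono2) (auto simp: bad_def)
    also have "\<dots> = (\<Sum>\<omega>\<in>?\<Omega>. \<Sum>p\<in>P. if Y p \<omega> < (d - \<epsilon> / 2) * real r then 1 else 0)"
      using finP by (simp add: sum.If_cases Int_def)
    also have "\<dots> = (\<Sum>p\<in>P. \<Sum>\<omega>\<in>?\<Omega>. if Y p \<omega> < (d - \<epsilon> / 2) * real r then 1 else 0)"
      by (rule sum.swap)
    also have "\<dots> = (\<Sum>p\<in>P. real (card {\<omega> \<in> ?\<Omega>. Y p \<omega> < (d - \<epsilon> / 2) * real r}))"
      using finO by (simp add: sum.If_cases Int_def)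
    also have "\<dots> \<le> (\<Sum>p\<in>P. exp (- (\<epsilon>\<^sup>2 / 16) * real r) * real (card ?\<Omega>))"
      using tail by (intro sum_mono)
    also have "\<dots> = fact (N - l) * (exp (- (\<epsilon>\<^sup>2 / 16) * real r) * real (card ?\<Omega>))" using finP by simp
    finally have "fact (N - l) * (\<epsilon> / 2 * real (card (bad S))) \<le> fact (N - l) * (exp (- (\<epsilon>\<^sup>2 / 16) * real r) * real (card ?\<Omega>))"
      by (simp add: mult_ac)
    then have "\<epsilon> / 2 * real (card (bad S)) \<le> exp (- (\<epsilon>\<^sup>2 / 16) * real r) * real (card ?\<Omega>)"
      by (simp only: mult_le_cancel_left_pos fact_gt_zero)
    then show ?thesis using \<epsilon> by (simp add: field_simps)
  qed
  let ?Ss = "{S. S \<subseteq> {..<N} \<and> card S = l}"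
  have finSs: "finite ?Ss" by (rule finite_subset[of _ "Pow {..<N}"]) auto
  have cardSs: "real (card ?Ss) \<le> real N ^ l"
  proof -
    have "card ?Ss = N choose l" using n_subsets[of "{..<N}" l] by simp
    also have "\<dots> \<le> (N choose l) * fact l" by simp
    also have "\<dots> \<le> N ^ l" by (rule binomial_fact_pow)
    finally have "real (card ?Ss) \<le> real (N ^ l)" by (simp only: of_nat_le_iff)
    then show ?thesis by simp
  qed
  have "{\<omega> \<in> ?\<Omega>. \<exists>S \<subseteq> {..<N}. card S = l \<and>
      real (card {M. M \<subseteq> {..<N} - S \<and> card M = m \<and> ind (S \<union> M) \<omega>}) < (d - \<epsilon>) * real ((N - l) choose m)}
    = (\<Union>S\<in>?Ss. bad S)" by (auto simp: bad_def)
  also have "real (card \<dots>) \<le> real (\<Sum>S\<in>?Ss. card (bad S))"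
    using card_UN_le[OF finSs] by (simp only: of_nat_le_iff)
  also have "\<dots> \<le> (\<Sum>S\<in>?Ss. (2 / \<epsilon>) * exp (- (\<epsilon>\<^sup>2 / 16) * real r) * real (card ?\<Omega>))"
    unfolding of_nat_sum using bad_le by (intro sum_mono) auto
  also have "\<dots> = real (card ?Ss) * ((2 / \<epsilon>) * exp (- (\<epsilon>\<^sup>2 / 16) * real r) * real (card ?\<Omega>))" by simp
  also have "\<dots> \<le> real N ^ l * ((2 / \<epsilon>) * exp (- (\<epsilon>\<^sup>2 / 16) * real r) * real (card ?\<Omega>))"
    using cardSs \<epsilon> by (intro mult_right_mono) auto
  also have "\<dots> = (real N ^ l * (2 / \<epsilon>) * exp (- (\<epsilon>\<^sup>2 / 16) * real r)) * real (card ?\<Omega>)" by (simp add: mult_ac)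
  also have "\<dots> \<le> \<delta> * real (card ?\<Omega>)" using num by (intro mult_right_mono) (auto simp: r_def)
  finally show ?thesis .
qed

lemma union_bound_tends_to_zero:
  assumes "0 < (\<epsilon>::real)" "0 < m" "0 < \<delta>"
  shows "\<forall>\<^sub>F N in sequentially. real N ^ l * (2 / \<epsilon>) * exp (- (\<epsilon>\<^sup>2 / 16) * real ((N - l) div m)) \<le> \<delta>"
proof -
  define c where "c = \<epsilon>\<^sup>2 / (16 * real m)"
  define A where "A = (2 / \<epsilon>) * exp (\<epsilon>\<^sup>2 / 16 * (real l + 1))"
  have c: "c > 0" using assms by (simp add: c_def)
  have "((\<lambda>x::real. x ^ l / exp x) \<longlongrightarrow> 0) at_top" by (rule tendsto_power_div_exp_0)
  moreover have "filterlim (\<lambda>N. c * real N) at_top sequentially"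
    using c by (intro filterlim_tendsto_pos_mult_at_top[OF tendsto_const]) (auto intro: filterlim_real_sequentially)
  ultimately have "(\<lambda>N. (c * real N) ^ l / exp (c * real N)) \<longlonglongrightarrow> 0"
    by (rule filterlim_compose)
  then have "(\<lambda>N. A / c ^ l * ((c * real N) ^ l / exp (c * real N))) \<longlonglongrightarrow> A / c ^ l * 0"
    by (intro tendsto_intros)
  then have "\<forall>\<^sub>F N in sequentially. A / c ^ l * ((c * real N) ^ l / exp (c * real N)) < \<delta>"
    using assms by (intro order_tendstoD(2)) auto
  then show ?thesis using eventually_ge_at_top[of l]
  proof eventually_elim
    case (elim N)
    have "real (N - l) / real m - 1 \<le> real ((N - l) div m)"
    proof -
      have "N - l < Suc ((N - l) div m) * m" using assms(2)
        by (metis add.commute dividend_less_div_times mult_Suc)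
      then have "real (N - l) < (real ((N - l) div m) + 1) * real m"
        by (metis of_nat_Suc of_nat_less_iff of_nat_mult add.commute)
      then show ?thesis using assms(2) by (simp add: field_simps)
    qed
    moreover have "real N / real m - real l \<le> real (N - l) / real m"
    proof -
      have "real l \<le> real l * real m" using assms(2) by (cases m) (auto simp: algebra_simps)
      then have "real l / real m \<le> real l" using assms(2) by (simp add: divide_le_eq)
      then show ?thesis using elim by (simp add: of_nat_diff diff_divide_distrib)
    qed
    ultimately have "real N / real m - (real l + 1) \<le> real ((N - l) div m)" by linarith
    then have "(\<epsilon>\<^sup>2 / 16) * (real N / real m - (real l + 1)) \<le> (\<epsilon>\<^sup>2 / 16) * real ((N - l) div m)"
      by (intro mult_left_mono) auto
    then have "- (\<epsilon>\<^sup>2 / 16) * real ((N - l) div m) \<le> \<epsilon>\<^sup>2 / 16 * (real l + 1) - c * real N"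
      using right_diff_distrib[of "\<epsilon>\<^sup>2 / 16" "real N / real m" "real l + 1"] by (simp add: c_def)
    then have "exp (- (\<epsilon>\<^sup>2 / 16) * real ((N - l) div m)) \<le> exp (\<epsilon>\<^sup>2 / 16 * (real l + 1)) / exp (c * real N)"
      by (simp add: exp_diff[symmetric])
    then have "real N ^ l * (2 / \<epsilon>) * exp (- (\<epsilon>\<^sup>2 / 16) * real ((N - l) div m))
      \<le> real N ^ l * (2 / \<epsilon>) * (exp (\<epsilon>\<^sup>2 / 16 * (real l + 1)) / exp (c * real N))"
      using assms by (intro mult_left_mono) auto
    also have "\<dots> = A / c ^ l * ((c * real N) ^ l / exp (c * real N))"
      using c by (simp add: A_def power_mult_distrib)
    finally show ?case using elim by linarith
  qed
qed

section \<open>Sampling\<close>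

lemma PiE_split_bij:
  assumes "A \<subseteq> I"
  shows "bij_betw (\<lambda>(z, y) i. if i \<in> A then z i else y i) (PiE A W \<times> PiE (I - A) W) (PiE I W)"
proof (rule bij_betw_byWitness[where f'="\<lambda>\<omega>. (restrict \<omega> A, restrict \<omega> (I - A))"])
  show "\<forall>a\<in>PiE A W \<times> PiE (I - A) W. (\<lambda>\<omega>. (restrict \<omega> A, restrict \<omega> (I - A)))
      ((\<lambda>(z, y) i. if i \<in> A then z i else y i) a) = a"
    by (auto simp: fun_eq_iff PiE_def extensional_def restrict_def)
  show "\<forall>a'\<in>PiE I W. (\<lambda>(z, y) i. if i \<in> A then z i else y i) (restrict a' A, restrict a' (I - A)) = a'"
    using assms by (auto simp: fun_eq_iff PiE_def extensional_def restrict_def)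
  show "(\<lambda>(z, y) i. if i \<in> A then z i else y i) ` (PiE A W \<times> PiE (I - A) W) \<subseteq> PiE I W"
    using assms by (auto simp: PiE_def Pi_def extensional_def)
  show "(\<lambda>\<omega>. (restrict \<omega> A, restrict \<omega> (I - A))) ` PiE I W \<subseteq> PiE A W \<times> PiE (I - A) W"
    using assms by (auto simp: PiE_def Pi_def extensional_def)
qed

lemma card_PiE_independent:
  assumes A: "A \<subseteq> I" and Q: "\<And>\<omega> \<omega>'. (\<And>i. i \<in> I - A \<Longrightarrow> \<omega> i = \<omega>' i) \<Longrightarrow> Q \<omega> = Q \<omega>'"
  shows "card {\<omega> \<in> PiE I W. P (restrict \<omega> A) \<and> Q \<omega>} = card {z \<in> PiE A W. P z} * card {y \<in> PiE (I - A) W. Q y}"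
proof -
  let ?f = "\<lambda>(z, y) i. if i \<in> A then z i else y i"
  have bij: "bij_betw ?f (PiE A W \<times> PiE (I - A) W) (PiE I W)" by (rule PiE_split_bij[OF A])
  have res: "restrict (\<lambda>i. if i \<in> A then z i else y i) A = z" if "z \<in> PiE A W" for z y
    using that by (auto simp: fun_eq_iff PiE_def extensional_def restrict_def)
  have Qf: "Q (\<lambda>i. if i \<in> A then z i else y i) = Q y" for z y by (rule Q) simp
  have "bij_betw ?f ({z \<in> PiE A W. P z} \<times> {y \<in> PiE (I - A) W. Q y}) {\<omega> \<in> PiE I W. P (restrict \<omega> A) \<and> Q \<omega>}"
    using bij
  proof (rule bij_betw_subset)
    show "?f ` ({z \<in> PiE A W. P z} \<times> {y \<in> PiE (I - A) W. Q y}) = {\<omega> \<in> PiE I W. P (restrict \<omega> A) \<and> Q \<omega>}"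
    proof (intro equalityI subsetI)
      fix \<omega> assume "\<omega> \<in> ?f ` ({z \<in> PiE A W. P z} \<times> {y \<in> PiE (I - A) W. Q y})"
      then obtain z y where z: "z \<in> PiE A W" "P z" "y \<in> PiE (I - A) W" "Q y" "\<omega> = ?f (z, y)" by auto
      then have "\<omega> \<in> PiE I W" using bij by (auto simp: bij_betw_def)
      then show "\<omega> \<in> {\<omega> \<in> PiE I W. P (restrict \<omega> A) \<and> Q \<omega>}" using z res Qf by auto
    next
      fix \<omega> assume w: "\<omega> \<in> {\<omega> \<in> PiE I W. P (restrict \<omega> A) \<and> Q \<omega>}"
      then have "\<omega> \<in> ?f ` (PiE A W \<times> PiE (I - A) W)" using bij by (auto simp: bij_betw_def)
      then obtain z y where z: "z \<in> PiE A W" "y \<in> PiE (I - A) W" "\<omega> = ?f (z, y)" by auto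
      then have "P z" "Q y" using w res Qf by auto
      then show "\<omega> \<in> ?f ` ({z \<in> PiE A W. P z} \<times> {y \<in> PiE (I - A) W. Q y})" using z by blast
    qed
  qed auto
  from bij_betw_same_card[OF this] show ?thesis by (simp only: card_cartesian_product)
qed

lemma card_PiE_marginal:
  assumes "A \<subseteq> I"
  shows "card {\<omega> \<in> PiE I W. P (restrict \<omega> A)} * card (PiE A W) = card (PiE I W) * card {z \<in> PiE A W. P z}"
proof -
  have "card {\<omega> \<in> PiE I W. P (restrict \<omega> A) \<and> True} = card {z \<in> PiE A W. P z} * card {y \<in> PiE (I - A) W. True}"
    by (rule card_PiE_independent[OF assms]) simp
  moreover have "card {\<omega> \<in> PiE I W. True \<and> True} = card {z \<in> PiE A W. True} * card {y \<in> PiE (I - A) W. True}"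
    by (rule card_PiE_independent[OF assms, where P = "\<lambda>_. True"]) simp
  ultimately show ?thesis by simp
qed

text \<open>Given the other coordinates, \<open>h\<close> is a fixed value while \<open>\<omega> i\<close> is still uniform on \<open>W i\<close>.\<close>

lemma card_coordinate_agrees:
  assumes fin: "finite (PiE I W)" and i: "i \<in> I" and h: "\<And>\<omega> x. h (fun_upd \<omega> i x) = h \<omega>"
  shows "card {\<omega> \<in> PiE I W. \<omega> i = h \<omega>} * card (W i) \<le> card (PiE I W)"
proof -
  have "inj_on (\<lambda>(\<omega>, x). fun_upd \<omega> i x) ({\<omega> \<in> PiE I W. \<omega> i = h \<omega>} \<times> W i)"
  proof (rule inj_onI, clarsimp)
    fix \<omega> x \<omega>' x'
    assume eq: "\<omega> i = h \<omega>" "\<omega>' i = h \<omega>'" "fun_upd \<omega> i x = fun_upd \<omega>' i x'"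
    then have "h \<omega> = h \<omega>'" using h by metis
    then have "\<omega> i = \<omega>' i" using eq by simp
    moreover have "\<omega> j = \<omega>' j" if "j \<noteq> i" for j using fun_cong[OF eq(3), of j] that by simp
    ultimately have "\<omega> = \<omega>'" by (metis ext)
    moreover have "x = x'" using fun_cong[OF eq(3), of i] by simp
    ultimately show "\<omega> = \<omega>' \<and> x = x'" ..
  qed
  moreover have "(\<lambda>(\<omega>, x). fun_upd \<omega> i x) ` ({\<omega> \<in> PiE I W. \<omega> i = h \<omega>} \<times> W i) \<subseteq> PiE I W"
    using i by (auto simp: PiE_def Pi_def extensional_def)
  ultimately have "card ({\<omega> \<in> PiE I W. \<omega> i = h \<omega>} \<times> W i) \<le> card (PiE I W)"
    by (rule card_inj_on_le[OF _ _ fin])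
  then show ?thesis by (simp only: card_cartesian_product)
qed

lemma card_not_injective:
  assumes "finite V" "V \<noteq> {}"
  shows "real (card {\<omega> \<in> {..<N} \<rightarrow>\<^sub>E V. \<not> inj_on \<omega> {..<N}}) * real (card V) \<le> real N ^ 2 * real (card V) ^ N"
proof -
  let ?\<Omega> = "{..<N} \<rightarrow>\<^sub>E V"
  have fin: "finite ?\<Omega>" using assms by (intro finite_PiE) auto
  let ?A = "\<lambda>(i, j). {\<omega> \<in> ?\<Omega>. i \<noteq> j \<and> \<omega> i = \<omega> j}"
  have A: "card (?A p) * card V \<le> card V ^ N" if "p \<in> {..<N} \<times> {..<N}" for p
  proof (cases "fst p = snd p")
    case True then show ?thesis by (cases p) auto
  next
    case False
    then have "?A p = {\<omega> \<in> ?\<Omega>. \<omega> (fst p) = \<omega> (snd p)}" by (cases p) auto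
    then show ?thesis
      using card_coordinate_agrees[OF fin, of "fst p" "\<lambda>\<omega>. \<omega> (snd p)"] that False
      by (auto simp: card_PiE)
  qed
  have "{\<omega> \<in> ?\<Omega>. \<not> inj_on \<omega> {..<N}} \<subseteq> (\<Union>p\<in>{..<N} \<times> {..<N}. ?A p)"
    by (auto simp: inj_on_def)
  then have "card {\<omega> \<in> ?\<Omega>. \<not> inj_on \<omega> {..<N}} \<le> card (\<Union>p\<in>{..<N} \<times> {..<N}. ?A p)"
    by (rule card_mono[rotated]) (use fin in auto)
  also have "\<dots> \<le> (\<Sum>p\<in>{..<N} \<times> {..<N}. card (?A p))" by (rule card_UN_le) auto
  finally have "card {\<omega> \<in> ?\<Omega>. \<not> inj_on \<omega> {..<N}} * card V \<le> (\<Sum>p\<in>{..<N} \<times> {..<N}. card (?A p) * card V)"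
    by (simp add: sum_distrib_right[symmetric])
  also have "\<dots> \<le> (\<Sum>p\<in>{..<N} \<times> {..<N}. card V ^ N)" using A by (intro sum_mono)
  also have "\<dots> = N ^ 2 * card V ^ N" by (simp add: power2_eq_square)
  finally have "real (card {\<omega> \<in> ?\<Omega>. \<not> inj_on \<omega> {..<N}} * card V) \<le> real (N ^ 2 * card V ^ N)"
    by (simp only: of_nat_le_iff)
  then show ?thesis by simp
qed

definition hg_pullback :: "nat \<Rightarrow> nat \<Rightarrow> (nat \<Rightarrow> 'a) \<Rightarrow> 'a hypergraph \<Rightarrow> nat hypergraph" where
  "hg_pullback k N \<omega> H = ({..<N}, {e. e \<subseteq> {..<N} \<and> card e = k \<and> \<omega> ` e \<in> edges H})"

lemma pullback_verts [simp]: "verts (hg_pullback k N \<omega> H) = {..<N}"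
  by (simp add: hg_pullback_def)

lemma pullback_edges: "e \<in> edges (hg_pullback k N \<omega> H) \<longleftrightarrow> e \<subseteq> {..<N} \<and> card e = k \<and> \<omega> ` e \<in> edges H"
  by (simp add: hg_pullback_def)

lemma pullback_kgraph: "kgraph k (hg_pullback k N \<omega> H)"
  by (simp add: hg_pullback_def kgraph_def)

lemma pullback_emb:
  assumes "\<omega> \<in> {..<N} \<rightarrow>\<^sub>E verts H" "inj_on \<omega> {..<N}"
  shows "hg_emb (hg_pullback k N \<omega> H) H"
  unfolding hg_emb_def by (rule exI[of _ \<omega>]) (use assms in \<open>auto simp: pullback_edges\<close>)

lemma eventually_density_slack:
  assumes "c < (d::real)"
  shows "\<forall>\<^sub>F N in sequentially. c * real N ^ m < d * (fact m * real ((N - l) choose m))"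
proof -
  have "(\<lambda>N. d * (fact m * real ((N - l) choose m) / real N ^ m)) \<longlonglongrightarrow> d * 1"
    by (intro tendsto_intros choose_asymptotics)
  then have "\<forall>\<^sub>F N in sequentially. c < d * (fact m * real ((N - l) choose m) / real N ^ m)"
    using assms by (intro order_tendstoD(1)) auto
  then show ?thesis using eventually_gt_at_top[of 0]
  proof eventually_elim
    case (elim N)
    then show ?case by (simp add: field_simps)
  qed
qed

text \<open>At least half of the \<open>N\<close>-vertex samples inherit the minimum \<open>l\<close>-degree. The threshold for \<open>N\<close>
  depends on the loss \<open>d - c\<close> only and not on the hypergraph that is sampled.\<close>

lemma samples_are_dense:
  assumes "l < k" "c < d" "d \<le> 1"
  shows "\<forall>\<^sub>F N in sequentially. \<forall>H :: 'a hypergraph. kgraph k H \<and> ldense k l d H \<and> 4 * N ^ 2 < card (verts H) \<longrightarrow>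
    real (card (verts H)) ^ N / 2 \<le>
      real (card {\<omega> \<in> {..<N} \<rightarrow>\<^sub>E verts H. inj_on \<omega> {..<N} \<and> ldense k l c (hg_pullback k N \<omega> H)})"
proof -
  define m where "m = k - l"
  have m: "0 < m" "l + m = k" using assms by (auto simp: m_def)
  define \<epsilon> where "\<epsilon> = min 1 ((d - c) / 2)"
  have \<epsilon>: "0 < \<epsilon>" "\<epsilon> \<le> 1" "c < d - \<epsilon>" using assms by (auto simp: \<epsilon>_def min_def field_simps)
  show ?thesis
    using union_bound_tends_to_zero[OF \<epsilon>(1) m(1), of "1/4" l, simplified] eventually_density_slack[OF \<epsilon>(3), of m l]
  proof eventually_elim
    case (elim N)
    show ?case
    proof (intro allI impI)
      fix H :: "'a hypergraph" assume H: "kgraph k H \<and> ldense k l d H \<and> 4 * N ^ 2 < card (verts H)"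
      let ?V = "verts H"
      let ?\<Omega> = "{..<N} \<rightarrow>\<^sub>E ?V"
      define n where "n = card ?V"
      have finV: "finite ?V" using H kgraph_finite by blast
      have n0: "0 < n" using H by (simp add: n_def)
      then have neV: "?V \<noteq> {}" by (auto simp: n_def)
      have fin\<Omega>: "finite ?\<Omega>" using finV by (intro finite_PiE) auto
      have ne\<Omega>: "?\<Omega> \<noteq> {}" using neV by (simp add: PiE_eq_empty_iff)
      have card\<Omega>: "card ?\<Omega> = n ^ N" by (simp add: card_PiE n_def)
      \<comment> \<open>Counting the sets with repeated images as edges keeps the conditional probabilities above \<open>d\<close>
        even if \<open>S\<close> has repetitions; few samples are affected.\<close>
      define ind where "ind e \<omega> \<longleftrightarrow> \<omega> ` e \<in> edges H \<or> \<not> inj_on \<omega> e" for e and \<omega> :: "nat \<Rightarrow> 'a"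
      let ?bad = "{\<omega> \<in> ?\<Omega>. \<exists>S \<subseteq> {..<N}. card S = l \<and>
        real (card {M. M \<subseteq> {..<N} - S \<and> card M = m \<and> ind (S \<union> M) \<omega>}) < (d - \<epsilon>) * real ((N - l) choose m)}"
      have "real (card ?bad) \<le> 1/4 * real (card ?\<Omega>)"
      proof (rule random_local_hypergraph[where supp = "\<lambda>i. {i}"])
        fix e and \<omega> \<omega>' :: "nat \<Rightarrow> 'a" assume "\<And>i. {i} \<subseteq> e \<Longrightarrow> \<omega> i = \<omega>' i"
        then have eq: "\<omega> i = \<omega>' i" if "i \<in> e" for i using that by simp
        have "\<omega> ` e = \<omega>' ` e" by (rule image_cong[OF refl eq])
        moreover have "inj_on \<omega> e = inj_on \<omega>' e" by (rule inj_on_cong[OF eq])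
        ultimately show "ind e \<omega> = ind e \<omega>'" by (simp add: ind_def)
      next
        fix S M \<omega> assume S: "S \<subseteq> {..<N}" and M: "M \<subseteq> {..<N}" and SM: "S \<inter> M = {}" "card S = l" "card M = m"
          and \<omega>: "\<omega> \<in> ?\<Omega>"
        have J: "{i. {i} \<subseteq> S \<union> M \<and> \<not> {i} \<subseteq> S} = M" using SM by auto
        have finM: "finite M" using M finite_subset by blast
        let ?R = "{\<omega>' \<in> ?\<Omega>. ind (S \<union> M) (override_on \<omega> \<omega>' M)}"
        show "d * real (card ?\<Omega>) \<le> real (card {\<omega>' \<in> ?\<Omega>. ind (S \<union> M) (override_on \<omega> \<omega>' {i. {i} \<subseteq> S \<union> M \<and> \<not> {i} \<subseteq> S})})"
        proof (cases "inj_on \<omega> S")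
          case False
          have "\<not> inj_on (override_on \<omega> \<omega>' M) (S \<union> M)" for \<omega>'
          proof
            assume "inj_on (override_on \<omega> \<omega>' M) (S \<union> M)"
            then have "inj_on (override_on \<omega> \<omega>' M) S" by (rule inj_on_subset) auto
            moreover have "override_on \<omega> \<omega>' M x = \<omega> x" if "x \<in> S" for x
              using that SM by (auto simp: override_on_def)
            ultimately show False using False by (metis inj_on_cong)
          qed
          then have "?R = ?\<Omega>" by (auto simp: ind_def)
          moreover have "d * real (card ?\<Omega>) \<le> 1 * real (card ?\<Omega>)" using assms(3) by (intro mult_right_mono) auto
          ultimately show ?thesis unfolding J by simp
        next
          case True
          define S' where "S' = \<omega> ` S"
          have S': "S' \<subseteq> ?V" "card S' = l" using \<omega> S True SM by (auto simp: S'_def card_image)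
          have finS': "finite S'" using S' finV finite_subset by blast
          define \<E> where "\<E> = {X. X \<subseteq> ?V - S' \<and> card X = m \<and> S' \<union> X \<in> edges H}"
          have deg: "hg_degree H S' = card \<E>"
            using degree_eq_card_completions[of k H S' l] H S' assms by (simp add: \<E>_def m_def)
          have sub: "{\<omega>' \<in> ?\<Omega>. restrict \<omega>' M ` M \<in> \<E>} \<subseteq> ?R"
          proof (intro subsetI)
            fix \<omega>' assume w: "\<omega>' \<in> {\<omega>' \<in> ?\<Omega>. restrict \<omega>' M ` M \<in> \<E>}"
            have "override_on \<omega> \<omega>' M ` (S \<union> M) = \<omega> ` S \<union> \<omega>' ` M"
              using SM by (auto simp: override_on_def image_iff Bex_def)
            also have "\<dots> = S' \<union> restrict \<omega>' M ` M" by (simp add: S'_def)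
            finally show "\<omega>' \<in> ?R" using w by (auto simp: ind_def \<E>_def)
          qed
          have "card {\<omega>' \<in> ?\<Omega>. restrict \<omega>' M ` M \<in> \<E>} * card (M \<rightarrow>\<^sub>E ?V) = card ?\<Omega> * card {z \<in> M \<rightarrow>\<^sub>E ?V. z ` M \<in> \<E>}"
            by (rule card_PiE_marginal[OF M])
          moreover have "card {z \<in> M \<rightarrow>\<^sub>E ?V. z ` M \<in> \<E>} = fact m * card \<E>"
            using card_funcs_onto_edges[OF finM finV, of \<E>] SM by (auto simp: \<E>_def)
          moreover have "card (M \<rightarrow>\<^sub>E ?V) = n ^ m" using finM SM by (simp add: card_PiE n_def)
          ultimately have eqM: "card {\<omega>' \<in> ?\<Omega>. restrict \<omega>' M ` M \<in> \<E>} * n ^ m = card ?\<Omega> * (fact m * card \<E>)" by simp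
          have "card {\<omega>' \<in> ?\<Omega>. restrict \<omega>' M ` M \<in> \<E>} \<le> card ?R"
            using fin\<Omega> by (intro card_mono[OF _ sub]) auto
          from mult_le_mono1[OF this, of "n ^ m"]
          have "card ?\<Omega> * (fact m * card \<E>) \<le> card ?R * n ^ m" unfolding eqM .
          then have "real (card ?\<Omega> * (fact m * card \<E>)) \<le> real (card ?R * n ^ m)" by (simp only: of_nat_le_iff)
          then have 1: "real (card ?\<Omega>) * (fact m * real (card \<E>)) \<le> real (card ?R) * real n ^ m" by simp
          have "d * real n ^ m \<le> fact m * real (card \<E>)"
            unfolding deg[symmetric] using H S' by (simp add: ldense_def n_def m_def)
          then have "real (card ?\<Omega>) * (d * real n ^ m) \<le> real (card ?\<Omega>) * (fact m * real (card \<E>))"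
            by (intro mult_left_mono) auto
          with 1 have "(d * real (card ?\<Omega>)) * real n ^ m \<le> real (card ?R) * real n ^ m"
            by (simp add: mult_ac)
          then show ?thesis unfolding J using n0 by simp
        qed
      qed (use fin\<Omega> ne\<Omega> m \<epsilon> assms elim(1) in \<open>auto simp: mult_ac\<close>)
      then have bad: "real (card ?bad) \<le> real n ^ N / 4" by (simp add: card\<Omega>)
      let ?ninj = "{\<omega> \<in> ?\<Omega>. \<not> inj_on \<omega> {..<N}}"
      have "real (card ?ninj) * real n \<le> real N ^ 2 * real n ^ N"
        unfolding n_def by (rule card_not_injective[OF finV neV])
      also have "\<dots> \<le> (real n / 4) * real n ^ N"
      proof (intro mult_right_mono)
        have "4 * N ^ 2 < n" using H by (simp add: n_def)
        then have "real (4 * N ^ 2) < real n" by (simp only: of_nat_less_iff)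
        then show "real N ^ 2 \<le> real n / 4" by simp
      qed auto
      finally have ninj: "real (card ?ninj) \<le> real n ^ N / 4" using n0 by simp
      let ?good = "{\<omega> \<in> ?\<Omega>. inj_on \<omega> {..<N} \<and> ldense k l c (hg_pullback k N \<omega> H)}"
      have "?\<Omega> \<subseteq> ?good \<union> (?bad \<union> ?ninj)"
      proof
        fix \<omega> assume \<omega>: "\<omega> \<in> ?\<Omega>"
        show "\<omega> \<in> ?good \<union> (?bad \<union> ?ninj)"
        proof (cases "\<omega> \<in> ?bad \<union> ?ninj")
          case True then show ?thesis by blast
        next
          case False
          then have inj: "inj_on \<omega> {..<N}" using \<omega> by blast
          have "ldense k l c (hg_pullback k N \<omega> H)"
            unfolding ldense_def pullback_verts
          proof (intro allI impI)
            fix S assume S: "S \<subseteq> {..<N} \<and> card S = l"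
            let ?P = "hg_pullback k N \<omega> H"
            have "hg_degree ?P S = card {M. M \<subseteq> {..<N} - S \<and> card M = m \<and> S \<union> M \<in> edges ?P}"
              using degree_eq_card_completions[OF pullback_kgraph[of k N \<omega> H], of S l] S assms by (simp add: m_def)
            also have "{M. M \<subseteq> {..<N} - S \<and> card M = m \<and> S \<union> M \<in> edges ?P}
               = {M. M \<subseteq> {..<N} - S \<and> card M = m \<and> ind (S \<union> M) \<omega>}"
            proof (rule Collect_cong, rule conj_cong[OF refl], rule conj_cong[OF refl])
              fix M assume M: "M \<subseteq> {..<N} - S" "card M = m"
              have finS: "finite S" using S finite_subset by blast
              have finM: "finite M" using M finite_subset by blast
              have "card (S \<union> M) = k" using finS finM M S m by (subst card_Un_disjoint) auto
              moreover have "inj_on \<omega> (S \<union> M)" using M S by (intro inj_on_subset[OF inj]) auto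
              ultimately show "S \<union> M \<in> edges ?P \<longleftrightarrow> ind (S \<union> M) \<omega>"
                using S M by (auto simp: pullback_edges ind_def)
            qed
            finally have "(d - \<epsilon>) * real ((N - l) choose m) \<le> real (hg_degree ?P S)"
              using False \<omega> S by force
            then have "fact m * ((d - \<epsilon>) * real ((N - l) choose m)) \<le> fact m * real (hg_degree ?P S)"
              by (rule mult_left_mono) simp
            then have "(d - \<epsilon>) * (fact m * real ((N - l) choose m)) \<le> fact m * real (hg_degree ?P S)"
              by (simp only: mult.left_commute)
            then have "c * real N ^ m \<le> fact m * real (hg_degree ?P S)" using elim(2) by linarith
            then show "c * real (card {..<N}) ^ (k - l) \<le> fact (k - l) * real (hg_degree ?P S)"
              by (simp only: card_lessThan m_def)
          qed
          then show ?thesis using \<omega> inj by blast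
        qed
      qed
      then have "card ?\<Omega> \<le> card (?good \<union> (?bad \<union> ?ninj))"
        by (rule card_mono[rotated]) (use fin\<Omega> in auto)
      also have "\<dots> \<le> card ?good + (card ?bad + card ?ninj)"
        using card_Un_le[of ?good "?bad \<union> ?ninj"] card_Un_le[of ?bad ?ninj] by linarith
      finally have "real (card ?\<Omega>) \<le> real (card ?good + (card ?bad + card ?ninj))" by (simp only: of_nat_le_iff)
      then have "real n ^ N \<le> real (card ?good) + (real (card ?bad) + real (card ?ninj))" by (simp add: card\<Omega>)
      then show "real (card ?V) ^ N / 2 \<le> real (card ?good)" using bad ninj by (simp add: n_def)
    qed
  qed
qed

section \<open>Existence of the density\<close>

text \<open>The numbers \<open>d\<close> that the normalised extremal degree reaches at \<open>n\<close>. Working with these thresholds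
  avoids the minimum and the maximum in the definition of the density.\<close>

definition adm :: "nat \<Rightarrow> nat \<Rightarrow> nat \<Rightarrow> real \<Rightarrow> 'b hypergraph \<Rightarrow> bool" where
  "adm k l n d F \<longleftrightarrow> (\<exists>H :: nat hypergraph. kgraph k H \<and> card (verts H) = n \<and> ldense k l d H \<and> \<not> hg_emb F H)"

lemma degree_le:
  assumes "kgraph k H" "S \<subseteq> verts H" "card S = l" "l \<le> k"
  shows "fact (k - l) * real (hg_degree H S) \<le> real (card (verts H)) ^ (k - l)"
proof -
  have fin: "finite (verts H)" by (rule kgraph_finite[OF assms(1)])
  have finS: "finite S" by (rule finite_subset[OF assms(2) fin])
  have "hg_degree H S \<le> card {M. M \<subseteq> verts H - S \<and> card M = k - l}"
    unfolding degree_eq_card_completions[OF assms]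
    by (rule card_mono) (use fin in \<open>auto intro: finite_subset[of _ "Pow (verts H)"]\<close>)
  also have "\<dots> = (card (verts H) - l) choose (k - l)"
    using fin finS assms by (subst n_subsets) (auto simp: card_Diff_subset)
  finally have "fact (k - l) * real (hg_degree H S) \<le> fact (k - l) * real ((card (verts H) - l) choose (k - l))"
    by simp
  also have "\<dots> \<le> real (card (verts H) - l) ^ (k - l)" by (rule fact_choose_le_power)
  also have "\<dots> \<le> real (card (verts H)) ^ (k - l)" by (intro power_mono) auto
  finally show ?thesis .
qed

lemma ldense_le_1:
  assumes "kgraph k H" "ldense k l d H" "l \<le> k" "l \<le> card (verts H)" "0 < card (verts H)"
  shows "d \<le> 1"
proof -
  obtain S where S: "S \<subseteq> verts H" "card S = l"
    using obtain_subset_with_card_n[OF assms(4)] by metis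
  have "d * real (card (verts H)) ^ (k - l) \<le> fact (k - l) * real (hg_degree H S)"
    using assms S by (simp add: ldense_def)
  also have "\<dots> \<le> 1 * real (card (verts H)) ^ (k - l)" using degree_le[OF assms(1) S assms(3)] by simp
  finally show ?thesis using assms(5) by (simp only: mult_le_cancel_right_pos zero_less_power of_nat_0_less_iff)
qed

text \<open>A sample of a hypergraph without \<open>F\<close> has no copy of \<open>F\<close> either, and many samples keep the degrees.\<close>

lemma adm_sampling:
  assumes "l < k" "c < d" "d \<le> 1" and "\<exists>\<^sub>F n in sequentially. adm k l n d F"
  shows "\<forall>\<^sub>F N in sequentially. adm k l N c F"
  using samples_are_dense[OF assms(1-3), where ?'a = nat]
proof eventually_elim
  case (elim N)
  obtain n where n: "4 * N ^ 2 < n" "adm k l n d F"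
    using frequently_eventually_conj[OF assms(4) eventually_gt_at_top[of "4 * N ^ 2"]] frequently_ex by blast
  then obtain H :: "nat hypergraph" where H: "kgraph k H" "card (verts H) = n" "ldense k l d H" "\<not> hg_emb F H"
    by (auto simp: adm_def)
  let ?G = "{\<omega> \<in> {..<N} \<rightarrow>\<^sub>E verts H. inj_on \<omega> {..<N} \<and> ldense k l c (hg_pullback k N \<omega> H)}"
  have "real n ^ N / 2 \<le> real (card ?G)" using elim H n by blast
  moreover have "0 < real n ^ N / 2" using n by simp
  ultimately have "0 < real (card ?G)" by linarith
  then have "?G \<noteq> {}" by (metis card.empty of_nat_0 less_irrefl)
  then obtain \<omega> where \<omega>: "\<omega> \<in> ?G" by blast
  then have "\<not> hg_emb F (hg_pullback k N \<omega> H)"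
    using H(4) emb_trans pullback_emb by blast
  then show ?case using \<omega> pullback_kgraph[of k N \<omega> H] unfolding adm_def
    by (intro exI[of _ "hg_pullback k N \<omega> H"]) auto
qed

lemma adm_iff_ex_degree:
  assumes F: "kgraph k F" "edges F \<noteq> {}" and "l \<le> k" "l \<le> n"
  shows "adm k l n d F \<longleftrightarrow> d * real n ^ (k - l) \<le> fact (k - l) * real (ex_degree k l n F)"
proof -
  define X where "X = {min_degree l H | H :: nat hypergraph. kgraph k H \<and> card (verts H) = n \<and> hg_free F H}"
  have degs: "finite {hg_degree H S |S. S \<subseteq> verts H \<and> card S = l} \<and> {hg_degree H S |S. S \<subseteq> verts H \<and> card S = l} \<noteq> {}"
    if "kgraph k H" "card (verts H) = n" for H :: "nat hypergraph"
  proof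
    have "{hg_degree H S |S. S \<subseteq> verts H \<and> card S = l} \<subseteq> hg_degree H ` Pow (verts H)" by auto
    then show "finite {hg_degree H S |S. S \<subseteq> verts H \<and> card S = l}"
      using kgraph_finite[OF that(1)] finite_subset by blast
    have "l \<le> card (verts H)" using assms(4) that by simp
    then obtain S where "S \<subseteq> verts H" "card S = l" by (rule obtain_subset_with_card_n)
    then show "{hg_degree H S |S. S \<subseteq> verts H \<and> card S = l} \<noteq> {}" by blast
  qed
  have dense: "ldense k l d H \<longleftrightarrow> d * real n ^ (k - l) \<le> fact (k - l) * real (min_degree l H)"
    if H: "kgraph k H" "card (verts H) = n" for H :: "nat hypergraph" and d
  proof
    assume a: "ldense k l d H"
    have "min_degree l H \<in> {hg_degree H S |S. S \<subseteq> verts H \<and> card S = l}"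
      unfolding min_degree_def using degs[OF H] by (intro Min_in) auto
    then show "d * real n ^ (k - l) \<le> fact (k - l) * real (min_degree l H)"
      using a H by (auto simp: ldense_def)
  next
    assume a: "d * real n ^ (k - l) \<le> fact (k - l) * real (min_degree l H)"
    show "ldense k l d H" unfolding ldense_def
    proof (intro allI impI)
      fix S assume S: "S \<subseteq> verts H \<and> card S = l"
      have "min_degree l H \<le> hg_degree H S"
        unfolding min_degree_def using degs[OF H] S by (intro Min_le) auto
      then have "fact (k - l) * real (min_degree l H) \<le> fact (k - l) * real (hg_degree H S)"
        by (intro mult_left_mono) auto
      then show "d * real (card (verts H)) ^ (k - l) \<le> fact (k - l) * real (hg_degree H S)"
        unfolding H(2) using a by linarith
    qed
  qed
  have X0: "X \<noteq> {}"
  proof -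
    have "kgraph k ({..<n}, {}) \<and> card (verts ({..<n}, {} :: nat set set)) = n" by (simp add: kgraph_def)
    moreover have "hg_free F ({..<n}, {} :: nat set set)"
      using F by (auto simp: hg_free_iff_no_emb hg_emb_def)
    ultimately show ?thesis unfolding X_def by blast
  qed
  have Xfin: "finite X"
  proof -
    have "X \<subseteq> {..n ^ (k - l)}"
    proof
      fix x assume "x \<in> X"
      then obtain H :: "nat hypergraph" where H: "kgraph k H" "card (verts H) = n" "x = min_degree l H"
        by (auto simp: X_def)
      have "min_degree l H \<in> {hg_degree H S |S. S \<subseteq> verts H \<and> card S = l}"
        unfolding min_degree_def using degs[OF H(1,2)] by (intro Min_in) auto
      then obtain S where S: "S \<subseteq> verts H" "card S = l" "x = hg_degree H S" using H by auto
      have "real x \<le> fact (k - l) * real x" by (simp add: mult_le_cancel_right1)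
      also have "\<dots> \<le> real n ^ (k - l)" using degree_le[OF H(1) S(1,2) assms(3)] S H by simp
      finally have "real x \<le> real (n ^ (k - l))" by simp
      then show "x \<in> {..n ^ (k - l)}" by (simp only: of_nat_le_iff atMost_iff)
    qed
    then show ?thesis using finite_subset by blast
  qed
  have exX: "ex_degree k l n F = Max X" by (simp add: ex_degree_def X_def)
  show ?thesis
  proof
    assume "adm k l n d F"
    then obtain H :: "nat hypergraph" where H: "kgraph k H" "card (verts H) = n" "ldense k l d H" "hg_free F H"
      unfolding adm_def hg_free_iff_no_emb[OF F(1)] by blast
    then have "min_degree l H \<in> X" unfolding X_def by blast
    then have "min_degree l H \<le> ex_degree k l n F" unfolding exX using Xfin by (intro Max_ge)
    then have "fact (k - l) * real (min_degree l H) \<le> fact (k - l) * real (ex_degree k l n F)" by simp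
    then show "d * real n ^ (k - l) \<le> fact (k - l) * real (ex_degree k l n F)"
      using dense[OF H(1,2), of d] H(3) by linarith
  next
    assume a: "d * real n ^ (k - l) \<le> fact (k - l) * real (ex_degree k l n F)"
    have "ex_degree k l n F \<in> X" unfolding exX using Xfin X0 by (rule Max_in)
    then obtain H :: "nat hypergraph" where H: "kgraph k H" "card (verts H) = n" "hg_free F H" "ex_degree k l n F = min_degree l H"
      by (auto simp: X_def)
    then have "ldense k l d H" using dense[OF H(1,2)] a by simp
    then show "adm k l n d F" using H(1-3) unfolding adm_def hg_free_iff_no_emb[OF F(1)] by blast
  qed
qed

text \<open>The limit is the supremum of the bounds that are reached infinitely often.\<close>

lemma convergent_if_values_propagate:
  fixes y :: "nat \<Rightarrow> real"
  assumes bnd: "\<forall>\<^sub>F n in sequentially. 0 \<le> y n \<and> y n \<le> 1"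
    and propagate: "\<And>c d. c < d \<Longrightarrow> \<exists>\<^sub>F n in sequentially. d \<le> y n \<Longrightarrow> \<forall>\<^sub>F n in sequentially. c \<le> y n"
  obtains P where "y \<longlonglongrightarrow> P" "0 \<le> P" "P \<le> 1"
proof -
  define D where "D = {d. \<exists>\<^sub>F n in sequentially. d \<le> y n}"
  define P where "P = Sup D"
  have "\<forall>\<^sub>F n in sequentially. 0 \<le> y n" using bnd by eventually_elim auto
  then have "0 \<in> D" unfolding D_def by (simp add: eventually_frequently)
  have le1: "d \<le> 1" if "d \<in> D" for d
  proof -
    have "\<exists>\<^sub>F n in sequentially. d \<le> y n" using that by (simp add: D_def)
    then obtain n where "d \<le> y n" "y n \<le> 1"
      using frequently_ex[OF frequently_eventually_conj[OF _ bnd]] by blast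
    then show ?thesis by simp
  qed
  then have bdd: "bdd_above D" by (rule bdd_aboveI)
  have "y \<longlonglongrightarrow> P"
  proof (rule order_tendstoI)
    fix a assume "a < P"
    then obtain d where d: "d \<in> D" "a < d" unfolding P_def using less_cSup_iff[of D a] bdd \<open>0 \<in> D\<close> by blast
    then have "\<forall>\<^sub>F n in sequentially. (a + d) / 2 \<le> y n" unfolding D_def by (intro propagate[of _ d]) auto
    then show "\<forall>\<^sub>F n in sequentially. a < y n" by eventually_elim (use d in auto)
  next
    fix a assume "P < a"
    then have "a \<notin> D" using cSup_upper[OF _ bdd] unfolding P_def by force
    then show "\<forall>\<^sub>F n in sequentially. y n < a"
      by (simp add: D_def not_frequently not_le)
  qed
  moreover have "0 \<le> P" unfolding P_def using \<open>0 \<in> D\<close> bdd by (rule cSup_upper)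
  moreover have "P \<le> 1" unfolding P_def using \<open>0 \<in> D\<close> le1 by (intro cSup_least) auto
  ultimately show thesis by (rule that)
qed

definition ex_ratio :: "nat \<Rightarrow> nat \<Rightarrow> 'b hypergraph \<Rightarrow> nat \<Rightarrow> real" where
  "ex_ratio k l F n = fact (k - l) * real (ex_degree k l n F) / real n ^ (k - l)"

lemma adm_iff_ex_ratio:
  assumes "kgraph k F" "edges F \<noteq> {}" "l \<le> k" "l \<le> n" "0 < n"
  shows "adm k l n d F \<longleftrightarrow> d \<le> ex_ratio k l F n"
  using adm_iff_ex_degree[OF assms(1-4)] assms(5) by (simp add: ex_ratio_def pos_le_divide_eq)

text \<open>Sampling from arbitrarily large hypergraphs propagates large values to every size, which is why the
  limit in the definition of the density exists.\<close>

lemma ex_ratio_tendsto_density: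
  assumes F: "kgraph k F" "edges F \<noteq> {}" and l: "l < k"
  shows "ex_ratio k l F \<longlonglongrightarrow> turan_density k l F" "0 \<le> turan_density k l F" "turan_density k l F \<le> 1"
proof -
  have ev: "\<forall>\<^sub>F n in sequentially. \<forall>d. adm k l n d F \<longleftrightarrow> d \<le> ex_ratio k l F n"
    using eventually_gt_at_top[of l] by eventually_elim (use adm_iff_ex_ratio[OF F] l in auto)
  have "\<forall>\<^sub>F n in sequentially. 0 \<le> ex_ratio k l F n \<and> ex_ratio k l F n \<le> 1"
    using ev eventually_gt_at_top[of l]
  proof eventually_elim
    case (elim n)
    then have "adm k l n (ex_ratio k l F n) F" by blast
    then have "ex_ratio k l F n \<le> 1"
      using ldense_le_1 l elim(2) unfolding adm_def by (metis less_imp_le_nat gr_implies_not0 not_gr0)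
    then show ?case by (simp add: ex_ratio_def)
  qed
  moreover have "\<forall>\<^sub>F n in sequentially. c \<le> ex_ratio k l F n"
    if "c < d" "\<exists>\<^sub>F n in sequentially. d \<le> ex_ratio k l F n" for c d
  proof -
    have fr: "\<exists>\<^sub>F n in sequentially. adm k l n d F"
      using frequently_eventually_conj[OF that(2) ev] by (rule frequently_elim1) auto
    have "d \<le> 1"
    proof -
      obtain n where n: "adm k l n d F" "l < n"
        using frequently_ex[OF frequently_eventually_conj[OF fr eventually_gt_at_top[of l]]] by auto
      then show ?thesis using ldense_le_1 l unfolding adm_def by (metis less_imp_le_nat gr_implies_not0 not_gr0)
    qed
    then have "\<forall>\<^sub>F n in sequentially. adm k l n c F" using adm_sampling[OF l that(1)] fr by blast
    then show ?thesis using ev by eventually_elim auto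
  qed
  ultimately obtain P where P: "ex_ratio k l F \<longlonglongrightarrow> P" "0 \<le> P" "P \<le> 1"
    using convergent_if_values_propagate by blast
  have "(\<lambda>n. ex_ratio k l F n / (fact (k - l) * real ((n - l) choose (k - l)) / real n ^ (k - l))) \<longlonglongrightarrow> P / 1"
    by (intro tendsto_divide P choose_asymptotics) auto
  moreover have "\<forall>\<^sub>F n in sequentially. ex_ratio k l F n / (fact (k - l) * real ((n - l) choose (k - l)) / real n ^ (k - l))
      = real (ex_degree k l n F) / real ((n - l) choose (k - l))"
    using eventually_gt_at_top[of 0] by eventually_elim (simp add: ex_ratio_def)
  ultimately have "(\<lambda>n. real (ex_degree k l n F) / real ((n - l) choose (k - l))) \<longlonglongrightarrow> P / 1"
    by (rule Lim_transform_eventually)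
  then have "(\<lambda>n. real (ex_degree k l n F) / real ((n - l) choose (k - l))) \<longlonglongrightarrow> P" by simp
  then have "turan_density k l F = P" unfolding turan_density_def by (rule limI)
  with P show "ex_ratio k l F \<longlonglongrightarrow> turan_density k l F" "0 \<le> turan_density k l F" "turan_density k l F \<le> 1" by auto
qed

lemma emb_if_above_density:
  assumes F: "kgraph k F" "edges F \<noteq> {}" and l: "l < k" and d: "turan_density k l F < d"
  shows "\<forall>\<^sub>F n in sequentially. \<forall>H :: nat hypergraph. kgraph k H \<and> card (verts H) = n \<and> ldense k l d H \<longrightarrow> hg_emb F H"
proof -
  have "\<forall>\<^sub>F n in sequentially. ex_ratio k l F n < d"
    using ex_ratio_tendsto_density(1)[OF F l] d by (rule order_tendstoD(2))
  then show ?thesis using eventually_gt_at_top[of l]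
  proof eventually_elim
    case (elim n)
    then have "\<not> adm k l n d F" using adm_iff_ex_ratio[OF F, of l n d] l by auto
    then show ?case by (auto simp: adm_def)
  qed
qed

lemma density_le_if_eventually_not_adm:
  assumes F: "kgraph k F" "edges F \<noteq> {}" and l: "l < k" and "\<exists>\<^sub>F n in sequentially. \<not> adm k l n d F"
  shows "turan_density k l F \<le> d"
proof (rule ccontr)
  assume "\<not> turan_density k l F \<le> d"
  then have "\<forall>\<^sub>F n in sequentially. d < ex_ratio k l F n"
    using ex_ratio_tendsto_density(1)[OF F l] by (intro order_tendstoD(1)) auto
  then have "\<forall>\<^sub>F n in sequentially. adm k l n d F" using eventually_gt_at_top[of l]
  proof eventually_elim
    case (elim n)
    then show ?case using adm_iff_ex_ratio[OF F, of l n d] l by auto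
  qed
  then show False using assms(4) by (simp add: frequently_def)
qed

lemma density_ge_if_frequently_adm:
  assumes F: "kgraph k F" "edges F \<noteq> {}" and l: "l < k" and "\<exists>\<^sub>F n in sequentially. adm k l n d F"
  shows "d \<le> turan_density k l F"
proof (rule ccontr)
  assume "\<not> d \<le> turan_density k l F"
  then have "\<forall>\<^sub>F n in sequentially. \<forall>H :: nat hypergraph. kgraph k H \<and> card (verts H) = n \<and> ldense k l d H \<longrightarrow> hg_emb F H"
    by (intro emb_if_above_density[OF F l]) auto
  then have "\<forall>\<^sub>F n in sequentially. \<not> adm k l n d F" by eventually_elim (auto simp: adm_def)
  then show False using assms(4) by (simp add: frequently_def)
qed

section \<open>Blowing up\<close>

definition lists_over :: "'a set \<Rightarrow> nat \<Rightarrow> 'a list set" where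
  "lists_over A q = {xs. set xs \<subseteq> A \<and> length xs = q}"

lemma finite_lists_over: "finite A \<Longrightarrow> finite (lists_over A q)"
  unfolding lists_over_def by (rule finite_lists_length_eq)

lemma card_lists_over: "finite A \<Longrightarrow> card (lists_over A q) = card A ^ q"
  unfolding lists_over_def by (rule card_lists_length_eq)

lemma sum_lists_over_Suc:
  fixes f :: "'a list \<Rightarrow> real"
  shows "(\<Sum>xs\<in>lists_over A (Suc q). f xs) = (\<Sum>v\<in>A. \<Sum>xs\<in>lists_over A q. f (v # xs))"
proof -
  have "(\<Sum>v\<in>A. \<Sum>xs\<in>lists_over A q. f (v # xs)) = (\<Sum>(v, xs)\<in>A \<times> lists_over A q. f (v # xs))"
    by (rule sum.cartesian_product)
  also have "\<dots> = (\<Sum>xs\<in>lists_over A (Suc q). f xs)"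
    by (rule sum.reindex_bij_witness[of _ "\<lambda>ys. (hd ys, tl ys)" "\<lambda>(v, xs). v # xs"])
      (auto simp: lists_over_def length_Suc_conv)
  finally show ?thesis by simp
qed

lemma lists_over_0: "lists_over A 0 = {[]}"
  by (auto simp: lists_over_def)

lemma sum_prod_list_over:
  fixes h :: "'a \<Rightarrow> real"
  shows "(\<Sum>w\<in>lists_over A t. prod_list (map h w)) = (\<Sum>v\<in>A. h v) ^ t"
  by (induction t) (simp_all add: lists_over_0 sum_lists_over_Suc sum_distrib_left[symmetric] sum_distrib_right[symmetric])

lemma power_above_tangent:
  assumes "0 \<le> (x::real)" "0 \<le> a"
  shows "a ^ p + real p * a ^ (p - 1) * (x - a) \<le> x ^ p"
proof (induction p)
  case 0 then show ?case by simp
next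
  case (Suc p)
  show ?case
  proof (cases p)
    case 0 then show ?thesis by simp
  next
    case (Suc r)
    have "0 \<le> real p * a ^ r * (x - a)\<^sup>2" using assms by (intro mult_nonneg_nonneg) auto
    then have "a ^ Suc p + real (Suc p) * a ^ p * (x - a) \<le> x * (a ^ p + real p * a ^ (p - 1) * (x - a))"
      unfolding Suc by (simp add: algebra_simps power2_eq_square)
    also have "\<dots> \<le> x * x ^ p" using Suc.IH assms by (intro mult_left_mono) auto
    finally show ?thesis by simp
  qed
qed

lemma power_of_mean_le:
  fixes x :: "'a \<Rightarrow> real"
  assumes "finite A" "A \<noteq> {}" "\<And>a. a \<in> A \<Longrightarrow> 0 \<le> x a"
  shows "((\<Sum>a\<in>A. x a) / real (card A)) ^ p \<le> (\<Sum>a\<in>A. x a ^ p) / real (card A)"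
proof -
  define \<mu> where "\<mu> = (\<Sum>a\<in>A. x a) / real (card A)"
  have c: "0 < real (card A)" using assms by (simp add: card_gt_0_iff)
  have \<mu>: "0 \<le> \<mu>" using assms c by (auto simp: \<mu>_def intro!: divide_nonneg_nonneg sum_nonneg)
  have "(\<Sum>a\<in>A. \<mu> ^ p + real p * \<mu> ^ (p - 1) * (x a - \<mu>)) \<le> (\<Sum>a\<in>A. x a ^ p)"
    using assms \<mu> by (intro sum_mono power_above_tangent) auto
  moreover have "(\<Sum>a\<in>A. \<mu> ^ p + real p * \<mu> ^ (p - 1) * (x a - \<mu>))
     = real (card A) * \<mu> ^ p + real p * \<mu> ^ (p - 1) * ((\<Sum>a\<in>A. x a) - real (card A) * \<mu>)"
    by (simp add: sum.distrib sum_distrib_left[symmetric] sum_subtractf)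
  moreover have "(\<Sum>a\<in>A. x a) - real (card A) * \<mu> = 0" using c by (simp add: \<mu>_def)
  ultimately have "real (card A) * \<mu> ^ p \<le> (\<Sum>a\<in>A. x a ^ p)" by simp
  then show ?thesis using c by (simp add: \<mu>_def[symmetric] pos_le_divide_eq mult.commute)
qed

text \<open>The product of \<open>g\<close> over all tuples that choose one entry from each list.\<close>

fun box_weight :: "'a list list \<Rightarrow> ('a list \<Rightarrow> real) \<Rightarrow> real" where
  "box_weight [] g = g []"
| "box_weight (w # ws) g = box_weight ws (\<lambda>xs. prod_list (map (\<lambda>v. g (v # xs)) w))"

text \<open>Replacing one coordinate after the other by \<open>t\<close> independent copies can only increase the
  average, by convexity of \<open>x ^ t\<close>, so a dense set of \<open>q\<close>-tuples contains many boxes with sides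
  of length \<open>t\<close>.\<close>

lemma average_box_weight:
  fixes g :: "'a list \<Rightarrow> real"
  assumes V: "finite V" "V \<noteq> {}" and g: "\<And>xs. 0 \<le> g xs"
  shows "((\<Sum>xs\<in>lists_over V q. g xs) / real (card V) ^ q) ^ (t ^ q)
    \<le> (\<Sum>ws\<in>lists_over (lists_over V t) q. box_weight ws g) / (real (card V) ^ t) ^ q"
  using g
proof (induction q arbitrary: g)
  case 0
  then show ?case by (simp add: lists_over_0)
next
  case (Suc q)
  let ?n = "real (card V)" and ?L = "lists_over V t"
  have n: "0 < ?n" using V by (simp add: card_gt_0_iff)
  have finL: "finite ?L" "card ?L = card V ^ t" using V finite_lists_over card_lists_over by auto
  have neL: "?L \<noteq> {}"
  proof
    assume "?L = {}"
    then have "real (card V ^ t) = 0" using finL by simp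
    then show False using n by simp
  qed
  define G where "G w xs = prod_list (map (\<lambda>v. g (v # xs)) w)" for w xs
  have G0: "0 \<le> G w xs" for w xs unfolding G_def by (rule prod_list_nonneg) (use Suc.prems in auto)
  have "((\<Sum>xs\<in>lists_over V (Suc q). g xs) / ?n ^ Suc q) ^ (t ^ Suc q)
    = (((\<Sum>xs\<in>lists_over V q. (\<Sum>v\<in>V. g (v # xs)) / ?n) / real (card (lists_over V q))) ^ t) ^ (t ^ q)"
    using V by (simp add: sum_lists_over_Suc sum.swap[of _ "lists_over V q"] card_lists_over power_mult
        sum_divide_distrib[symmetric])
  also have "\<dots> \<le> ((\<Sum>xs\<in>lists_over V q. ((\<Sum>v\<in>V. g (v # xs)) / ?n) ^ t) / real (card (lists_over V q))) ^ (t ^ q)"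
  proof (intro power_mono power_of_mean_le)
    show "lists_over V q \<noteq> {}"
    proof
      assume "lists_over V q = {}"
      then have "real (card V ^ q) = 0" using card_lists_over[OF V(1), of q] by simp
      then show False using n by simp
    qed
    show "0 \<le> ((\<Sum>xs\<in>lists_over V q. (\<Sum>v\<in>V. g (v # xs)) / ?n) / real (card (lists_over V q))) ^ t"
      using Suc.prems n by (intro zero_le_power divide_nonneg_nonneg sum_nonneg) auto
  qed (use V Suc.prems in \<open>auto intro!: finite_lists_over divide_nonneg_nonneg sum_nonneg\<close>)
  also have "(\<Sum>xs\<in>lists_over V q. ((\<Sum>v\<in>V. g (v # xs)) / ?n) ^ t) / real (card (lists_over V q))
    = (\<Sum>w\<in>?L. (\<Sum>xs\<in>lists_over V q. G w xs) / ?n ^ q) / real (card ?L)"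
    unfolding G_def using V n
    by (simp add: power_divide sum_prod_list_over[symmetric] sum.swap[of _ ?L] card_lists_over
        sum_divide_distrib[symmetric] mult.commute)
  also have "\<dots> ^ (t ^ q) \<le> (\<Sum>w\<in>?L. ((\<Sum>xs\<in>lists_over V q. G w xs) / ?n ^ q) ^ (t ^ q)) / real (card ?L)"
    using finL neL G0 n by (intro power_of_mean_le) (auto intro!: divide_nonneg_nonneg sum_nonneg)
  also have "\<dots> \<le> (\<Sum>w\<in>?L. (\<Sum>ws\<in>lists_over ?L q. box_weight ws (G w)) / (?n ^ t) ^ q) / real (card ?L)"
    using Suc.IH G0 by (intro divide_right_mono sum_mono) auto
  also have "\<dots> = (\<Sum>ws\<in>lists_over ?L (Suc q). box_weight ws g) / (?n ^ t) ^ Suc q"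
    using finL by (simp add: sum_lists_over_Suc G_def[abs_def] sum_divide_distrib[symmetric] mult.commute)
  finally show ?case .
qed

lemma prod_list_of_bool: "prod_list (map (\<lambda>v. of_bool (P v)) w) = (of_bool (\<forall>v\<in>set w. P v) :: real)"
  by (induction w) auto

lemma box_weight_of_bool:
  "box_weight ws (\<lambda>xs. of_bool (P xs)) = of_bool (\<forall>xs. list_all2 (\<lambda>x w. x \<in> set w) xs ws \<longrightarrow> P xs)"
proof (induction ws arbitrary: P)
  case Nil then show ?case by simp
next
  case (Cons w ws)
  have "(\<forall>xs. list_all2 (\<lambda>x w. x \<in> set w) xs ws \<longrightarrow> (\<forall>v\<in>set w. P (v # xs)))
    \<longleftrightarrow> (\<forall>xs. list_all2 (\<lambda>x w. x \<in> set w) xs (w # ws) \<longrightarrow> P xs)"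
    by (auto simp: list_all2_Cons2)
  then show ?case using Cons.IH[of "\<lambda>xs. \<forall>v\<in>set w. P (v # xs)"] by (simp add: prod_list_of_bool)
qed

text \<open>The boxes that lie in \<open>P\<close> make up at least \<open>\<eta> ^ (t ^ q)\<close> of all boxes, and those with a repetition
  in some side make up less than that.\<close>

lemma distinct_box_exists:
  assumes V: "finite V" and t: "t \<le> card V" "0 < card V"
    and dense: "\<eta> * real (card V) ^ q \<le> real (card {xs \<in> lists_over V q. P xs})" and \<eta>: "0 \<le> \<eta>"
    and num: "1 - \<eta> ^ (t ^ q) < (1 - real t / real (card V)) ^ (t * q)"
  obtains ws where "ws \<in> lists_over (lists_over V t) q" "\<And>w. w \<in> set ws \<Longrightarrow> distinct w"
    "\<And>xs. list_all2 (\<lambda>x w. x \<in> set w) xs ws \<Longrightarrow> P xs"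
proof -
  let ?n = "real (card V)" and ?L = "lists_over V t"
  have neV: "V \<noteq> {}" using t by auto
  have n: "0 < ?n" using t by simp
  have finL: "finite ?L" "card ?L = card V ^ t" using V finite_lists_over card_lists_over by auto
  define B where "B = {ws \<in> lists_over ?L q. \<forall>xs. list_all2 (\<lambda>x w. x \<in> set w) xs ws \<longrightarrow> P xs}"
  define X where "X = {w. length w = t \<and> distinct w \<and> set w \<subseteq> V}"
  define D where "D = lists_over X q"
  have fin: "finite (lists_over ?L q)" using finL finite_lists_over by blast
  have "\<eta> \<le> (\<Sum>xs\<in>lists_over V q. of_bool (P xs)) / ?n ^ q"
    using dense n V by (simp add: pos_le_divide_eq finite_lists_over Int_def)
  then have "\<eta> ^ (t ^ q) \<le> ((\<Sum>xs\<in>lists_over V q. of_bool (P xs)) / ?n ^ q) ^ (t ^ q)"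
    using \<eta> by (intro power_mono)
  also have "\<dots> \<le> (\<Sum>ws\<in>lists_over ?L q. box_weight ws (\<lambda>xs. of_bool (P xs))) / (?n ^ t) ^ q"
    by (rule average_box_weight[OF V neV]) simp
  also have "(\<Sum>ws\<in>lists_over ?L q. box_weight ws (\<lambda>xs. of_bool (P xs))) = real (card B)"
    unfolding box_weight_of_bool B_def using fin by (simp add: Int_def)
  finally have cB: "\<eta> ^ (t ^ q) * (?n ^ t) ^ q \<le> real (card B)" using n by (simp add: pos_le_divide_eq)
  have finX: "finite X" by (rule finite_subset[OF _ finL(1)]) (auto simp: X_def lists_over_def)
  have "(?n - real t) ^ t \<le> real (card X)"
  proof -
    have "(?n - real t) ^ t = (\<Prod>i\<in>{card V - t + 1..card V}. ?n - real t)" using t by simp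
    also have "\<dots> \<le> (\<Prod>i\<in>{card V - t + 1..card V}. real i)"
      by (rule prod_mono) (use t in auto)
    also have "\<dots> = real (card X)" unfolding X_def card_lists_distinct_length_eq[OF V t(1)] by simp
    finally show ?thesis .
  qed
  then have "((?n - real t) ^ t) ^ q \<le> real (card X) ^ q" using t by (intro power_mono) auto
  then have "((?n - real t) ^ t) ^ q \<le> real (card D)" by (simp add: D_def card_lists_over[OF finX])
  moreover have "((?n - real t) ^ t) ^ q = (1 - real t / ?n) ^ (t * q) * (?n ^ t) ^ q"
    using n by (simp add: power_mult[symmetric] power_mult_distrib[symmetric] left_diff_distrib)
  moreover have "(1 - \<eta> ^ (t ^ q)) * (?n ^ t) ^ q < (1 - real t / ?n) ^ (t * q) * (?n ^ t) ^ q"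
    using num n by (intro mult_strict_right_mono) auto
  ultimately have big: "(?n ^ t) ^ q < real (card B) + real (card D)" using cB by (simp add: left_diff_distrib)
  have "B \<inter> D \<noteq> {}"
  proof
    assume e: "B \<inter> D = {}"
    have sub: "B \<subseteq> lists_over ?L q" "D \<subseteq> lists_over ?L q" by (auto simp: B_def D_def X_def lists_over_def)
    have "card B + card D = card (B \<union> D)"
      using e finite_subset[OF sub(1) fin] finite_subset[OF sub(2) fin] by (simp add: card_Un_disjoint)
    also have "\<dots> \<le> card (lists_over ?L q)" using sub by (intro card_mono[OF fin]) auto
    also have "\<dots> = (card V ^ t) ^ q" using card_lists_over[OF finL(1)] finL(2) by simp
    finally have "real (card B + card D) \<le> real ((card V ^ t) ^ q)" by (simp only: of_nat_le_iff)
    then show False using big by simp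
  qed
  then obtain ws where "ws \<in> B" "ws \<in> D" by blast
  then show thesis by (intro that[of ws]) (auto simp: B_def D_def X_def lists_over_def)
qed

lemma eventually_boxes:
  assumes "0 < (\<eta>::real)"
  shows "\<forall>\<^sub>F n in sequentially. 1 - \<eta> ^ p < (1 - real t / real n) ^ r"
proof -
  have "(\<lambda>n. real t / real n) \<longlonglongrightarrow> 0" by (rule lim_const_over_n)
  then have "(\<lambda>n. (1 - real t / real n) ^ r) \<longlonglongrightarrow> (1 - 0) ^ r" by (intro tendsto_intros)
  then show ?thesis using assms by (intro order_tendstoD(1)) auto
qed

text \<open>The density does not see the difference between homomorphisms and embeddings: if all dense
  hypergraphs on a fixed number \<open>N\<close> of vertices receive a homomorphism from \<open>F\<close>, then a dense large
  hypergraph has many \<open>N\<close>-vertex samples with the same homomorphism, hence contains a blow-up of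
  the image, and \<open>F\<close> embeds into the blow-up.\<close>

lemma hom_forcing_implies_not_adm:
  assumes F: "kgraph k F"
    and sample: "\<And>H :: nat hypergraph. kgraph k H \<Longrightarrow> ldense k l d H \<Longrightarrow> 4 * N ^ 2 < card (verts H) \<Longrightarrow>
      real (card (verts H)) ^ N / 2 \<le>
        real (card {\<omega> \<in> {..<N} \<rightarrow>\<^sub>E verts H. inj_on \<omega> {..<N} \<and> ldense k l c (hg_pullback k N \<omega> H)})"
    and hom: "\<And>H :: nat hypergraph. kgraph k H \<Longrightarrow> verts H = {..<N} \<Longrightarrow> ldense k l c H \<Longrightarrow> hg_hom F H"
  shows "\<forall>\<^sub>F n in sequentially. \<not> adm k l n d F"
proof -
  \<comment> \<open>The successor keeps the sides of a box nonempty.\<close>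
  define t where "t = Suc (card (verts F))"
  define \<F> where "\<F> = verts F \<rightarrow>\<^sub>E {..<N}"
  have finF: "finite (verts F)" by (rule kgraph_finite[OF F])
  have fin\<F>: "finite \<F>" using finF by (auto simp: \<F>_def intro: finite_PiE)
  define \<eta> where "\<eta> = 1 / (2 * (real (card \<F>) + 1))"
  have \<eta>: "0 < \<eta>" by (simp add: \<eta>_def add_nonneg_pos)
  show ?thesis
    using eventually_boxes[OF \<eta>, of "t ^ N" t "t * N"] eventually_gt_at_top[of "4 * N ^ 2"] eventually_gt_at_top[of t]
  proof eventually_elim
    case (elim n)
    show ?case
    proof
      assume "adm k l n d F"
      then obtain H :: "nat hypergraph" where H: "kgraph k H" "card (verts H) = n" "ldense k l d H" "\<not> hg_emb F H"
        by (auto simp: adm_def)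
      let ?V = "verts H"
      have finV: "finite ?V" by (rule kgraph_finite[OF H(1)])
      let ?\<Omega> = "{..<N} \<rightarrow>\<^sub>E ?V"
      have fin\<Omega>: "finite ?\<Omega>" using finV by (auto intro: finite_PiE)
      define G where "G = {\<omega> \<in> ?\<Omega>. inj_on \<omega> {..<N} \<and> ldense k l c (hg_pullback k N \<omega> H)}"
      define T where "T h = {\<omega> \<in> ?\<Omega>. inj_on \<omega> {..<N} \<and> (\<forall>e\<in>edges F. (\<lambda>v. \<omega> (h v)) ` e \<in> edges H)}" for h
      have finT: "finite (T h)" for h using fin\<Omega> by (simp add: T_def)
      have GT: "G \<subseteq> (\<Union>h\<in>\<F>. T h)"
      proof
        fix \<omega> assume \<omega>: "\<omega> \<in> G"
        then have "hg_hom F (hg_pullback k N \<omega> H)" using pullback_kgraph[of k N \<omega> H] by (intro hom) (auto simp: G_def)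
        then obtain h where h: "h ` verts F \<subseteq> {..<N}" "\<forall>e\<in>edges F. h ` e \<in> edges (hg_pullback k N \<omega> H)"
          by (auto simp: hg_hom_def)
        define h' where "h' = restrict h (verts F)"
        have "h' \<in> \<F>" using h by (auto simp: h'_def \<F>_def)
        moreover have "(\<lambda>v. \<omega> (h' v)) ` e \<in> edges H" if "e \<in> edges F" for e
        proof -
          have "(\<lambda>v. \<omega> (h' v)) ` e = \<omega> ` h ` e"
            using kgraph_edge[OF F that] by (auto simp: h'_def image_image intro!: image_cong)
          then show ?thesis using h that by (auto simp: pullback_edges)
        qed
        ultimately show "\<omega> \<in> (\<Union>h\<in>\<F>. T h)" using \<omega> by (auto simp: T_def G_def)
      qed
      have "\<exists>h\<in>\<F>. \<eta> * real n ^ N \<le> real (card (T h))"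
      proof (rule ccontr)
        assume neg: "\<not> (\<exists>h\<in>\<F>. \<eta> * real n ^ N \<le> real (card (T h)))"
        have "card G \<le> (\<Sum>h\<in>\<F>. card (T h))"
          using card_mono[OF _ GT] card_UN_le[OF fin\<F>, of T] finT fin\<F> by fastforce
        then have "real (card G) \<le> (\<Sum>h\<in>\<F>. real (card (T h)))"
          by (simp only: of_nat_sum[symmetric] of_nat_le_iff)
        also have "\<dots> \<le> (\<Sum>h\<in>\<F>. \<eta> * real n ^ N)" using neg by (intro sum_mono) auto
        also have "\<dots> = real (card \<F>) * \<eta> * real n ^ N" by simp
        also have "\<dots> < 1 / 2 * real n ^ N"
          using elim by (intro mult_strict_right_mono) (auto simp: \<eta>_def field_simps)
        finally show False using sample[OF H(1,3)] elim H(2) by (simp add: G_def)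
      qed
      then obtain h where h: "h \<in> \<F>" "\<eta> * real n ^ N \<le> real (card (T h))" by blast
      have hN: "h v < N" if "v \<in> verts F" for v using h(1) that by (auto simp: \<F>_def)
      define P where "P xs \<longleftrightarrow> distinct xs \<and> (\<forall>e\<in>edges F. (\<lambda>v. xs ! (h v)) ` e \<in> edges H)" for xs
      have "card (T h) \<le> card {xs \<in> lists_over ?V N. P xs}"
      proof (rule card_inj_on_le[where f = "\<lambda>\<omega>. map \<omega> [0..<N]"])
        show "inj_on (\<lambda>\<omega>. map \<omega> [0..<N]) (T h)"
        proof (rule inj_onI)
          fix \<omega> \<omega>' assume a: "\<omega> \<in> T h" "\<omega>' \<in> T h" "map \<omega> [0..<N] = map \<omega>' [0..<N]"
          then have "\<omega> i = \<omega>' i" if "i \<in> {..<N}" for i using that by simp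
          then show "\<omega> = \<omega>'" using a by (intro PiE_ext[of _ "{..<N}" "\<lambda>_. ?V"]) (auto simp: T_def)
        qed
        show "(\<lambda>\<omega>. map \<omega> [0..<N]) ` T h \<subseteq> {xs \<in> lists_over ?V N. P xs}"
        proof clarify
          fix \<omega> assume w: "\<omega> \<in> T h"
          then have "distinct (map \<omega> [0..<N])" by (simp add: T_def distinct_map atLeast0LessThan)
          moreover have "(\<lambda>v. map \<omega> [0..<N] ! h v) ` e = (\<lambda>v. \<omega> (h v)) ` e" if "e \<in> edges F" for e
            using kgraph_edge[OF F that] hN by (intro image_cong) auto
          ultimately have "P (map \<omega> [0..<N])" using w by (simp add: P_def T_def)
          moreover have "map \<omega> [0..<N] \<in> lists_over ?V N" using w by (auto simp: T_def lists_over_def)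
          ultimately show "map \<omega> [0..<N] \<in> lists_over ?V N \<and> P (map \<omega> [0..<N])" by simp
        qed
        show "finite {xs \<in> lists_over ?V N. P xs}" using finite_lists_over[OF finV] by auto
      qed
      then have "\<eta> * real (card ?V) ^ N \<le> real (card {xs \<in> lists_over ?V N. P xs})" using h H(2) by simp
      then obtain ws where ws: "ws \<in> lists_over (lists_over ?V t) N" "\<And>w. w \<in> set ws \<Longrightarrow> distinct w"
        "\<And>xs. list_all2 (\<lambda>x w. x \<in> set w) xs ws \<Longrightarrow> P xs"
        using distinct_box_exists[OF finV, of t \<eta> N P] elim \<eta> H(2) by auto
      have lenws: "length ws = N" using ws by (simp add: lists_over_def)
      have wsi: "distinct (ws ! i)" "length (ws ! i) = t" "set (ws ! i) \<subseteq> ?V" if "i < N" for i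
      proof -
        have "ws ! i \<in> set ws" using that lenws by simp
        then show "distinct (ws ! i)" "length (ws ! i) = t" "set (ws ! i) \<subseteq> ?V" using ws(1,2) by (auto simp: lists_over_def)
      qed
      obtain b where b: "bij_betw b (verts F) {0..<card (verts F)}" using ex_bij_betw_finite_nat[OF finF] by blast
      have bt: "b v < t" if "v \<in> verts F" for v using bij_betwE[OF b] that by (fastforce simp: t_def)
      define f where "f v = ws ! (h v) ! (b v)" for v
      have select: "\<exists>xs. length xs = N \<and> P xs \<and> (\<forall>v\<in>A. xs ! (h v) = f v)" if A: "A \<subseteq> verts F" "inj_on h A" for A
      proof -
        define xs where "xs = map (\<lambda>i. if i \<in> h ` A then f (inv_into A h i) else ws ! i ! 0) [0..<N]"
        have "list_all2 (\<lambda>x w. x \<in> set w) xs ws"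
        proof (rule list_all2_all_nthI)
          show "length xs = length ws" by (simp add: xs_def lenws)
          fix i assume "i < length xs"
          then have i: "i < N" by (simp add: xs_def)
          show "xs ! i \<in> set (ws ! i)"
          proof (cases "i \<in> h ` A")
            case True
            then obtain v where v: "v \<in> A" "i = h v" by auto
            then have "xs ! i = f v" using i A by (simp add: xs_def)
            then show ?thesis using v wsi[OF i] bt[of v] A by (auto simp: f_def)
          next
            case False
            then show ?thesis using i wsi[OF i] by (simp add: xs_def t_def)
          qed
        qed
        moreover have "xs ! (h v) = f v" if "v \<in> A" for v
          using that A hN[of v] by (auto simp: xs_def)
        moreover have "length xs = N" by (simp add: xs_def)
        ultimately show ?thesis using ws(3) by blast
      qed
      have "hg_emb F H" unfolding hg_emb_def
      proof (intro exI[of _ f] conjI ballI)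
        show "inj_on f (verts F)"
        proof (rule inj_onI)
          fix u v assume uv: "u \<in> verts F" "v \<in> verts F" "f u = f v"
          show "u = v"
          proof (cases "h u = h v")
            case True
            then have "b u = b v" using uv wsi[OF hN[OF uv(1)]] bt by (auto simp: f_def nth_eq_iff_index_eq)
            then show ?thesis using b uv by (auto simp: bij_betw_def inj_on_def)
          next
            case False
            then obtain xs where xs: "P xs" "xs ! h u = f u" "xs ! h v = f v" "length xs = N"
              using select[of "{u, v}"] uv by (auto simp: inj_on_def)
            then have "xs ! h u = xs ! h v" "distinct xs" using uv by (simp_all add: P_def)
            then have "h u = h v" using nth_eq_iff_index_eq[of xs "h u" "h v"] hN uv xs(4) by simp
            then show ?thesis using False by simp
          qed
        qed
        show "f ` verts F \<subseteq> ?V"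
        proof
          fix x assume "x \<in> f ` verts F"
          then obtain v where v: "v \<in> verts F" "x = f v" by auto
          then have "x \<in> set (ws ! h v)" using wsi(2)[OF hN] bt by (auto simp: f_def)
          then show "x \<in> ?V" using wsi(3)[OF hN[OF v(1)]] by auto
        qed
        fix e assume e: "e \<in> edges F"
        then have e': "e \<subseteq> verts F" "card e = k" using kgraph_edge[OF F] by auto
        then have fine: "finite e" using finF finite_subset by blast
        obtain xs where "P xs" using select[of "{}"] by auto
        then have "(\<lambda>v. xs ! (h v)) ` e \<in> edges H" using e by (simp add: P_def)
        then have "card ((\<lambda>v. xs ! (h v)) ` e) = card e" using kgraph_edge[OF H(1)] e' by simp
        then have "inj_on (\<lambda>v. xs ! (h v)) e" using eq_card_imp_inj_on[OF fine] by simp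
        then have "inj_on h e" by (auto simp: inj_on_def)
        then obtain ys where ys: "P ys" "\<forall>v\<in>e. ys ! (h v) = f v" using select e' by blast
        have "(\<lambda>v. ys ! (h v)) ` e \<in> edges H" using ys(1) e unfolding P_def by blast
        moreover have "(\<lambda>v. ys ! (h v)) ` e = f ` e" using ys by (intro image_cong) auto
        ultimately show "f ` e \<in> edges H" by simp
      qed
      then show False using H(4) by simp
    qed
  qed
qed

text \<open>The threshold for \<open>N\<close> is independent of \<open>F\<close>. So \<open>F\<close> may be chosen after \<open>N\<close>, to suit all of the
  finitely many dense hypergraphs on \<open>N\<close> vertices.\<close>

theorem density_le_if_hom_forced:
  assumes l: "l < k" and cd: "c < d" "d \<le> 1"
  shows "\<forall>\<^sub>F N in sequentially. \<forall>F :: 'b hypergraph. kgraph k F \<and>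
    (\<forall>H :: nat hypergraph. kgraph k H \<and> verts H = {..<N} \<and> ldense k l c H \<longrightarrow> hg_hom F H) \<longrightarrow>
    (\<forall>\<^sub>F n in sequentially. \<not> adm k l n d F)"
  using samples_are_dense[OF l cd, where ?'a = nat]
proof eventually_elim
  case (elim N)
  show ?case
  proof (intro allI impI, elim conjE)
    fix F :: "'b hypergraph"
    assume F: "kgraph k F" and hom: "\<forall>H :: nat hypergraph. kgraph k H \<and> verts H = {..<N} \<and> ldense k l c H \<longrightarrow> hg_hom F H"
    show "\<forall>\<^sub>F n in sequentially. \<not> adm k l n d F"
      by (rule hom_forcing_implies_not_adm[OF F]) (use elim hom in auto)
  qed
qed

section \<open>The map on densities\<close>

lemma Phi_parameters:
  assumes "l < k" "x < 1"
  obtains y where "0 < y" "y = (1 - x) powr (- 1 / real (k - l))" "(1 - x) * y ^ (k - l) = 1"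
    "Phi k l x = 1 - (1 / (1 + y)) ^ (k - l)"
proof -
  define m where "m = k - l"
  have m: "0 < m" using assms by (simp add: m_def)
  define y where "y = (1 - x) powr (- 1 / real m)"
  have y: "0 < y" using assms by (simp add: y_def)
  have "y ^ m = y powr real m" using y by (simp add: powr_realpow)
  also have "\<dots> = (1 - x) powr (- 1)" using m by (simp add: y_def powr_powr)
  finally have "(1 - x) * y ^ m = 1" using assms by (simp add: powr_minus)
  moreover have "Phi k l x = 1 - (1 / (1 + y)) ^ m"
  proof -
    have "(1 + y) powr (- real m) = 1 / (1 + y) ^ m"
      using y by (simp add: powr_minus powr_realpow inverse_eq_divide)
    then show ?thesis unfolding Phi_def m_def[symmetric] y_def[symmetric] by (simp add: power_one_over)
  qed
  ultimately show thesis using y by (intro that[of y]) (simp_all add: y_def m_def)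
qed

text \<open>The two-part pattern behind the map: a part of relative size \<open>1 - b\<close> carries a hypergraph of
  density \<open>x\<close>, a part of size \<open>b\<close> spans no edge, and all sets that meet both parts are edges. The
  value of \<open>b\<close> is the one for which \<open>l\<close>-sets in either part have the same degree.\<close>

lemma Phi_balance:
  assumes "l < k" "0 \<le> x" "x < 1"
  obtains b where "0 < b" "b < 1" "(1 - x) * (1 - b) ^ (k - l) = b ^ (k - l)" "Phi k l x = 1 - b ^ (k - l)"
proof -
  obtain y where y: "0 < y" "(1 - x) * y ^ (k - l) = 1" "Phi k l x = 1 - (1 / (1 + y)) ^ (k - l)"
    using Phi_parameters[OF assms(1,3)] by metis
  define b where "b = 1 / (1 + y)"
  have "1 - b = y * b" using y by (simp add: b_def field_simps)
  then have "(1 - x) * (1 - b) ^ (k - l) = ((1 - x) * y ^ (k - l)) * b ^ (k - l)"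
    by (simp add: power_mult_distrib)
  then show thesis using y by (intro that[of b]) (auto simp: b_def)
qed

lemma Phi_bounds:
  assumes "l < k" "0 \<le> x" "x < 1"
  shows "x < Phi k l x" "Phi k l x < 1"
proof -
  obtain b where b: "0 < b" "b < 1" "(1 - x) * (1 - b) ^ (k - l) = b ^ (k - l)" "Phi k l x = 1 - b ^ (k - l)"
    using Phi_balance[OF assms] by metis
  have "(1 - b) ^ (k - l) < 1" using b assms(1) by (intro power_Suc_less_one[of _ "k - l - 1", simplified] power_less_one_iff[THEN iffD2]) auto
  then have "(1 - x) * (1 - b) ^ (k - l) < (1 - x) * 1" using assms by (intro mult_strict_left_mono) auto
  then show "x < Phi k l x" using b by simp
  show "Phi k l x < 1" using b by simp
qed

lemma Phi_strict_mono:
  assumes "l < k" "x < x'" "x' < 1"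
  shows "Phi k l x < Phi k l x'"
proof -
  define m where "m = k - l"
  have m: "0 < m" using assms by (simp add: m_def)
  obtain y where y: "0 < y" "(1 - x) * y ^ m = 1" "Phi k l x = 1 - (1 / (1 + y)) ^ m"
    using Phi_parameters[of l k x] assms unfolding m_def by (metis less_trans)
  obtain y' where y': "0 < y'" "(1 - x') * y' ^ m = 1" "Phi k l x' = 1 - (1 / (1 + y')) ^ m"
    using Phi_parameters[of l k x'] assms unfolding m_def by metis
  have "y ^ m < y' ^ m"
  proof -
    have "y ^ m = 1 / (1 - x)" "y' ^ m = 1 / (1 - x')"
      using y(2) y'(2) assms by (auto simp: field_simps)
    moreover have "1 / (1 - x) < 1 / (1 - x')" using assms by (intro divide_strict_left_mono) auto
    ultimately show ?thesis by simp
  qed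
  then have "y < y'" using y' by (intro power_less_imp_less_base[of y m y']) auto
  then have "1 / (1 + y') < 1 / (1 + y)" using y by (intro divide_strict_left_mono) auto
  then have "(1 / (1 + y')) ^ m < (1 / (1 + y)) ^ m" using m y' by (intro power_strict_mono) auto
  then show ?thesis using y y' by simp
qed

lemma Phi_isCont:
  assumes "l < k" "x < 1"
  shows "isCont (Phi k l) x"
proof -
  have "isCont (\<lambda>x. 1 - (1 + (1 - x) powr (- 1 / real (k - l))) powr (- real (k - l))) x"
    by (intro continuous_intros) (use assms in \<open>auto intro: add_pos_nonneg simp: add_nonneg_eq_0_iff\<close>)
  then show ?thesis by (simp add: Phi_def[abs_def])
qed

text \<open>A tree of nonempty words over the vertices of \<open>F\<close>: the children of each word form a copy of \<open>F\<close>, and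
  the vertices along each branch of length \<open>k\<close> form an edge.\<close>

definition Phi_tree :: "nat \<Rightarrow> 'a hypergraph \<Rightarrow> 'a list hypergraph" where
  "Phi_tree k F = ({p. set p \<subseteq> verts F \<and> p \<noteq> [] \<and> length p \<le> k},
     {(\<lambda>v. p @ [v]) ` e |p e. set p \<subseteq> verts F \<and> length p < k \<and> e \<in> edges F} \<union>
     {(\<lambda>i. take i q) ` {1..k} |q. set q \<subseteq> verts F \<and> length q = k})"

lemma Phi_tree_kgraph:
  assumes "kgraph k F"
  shows "kgraph k (Phi_tree k F)"
proof -
  have "finite {p. set p \<subseteq> verts F \<and> length p \<le> k}"
    by (rule finite_lists_length_le[OF kgraph_finite[OF assms]])
  then have "finite (verts (Phi_tree k F))"
    by (rule finite_subset[rotated]) (auto simp: Phi_tree_def)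
  moreover have "e \<subseteq> verts (Phi_tree k F) \<and> card e = k" if "e \<in> edges (Phi_tree k F)" for e
  proof -
    from that consider p e' where "e = (\<lambda>v. p @ [v]) ` e'" "set p \<subseteq> verts F" "length p < k" "e' \<in> edges F"
      | q where "e = (\<lambda>i. take i q) ` {1..k}" "set q \<subseteq> verts F" "length q = k"
      by (auto simp: Phi_tree_def)
    then show ?thesis
    proof cases
      case 1
      then have e': "e' \<subseteq> verts F" "card e' = k" using kgraph_edge[OF assms] by auto
      have "inj_on (\<lambda>v. p @ [v]) e'" by (auto simp: inj_on_def)
      then show ?thesis using 1 e' by (auto simp: Phi_tree_def card_image)
    next
      case 2
      have "inj_on (\<lambda>i. take i q) {1..k}"
      proof (rule inj_onI)
        fix i j assume a: "i \<in> {1..k}" "j \<in> {1..k}" "take i q = take j q"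
        have "length (take i q) = i" using a(1) 2(3) by simp
        moreover have "length (take j q) = j" using a(2) 2(3) by simp
        ultimately show "i = j" using a(3) by metis
      qed
      moreover have "e \<subseteq> verts (Phi_tree k F)"
        using 2 by (auto simp: Phi_tree_def dest: in_set_takeD)
      ultimately show ?thesis using 2 by (simp add: card_image)
    qed
  qed
  ultimately show ?thesis by (simp add: kgraph_def)
qed

text \<open>The branches of the tree defeat every two-part colouring. If no copy of \<open>F\<close> lies in the part
  \<open>A\<close>, then each copy has a vertex outside \<open>A\<close>; following these vertices down the tree produces an
  edge of the tree, the chain of prefixes, that avoids \<open>A\<close>.\<close>

lemma Phi_tree_not_hom:
  assumes F: "kgraph k F" and no: "\<not> hg_hom F (A, EA)"
    and inside: "\<And>e. e \<in> edges G \<Longrightarrow> e \<subseteq> A \<Longrightarrow> e \<in> EA"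
    and meets: "\<And>e. e \<in> edges G \<Longrightarrow> e \<inter> A \<noteq> {}"
  shows "\<not> hg_hom (Phi_tree k F) G"
proof
  assume "hg_hom (Phi_tree k F) G"
  then obtain \<phi> where \<phi>: "\<And>e. e \<in> edges (Phi_tree k F) \<Longrightarrow> \<phi> ` e \<in> edges G" by (auto simp: hg_hom_def)
  have "\<exists>q. length q = j \<and> set q \<subseteq> verts F \<and> (\<forall>i\<in>{1..j}. \<phi> (take i q) \<notin> A)" if "j \<le> k" for j
    using that
  proof (induction j)
    case 0 then show ?case by auto
  next
    case (Suc j)
    then obtain q where q: "length q = j" "set q \<subseteq> verts F" "\<forall>i\<in>{1..j}. \<phi> (take i q) \<notin> A" by auto
    have "\<exists>v\<in>verts F. \<phi> (q @ [v]) \<notin> A"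
    proof (rule ccontr)
      assume all: "\<not> (\<exists>v\<in>verts F. \<phi> (q @ [v]) \<notin> A)"
      have "hg_hom F (A, EA)" unfolding hg_hom_def
      proof (intro exI[of _ "\<lambda>v. \<phi> (q @ [v])"] conjI ballI)
        show "(\<lambda>v. \<phi> (q @ [v])) ` verts F \<subseteq> verts (A, EA)" using all by auto
        fix e assume e: "e \<in> edges F"
        have "(\<lambda>v. q @ [v]) ` e \<in> {(\<lambda>v. p @ [v]) ` e |p e. set p \<subseteq> verts F \<and> length p < k \<and> e \<in> edges F}"
          using e q Suc.prems by (intro CollectI exI[of _ q] exI[of _ e]) auto
        then have "\<phi> ` (\<lambda>v. q @ [v]) ` e \<in> edges G" by (intro \<phi>) (simp add: Phi_tree_def)
        moreover have "\<phi> ` (\<lambda>v. q @ [v]) ` e = (\<lambda>v. \<phi> (q @ [v])) ` e" by (simp add: image_image)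
        ultimately show "(\<lambda>v. \<phi> (q @ [v])) ` e \<in> edges (A, EA)"
          using inside[of "(\<lambda>v. \<phi> (q @ [v])) ` e"] kgraph_edge[OF F e] all by auto
      qed
      then show False using no by simp
    qed
    then obtain v where v: "v \<in> verts F" "\<phi> (q @ [v]) \<notin> A" by blast
    show ?case
    proof (intro exI[of _ "q @ [v]"] conjI ballI)
      fix i assume i: "i \<in> {1..Suc j}"
      show "\<phi> (take i (q @ [v])) \<notin> A"
      proof (cases "i = Suc j")
        case True then show ?thesis using v q by simp
      next
        case False then show ?thesis using i q by auto
      qed
    qed (use q v in auto)
  qed
  from this[of k] obtain q where q: "length q = k" "set q \<subseteq> verts F" "\<forall>i\<in>{1..k}. \<phi> (take i q) \<notin> A" by auto
  have "\<phi> ` (\<lambda>i. take i q) ` {1..k} \<in> edges G" by (rule \<phi>) (use q in \<open>auto simp: Phi_tree_def\<close>)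
  then have "\<phi> ` (\<lambda>i. take i q) ` {1..k} \<inter> A \<noteq> {}" by (rule meets)
  then show False using q by auto
qed

lemma hom_free_if_below_density:
  fixes F :: "'b hypergraph"
  assumes F: "kgraph k F" "edges F \<noteq> {}" and l: "l < k" and d: "d < turan_density k l F"
  shows "\<forall>\<^sub>F n in sequentially. \<exists>H :: nat hypergraph. kgraph k H \<and> verts H = {..<n} \<and> ldense k l d H \<and> \<not> hg_hom F H"
proof -
  define d' where "d' = (d + turan_density k l F) / 2"
  have d': "d < d'" "d' < turan_density k l F" "d' \<le> 1"
    using d ex_ratio_tendsto_density(3)[OF F l] by (auto simp: d'_def)
  show ?thesis using density_le_if_hom_forced[OF l d'(1,3), where ?'b = 'b]
  proof eventually_elim
    case (elim N)
    have "\<not> (\<forall>\<^sub>F n in sequentially. \<not> adm k l n d' F)"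
    proof
      assume "\<forall>\<^sub>F n in sequentially. \<not> adm k l n d' F"
      then have "turan_density k l F \<le> d'"
        by (intro density_le_if_eventually_not_adm[OF F l] eventually_frequently) auto
      then show False using d' by simp
    qed
    then show ?case using elim F(1) by blast
  qed
qed

lemma density_le_if_hom_forced':
  assumes F: "kgraph k F" "edges F \<noteq> {}" and l: "l < k"
    and hom: "\<And>c. c0 < c \<Longrightarrow> \<forall>\<^sub>F N in sequentially. \<forall>H :: nat hypergraph.
      kgraph k H \<and> verts H = {..<N} \<and> ldense k l c H \<longrightarrow> hg_hom F H"
  shows "turan_density k l F \<le> c0"
proof (rule ccontr)
  assume "\<not> turan_density k l F \<le> c0"
  then obtain c where c: "c0 < c" "c < turan_density k l F" using dense[of c0 "turan_density k l F"] by (auto simp: not_le)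
  have "\<forall>\<^sub>F N in sequentially. False"
    using hom[OF c(1)] hom_free_if_below_density[OF F l c(2)] by eventually_elim blast
  then show False by simp
qed

lemma fact_Suc_choose_Suc: "fact (Suc m) * (n choose Suc m) = fact m * (n choose m) * (n - m)"
proof -
  have "Suc m * (n choose Suc m) = (n - m) * (n choose m)"
    using binomial_absorb_comp[of n m] binomial_absorption[of m n] by (metis mult.commute)
  then have "fact m * (Suc m * (n choose Suc m)) = fact m * ((n - m) * (n choose m))" by (rule arg_cong)
  moreover have "fact (Suc m) * (n choose Suc m) = fact m * (Suc m * (n choose Suc m))"
    by (simp only: fact_Suc of_nat_id mult_ac)
  ultimately show ?thesis by (simp only: mult_ac)
qed

lemma fact_choose_diff_le:
  assumes "x \<le> n"
  shows "fact m * real ((n - l) choose m) - fact m * real ((x - l) choose m) \<le> real n ^ m - real x ^ m"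
proof (induction m)
  case 0 then show ?case by simp
next
  case (Suc m)
  define f where "f z = fact m * real ((z - l) choose m)" for z
  define u where "u z = real (z - l - m)" for z
  have f: "fact (Suc m) * real ((z - l) choose Suc m) = f z * u z" for z
    using arg_cong[OF fact_Suc_choose_Suc[of m "z - l"], of real]
    by (simp only: f_def u_def of_nat_mult of_nat_fact)
  have IH: "f n - f x \<le> real n ^ m - real x ^ m" using Suc by (simp add: f_def)
  have mono: "0 \<le> real n ^ m - real x ^ m" using assms by (simp add: power_mono)
  have "f n * u n - f x * u x = (f n - f x) * u n + f x * (u n - u x)" by (simp add: algebra_simps)
  also have "\<dots> \<le> (real n ^ m - real x ^ m) * real n + real x ^ m * (real n - real x)"
  proof (intro add_mono)
    have "(f n - f x) * u n \<le> (real n ^ m - real x ^ m) * u n" using IH by (intro mult_right_mono) (auto simp: u_def)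
    also have "\<dots> \<le> (real n ^ m - real x ^ m) * real n" using mono by (intro mult_left_mono) (auto simp: u_def)
    finally show "(f n - f x) * u n \<le> (real n ^ m - real x ^ m) * real n" .
    have "f x \<le> real x ^ m"
      unfolding f_def using fact_choose_le_power[of m "x - l"] power_mono[of "real (x - l)" "real x" m] by simp
    moreover have "u n - u x \<le> real n - real x" "0 \<le> u n - u x" using assms by (auto simp: u_def)
    ultimately show "f x * (u n - u x) \<le> real x ^ m * (real n - real x)"
      by (intro mult_mono) (auto simp: f_def)
  qed
  finally show ?case unfolding f by (simp add: algebra_simps)
qed

lemma sum_degrees_insert:
  assumes "kgraph k H" "T \<subseteq> verts H" "card T \<le> k"
  shows "(\<Sum>v\<in>verts H - T. hg_degree H (insert v T)) = (k - card T) * hg_degree H T"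
proof -
  have fin: "finite (verts H)" "finite (edges H)" "finite T"
    using kgraph_finite[OF assms(1)] kgraph_finite_edges[OF assms(1)] finite_subset[OF assms(2)] by auto
  have "(\<Sum>v\<in>verts H - T. hg_degree H (insert v T)) = (\<Sum>v\<in>verts H - T. card {e \<in> {e \<in> edges H. T \<subseteq> e}. v \<in> e})"
    by (rule sum.cong) (auto simp: hg_degree_def intro!: arg_cong[where f = card])
  also have "\<dots> = (\<Sum>v\<in>verts H - T. \<Sum>e\<in>{e \<in> edges H. T \<subseteq> e}. if v \<in> e then 1 else 0)"
    using fin by (simp add: sum.If_cases Int_def)
  also have "\<dots> = (\<Sum>e\<in>{e \<in> edges H. T \<subseteq> e}. \<Sum>v\<in>verts H - T. if v \<in> e then 1 else 0)"
    by (rule sum.swap)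
  also have "\<dots> = (\<Sum>e\<in>{e \<in> edges H. T \<subseteq> e}. k - card T)"
  proof (rule sum.cong[OF refl])
    fix e assume e: "e \<in> {e \<in> edges H. T \<subseteq> e}"
    then have "e \<subseteq> verts H" "card e = k" using kgraph_edge[OF assms(1)] by auto
    have "(\<Sum>v\<in>verts H - T. if v \<in> e then 1 else 0) = card ((verts H - T) \<inter> e)"
      using fin by (simp add: sum.If_cases Int_def)
    also have "(verts H - T) \<inter> e = e - T" using \<open>e \<subseteq> verts H\<close> by auto
    also have "card (e - T) = k - card T" using e fin \<open>card e = k\<close> by (simp add: card_Diff_subset)
    finally show "(\<Sum>v\<in>verts H - T. if v \<in> e then 1 else 0) = k - card T" .
  qed
  finally show ?thesis by (simp add: hg_degree_def mult.commute)
qed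

lemma floor_fraction_at_top:
  assumes "0 < (a::real)"
  shows "filterlim (\<lambda>n. nat \<lfloor>a * real n\<rfloor>) at_top sequentially"
  unfolding filterlim_at_top
proof
  fix Z :: nat
  show "\<forall>\<^sub>F n in sequentially. Z \<le> nat \<lfloor>a * real n\<rfloor>"
    using eventually_ge_at_top[of "nat \<lceil>real Z / a\<rceil>"]
  proof eventually_elim
    case (elim n)
    then have "real Z / a \<le> real n" by linarith
    then have "real Z \<le> a * real n" using assms by (simp add: divide_le_eq mult.commute)
    then show ?case by (rule le_nat_floor)
  qed
qed

text \<open>In the two-part pattern, an \<open>l\<close>-set outside \<open>A\<close> misses the completions outside \<open>A\<close>, one inside \<open>A\<close>
  misses the completions that are non-edges inside \<open>A\<close>, and one that meets both parts misses none.
  The choice of \<open>b\<close> makes the first two losses equal to a fraction \<open>b ^ m\<close>.\<close>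

lemma Phi_tree_lower:
  assumes F: "kgraph k (F :: nat hypergraph)" "edges F \<noteq> {}" and l: "1 \<le> l" "l < k"
    and \<alpha>: "turan_density k l F < 1" and d: "d < Phi k l (turan_density k l F)"
  shows "\<forall>\<^sub>F n in sequentially. adm k l n d (Phi_tree k F)"
proof -
  define m where "m = k - l"
  define \<alpha> where "\<alpha> = turan_density k l F"
  have \<alpha>0: "0 \<le> \<alpha>" using ex_ratio_tendsto_density(2)[OF F l(2)] by (simp add: \<alpha>_def)
  obtain b where b: "0 < b" "b < 1" "(1 - \<alpha>) * (1 - b) ^ m = b ^ m" "Phi k l \<alpha> = 1 - b ^ m"
    using Phi_balance[OF l(2) \<alpha>0] \<alpha> unfolding \<alpha>_def m_def by metis
  define \<eta> where "\<eta> = (1 - b ^ m - d) / 2"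
  have \<eta>: "0 < \<eta>" using d b by (simp add: \<eta>_def \<alpha>_def)
  define x where "x n = nat \<lfloor>(1 - b) * real n\<rfloor>" for n
  have "\<forall>\<^sub>F y in sequentially. \<exists>H :: nat hypergraph. kgraph k H \<and> verts H = {..<y} \<and> ldense k l (\<alpha> - \<eta>) H \<and> \<not> hg_hom F H"
    by (rule hom_free_if_below_density[OF F l(2)]) (use \<eta> in \<open>simp add: \<alpha>_def\<close>)
  moreover have "filterlim x at_top sequentially" unfolding x_def[abs_def] using b by (intro floor_fraction_at_top) auto
  ultimately have ev1: "\<forall>\<^sub>F n in sequentially. \<exists>H :: nat hypergraph. kgraph k H \<and> verts H = {..<x n} \<and> ldense k l (\<alpha> - \<eta>) H \<and> \<not> hg_hom F H"
    by (rule eventually_compose_filterlim)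
  have ev2: "\<forall>\<^sub>F n in sequentially. (1 - \<eta>) * real n ^ m < 1 * (fact m * real ((n - l) choose m))"
    by (rule eventually_density_slack) (use \<eta> in simp)
  have "(\<lambda>n. (b + 1 / real n) ^ m) \<longlonglongrightarrow> (b + 0) ^ m"
    by (intro tendsto_intros lim_const_over_n)
  then have ev3: "\<forall>\<^sub>F n in sequentially. (b + 1 / real n) ^ m < b ^ m + \<eta>"
    by (rule order_tendstoD(2)) (use \<eta> in simp)
  show ?thesis using ev1 ev2 ev3 eventually_gt_at_top[of 0]
  proof eventually_elim
    case (elim n)
    then obtain HA :: "nat hypergraph" where HA: "kgraph k HA" "verts HA = {..<x n}" "ldense k l (\<alpha> - \<eta>) HA" "\<not> hg_hom F HA"
      by blast
    define A where "A = {..<x n}"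
    define V where "V = {..<n}"
    have xn: "real (x n) \<le> (1 - b) * real n" using b by (simp add: x_def)
    also have "\<dots> \<le> 1 * real n" using b by (intro mult_right_mono) auto
    finally have xn': "x n \<le> n" by simp
    then have AV: "A \<subseteq> V" by (auto simp: A_def V_def)
    have fin: "finite V" "finite A" by (auto simp: V_def A_def)
    define E where "E = {e. e \<subseteq> V \<and> card e = k \<and> e \<inter> A \<noteq> {} \<and> (e \<subseteq> A \<longrightarrow> e \<in> edges HA)}"
    define G where "G = (V, E)"
    have G: "kgraph k G" using fin by (auto simp: G_def E_def kgraph_def)
    define fn where "fn = fact m * real ((n - l) choose m)"
    have "ldense k l d G" unfolding ldense_def
    proof (intro allI impI)
      fix S assume S: "S \<subseteq> verts G \<and> card S = l"
      then have SV: "S \<subseteq> V" and cS: "card S = l" by (auto simp: G_def)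
      have finS: "finite S" using SV fin finite_subset by blast
      have S0: "S \<noteq> {}" using cS l by auto
      define P where "P = {M. M \<subseteq> V - S \<and> card M = m}"
      define C where "C = {M. M \<subseteq> V - S \<and> card M = m \<and> S \<union> M \<in> E}"
      have deg: "hg_degree G S = card C"
        using degree_eq_card_completions[OF G, of S l] SV cS l by (simp add: G_def C_def m_def)
      have finP: "finite P" using fin by (auto simp: P_def intro: finite_subset[of _ "Pow V"])
      have finC: "finite C" using finP by (rule finite_subset[rotated]) (auto simp: C_def P_def)
      have cP: "card P = (n - l) choose m"
        unfolding P_def using fin SV finS cS by (subst n_subsets) (auto simp: card_Diff_subset V_def)
      have cU: "card (S \<union> M) = k" if "M \<in> P" for M
      proof -
        have "finite M" using that fin by (auto simp: P_def intro: finite_subset)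
        then show ?thesis using that finS cS l by (subst card_Un_disjoint) (auto simp: P_def m_def)
      qed
      have main: "fn - (b ^ m + \<eta>) * real n ^ m \<le> fact m * real (card C)"
      proof -
        consider "S \<inter> A = {}" | "S \<subseteq> A" | "S \<inter> A \<noteq> {}" "\<not> S \<subseteq> A" by blast
        then show ?thesis
        proof cases
          case 1
          define Q where "Q = {M. M \<subseteq> (V - A) - S \<and> card M = m}"
          have finQ: "finite Q" using fin by (auto simp: Q_def intro: finite_subset[of _ "Pow V"])
          have "P \<subseteq> C \<union> Q"
          proof
            fix M assume M: "M \<in> P"
            show "M \<in> C \<union> Q"
            proof (cases "M \<subseteq> V - A")
              case True then show ?thesis using M by (auto simp: P_def Q_def)
            next
              case False
              then have "S \<union> M \<in> E" using M cU[OF M] 1 S0 SV by (auto simp: E_def P_def)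
              then show ?thesis using M by (auto simp: C_def P_def)
            qed
          qed
          then have "card P \<le> card C + card Q"
            using card_mono[of "C \<union> Q" P] card_Un_le[of C Q] finC finQ by (meson finite_UnI le_trans)
          moreover have "card Q = (n - x n - l) choose m"
          proof -
            have "S \<subseteq> V - A" using 1 SV by auto
            then have "card ((V - A) - S) = n - x n - l"
              using card_Diff_subset[OF finS, of "V - A"] card_Diff_subset[OF fin(2) AV] cS
              by (simp add: V_def A_def)
            then show ?thesis unfolding Q_def using fin by (subst n_subsets) auto
          qed
          ultimately have "real ((n - l) choose m) \<le> real (card C) + real ((n - x n - l) choose m)"
            by (simp only: cP of_nat_add[symmetric] of_nat_le_iff)
          then have "fact m * real ((n - l) choose m) \<le> fact m * (real (card C) + real ((n - x n - l) choose m))"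
            by (intro mult_left_mono) auto
          then have "fn \<le> fact m * real (card C) + fact m * real ((n - x n - l) choose m)"
            by (simp only: fn_def distrib_left)
          moreover have "fact m * real ((n - x n - l) choose m) \<le> (b ^ m + \<eta>) * real n ^ m"
          proof -
            have "fact m * real ((n - x n - l) choose m) \<le> real (n - x n - l) ^ m" by (rule fact_choose_le_power)
            also have "\<dots> \<le> ((b + 1 / real n) * real n) ^ m"
            proof (intro power_mono)
              have "(1 - b) * real n < real (x n) + 1" using b by (simp add: x_def)
              then have "real (n - x n) \<le> b * real n + 1" using xn' by (simp add: of_nat_diff algebra_simps)
              then show "real (n - x n - l) \<le> (b + 1 / real n) * real n" using elim by (simp add: distrib_right)
            qed auto
            also have "\<dots> = (b + 1 / real n) ^ m * real n ^ m" by (rule power_mult_distrib)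
            also have "\<dots> \<le> (b ^ m + \<eta>) * real n ^ m" using elim by (intro mult_right_mono) auto
            finally show ?thesis .
          qed
          ultimately show ?thesis by linarith
        next
          case 2
          define Q where "Q = {M. M \<subseteq> A - S \<and> card M = m}"
          define R where "R = {M. M \<subseteq> A - S \<and> card M = m \<and> S \<union> M \<in> edges HA}"
          have finQ: "finite Q" using fin by (auto simp: Q_def intro: finite_subset[of _ "Pow V"] finite_subset[of _ "Pow A"])
          have finR: "finite R" using finQ by (rule finite_subset[rotated]) (auto simp: Q_def R_def)
          have degR: "hg_degree HA S = card R"
            using degree_eq_card_completions[OF HA(1), of S l] 2 cS l HA(2) by (simp add: R_def A_def m_def)
          have "(P - Q) \<union> R \<subseteq> C"
          proof
            fix M assume "M \<in> (P - Q) \<union> R"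
            then consider "M \<in> P" "M \<notin> Q" | "M \<in> R" by blast
            then show "M \<in> C"
            proof cases
              case a: 1
              then have "\<not> M \<subseteq> A" by (auto simp: P_def Q_def)
              then have "S \<union> M \<in> E" using a cU[OF a(1)] 2 S0 SV by (auto simp: E_def P_def)
              then show ?thesis using a by (auto simp: C_def P_def)
            next
              case a: 2
              then have MP: "M \<in> P" using AV by (auto simp: P_def R_def)
              then have "S \<union> M \<in> E" using a cU[OF MP] 2 S0 SV by (auto simp: E_def P_def R_def)
              then show ?thesis using MP by (auto simp: C_def P_def)
            qed
          qed
          then have "card ((P - Q) \<union> R) \<le> card C" using finC by (intro card_mono)
          moreover have "card ((P - Q) \<union> R) = card (P - Q) + card R"
            using finP finR by (intro card_Un_disjoint) (auto simp: Q_def R_def)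
          moreover have "card P \<le> card (P - Q) + card Q"
            using diff_card_le_card_Diff[OF finQ, of P] by linarith
          ultimately have "card P + card R \<le> card C + card Q" by linarith
          moreover have "card Q = (x n - l) choose m"
            unfolding Q_def using fin 2 finS cS by (subst n_subsets) (auto simp: card_Diff_subset A_def)
          ultimately have "real ((n - l) choose m) + real (card R) \<le> real (card C) + real ((x n - l) choose m)"
            by (simp only: cP of_nat_add[symmetric] of_nat_le_iff)
          then have "fact m * (real ((n - l) choose m) + real (card R)) \<le> fact m * (real (card C) + real ((x n - l) choose m))"
            by (intro mult_left_mono) auto
          then have 1: "fn + fact m * real (card R) \<le> fact m * real (card C) + fact m * real ((x n - l) choose m)"
            by (simp only: fn_def distrib_left)
          have 2: "fact m * real ((x n - l) choose m) \<le> real (x n) ^ m"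
            using fact_choose_le_power[of m "x n - l"] power_mono[of "real (x n - l)" "real (x n)" m] by simp
          have "(\<alpha> - \<eta>) * real (x n) ^ m \<le> fact m * real (card R)"
            unfolding degR[symmetric] using HA(3) cS HA(2) \<open>S \<subseteq> A\<close> by (simp add: ldense_def A_def m_def)
          then have "fn - (1 - (\<alpha> - \<eta>)) * real (x n) ^ m \<le> fact m * real (card C)"
            using 1 2 by (simp add: left_diff_distrib)
          moreover have "(1 - (\<alpha> - \<eta>)) * real (x n) ^ m \<le> (b ^ m + \<eta>) * real n ^ m"
          proof -
            have "(1 - (\<alpha> - \<eta>)) * real (x n) ^ m \<le> (1 - (\<alpha> - \<eta>)) * ((1 - b) * real n) ^ m"
              using xn \<eta> \<alpha> by (intro mult_left_mono power_mono) (auto simp: \<alpha>_def)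
            also have "\<dots> = ((1 - \<alpha>) * (1 - b) ^ m + \<eta> * (1 - b) ^ m) * real n ^ m"
              unfolding power_mult_distrib by algebra
            also have "\<dots> = (b ^ m + \<eta> * (1 - b) ^ m) * real n ^ m" by (simp only: b(3))
            also have "\<dots> \<le> (b ^ m + \<eta> * 1) * real n ^ m"
              using b \<eta> by (intro mult_right_mono add_left_mono mult_left_mono power_le_one) auto
            finally show ?thesis by simp
          qed
          ultimately show ?thesis by linarith
        next
          case 3
          have "P \<subseteq> C"
          proof
            fix M assume M: "M \<in> P"
            then have "S \<union> M \<in> E" using cU[OF M] 3 SV by (auto simp: E_def P_def)
            then show "M \<in> C" using M by (auto simp: C_def P_def)
          qed
          then have "card P \<le> card C" using finC by (intro card_mono)
          then have "fn \<le> fact m * real (card C)" by (simp add: fn_def cP)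
          moreover have "0 \<le> (b ^ m + \<eta>) * real n ^ m" using b \<eta> by simp
          ultimately show ?thesis by linarith
        qed
      qed
      define X where "X = real n ^ m"
      have "2 * \<eta> = 1 - b ^ m - d" by (simp add: \<eta>_def)
      then have "2 * \<eta> * X = (1 - b ^ m - d) * X" by (rule arg_cong)
      then have "2 * (\<eta> * X) = X - b ^ m * X - d * X" by (simp only: left_diff_distrib mult.assoc mult_1_left)
      moreover have "X - \<eta> * X < fn" using elim by (simp add: fn_def X_def left_diff_distrib)
      moreover have "fn - (b ^ m * X + \<eta> * X) \<le> fact m * real (card C)"
        using main by (simp only: X_def distrib_right)
      ultimately have "d * X \<le> fact m * real (card C)" by linarith
      then show "d * real (card (verts G)) ^ (k - l) \<le> fact (k - l) * real (hg_degree G S)"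
        unfolding deg by (simp add: G_def V_def m_def X_def)
    qed
    moreover have "\<not> hg_hom (Phi_tree k F) G"
    proof (rule Phi_tree_not_hom[OF F(1), where A = A and EA = "edges HA"])
      have "(A, edges HA) = HA" using HA(2) by (simp add: A_def prod_eq_iff)
      then show "\<not> hg_hom F (A, edges HA)" using HA(4) by simp
    qed (auto simp: G_def E_def)
    then have "\<not> hg_emb (Phi_tree k F) G" using emb_imp_hom by blast
    moreover have "card (verts G) = n" by (simp add: G_def V_def)
    ultimately show ?case using G unfolding adm_def by blast
  qed
qed

text \<open>Call a set of at least \<open>l\<close> vertices good if its link is denser than the complement of a clique of
  relative size \<open>b\<close>; all smaller sets count as good. By averaging, the good one-vertex extensions of
  a good set make up at least a fraction \<open>1 - b\<close> of the vertices, up to a bounded number, so they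
  contain an image of \<open>F\<close>. The tree is mapped level by level, the vertices of each branch forming a
  good set.\<close>

lemma Phi_tree_hom:
  assumes H: "kgraph k (H :: nat hypergraph)" and n: "card (verts H) = n" "0 < n" and l: "1 \<le> l" "l < k"
    and b: "0 < b" "b \<le> 1"
    and dense: "ldense k l c H" and c: "1 - b ^ (k - l) < c"
    and copies: "\<And>X. X \<subseteq> verts H \<Longrightarrow> (1 - b) * real n - real k \<le> real (card X) \<Longrightarrow>
      hg_hom F (X, {e \<in> edges H. e \<subseteq> X})"
  shows "hg_hom (Phi_tree k F) H"
proof -
  let ?V = "verts H" and ?E = "edges H"
  have finV: "finite ?V" by (rule kgraph_finite[OF H])
  define good where "good T \<longleftrightarrow> T \<subseteq> ?V \<and> card T \<le> k \<and> (l \<le> card T \<longrightarrow>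
    (1 - b ^ (k - card T)) * real n ^ (k - card T) < fact (k - card T) * real (hg_degree H T))" for T
  have extensions: "(1 - b) * real n - real k \<le> real (card {v \<in> ?V - T. good (insert v T)})"
    if T: "good T" "card T < k" for T
  proof (cases "card T < l")
    case True
    have finT: "finite T" using T finV finite_subset by (auto simp: good_def)
    have "good (insert v T)" if v: "v \<in> ?V - T" for v
    proof -
      have cv: "card (insert v T) = Suc (card T)" using v finT by simp
      have sub: "insert v T \<subseteq> ?V" using v T by (auto simp: good_def)
      show ?thesis
      proof (cases "Suc (card T) = l")
        case eq: True
        have "(1 - b ^ (k - l)) * real n ^ (k - l) < c * real n ^ (k - l)"
          using c n by (intro mult_strict_right_mono) auto
        also have "\<dots> \<le> fact (k - l) * real (hg_degree H (insert v T))"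
          using dense sub cv eq n unfolding ldense_def by auto
        finally show ?thesis using sub cv eq l by (auto simp: good_def)
      next
        case False
        then show ?thesis using sub cv True T by (auto simp: good_def)
      qed
    qed
    then have "{v \<in> ?V - T. good (insert v T)} = ?V - T" by auto
    then have "real (card {v \<in> ?V - T. good (insert v T)}) = real n - real (card T)"
      using T finT n by (auto simp: good_def card_Diff_subset card_mono finV of_nat_diff)
    moreover have "(1 - b) * real n \<le> 1 * real n" using b by (intro mult_right_mono) auto
    ultimately show ?thesis using T(2) by simp
  next
    case False
    then have lT: "l \<le> card T" by simp
    define q where "q = k - card T - 1"
    have q: "k - card T = Suc q" using T by (simp add: q_def)
    have finT: "finite T" "T \<subseteq> ?V" using T finV finite_subset by (auto simp: good_def)
    let ?X = "{v \<in> ?V - T. good (insert v T)}"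
    have deg_le: "fact q * real (hg_degree H (insert v T)) \<le> (if good (insert v T) then real n ^ q else (1 - b ^ q) * real n ^ q)"
      if v: "v \<in> ?V - T" for v
    proof -
      have cv: "card (insert v T) = Suc (card T)" using v finT by simp
      have kq: "k - Suc (card T) = q" by (simp add: q_def)
      show ?thesis
      proof (cases "good (insert v T)")
        case True
        then show ?thesis using degree_le[OF H, of "insert v T" "Suc (card T)"] v finT cv T n kq by auto
      next
        case False
        then show ?thesis using v finT cv T lT kq by (auto simp: good_def)
      qed
    qed
    have "fact q * real (\<Sum>v\<in>?V - T. hg_degree H (insert v T)) = fact q * real ((k - card T) * hg_degree H T)"
      using sum_degrees_insert[OF H finT(2)] T by simp
    also have "\<dots> = fact (Suc q) * real (hg_degree H T)" by (simp add: q algebra_simps)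
    finally have "(1 - b ^ Suc q) * real n ^ Suc q < fact q * real (\<Sum>v\<in>?V - T. hg_degree H (insert v T))"
      using T(1) lT by (simp add: good_def q mult_ac)
    also have "\<dots> = (\<Sum>v\<in>?V - T. fact q * real (hg_degree H (insert v T)))"
      by (simp add: sum_distrib_left)
    also have "\<dots> \<le> (\<Sum>v\<in>?V - T. if good (insert v T) then real n ^ q else (1 - b ^ q) * real n ^ q)"
      using deg_le by (intro sum_mono)
    also have "\<dots> = (\<Sum>v\<in>?V - T. (1 - b ^ q) * real n ^ q + (if good (insert v T) then b ^ q * real n ^ q else 0))"
      by (rule sum.cong) (auto simp: algebra_simps)
    also have "\<dots> = real (card (?V - T)) * ((1 - b ^ q) * real n ^ q) + real (card ?X) * (b ^ q * real n ^ q)"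
      using finV by (simp add: sum.distrib sum.If_cases Int_def)
    also have "\<dots> \<le> real n * ((1 - b ^ q) * real n ^ q) + real (card ?X) * (b ^ q * real n ^ q)"
    proof -
      have "card (?V - T) \<le> n" using finV n by (metis Diff_subset card_mono)
      moreover have "b ^ q \<le> 1" using b by (intro power_le_one) auto
      ultimately show ?thesis by (intro add_right_mono mult_right_mono) auto
    qed
    finally have "real n ^ q * ((1 - b ^ Suc q) * real n) < real n ^ q * (real n * (1 - b ^ q) + real (card ?X) * b ^ q)"
      by (simp add: algebra_simps)
    then have "(1 - b ^ Suc q) * real n < real n * (1 - b ^ q) + real (card ?X) * b ^ q"
      using n by (simp only: mult_less_cancel_left_pos zero_less_power of_nat_0_less_iff)
    then have "b ^ q * ((1 - b) * real n) < b ^ q * real (card ?X)" by (simp add: algebra_simps)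
    then have "(1 - b) * real n < real (card ?X)" using b by simp
    then show ?thesis by simp
  qed
  define rooted where "rooted r T g \<longleftrightarrow>
      (\<forall>p. set p \<subseteq> verts F \<and> p \<noteq> [] \<and> length p \<le> r \<longrightarrow> g p \<in> ?V) \<and>
      (\<forall>p e. set p \<subseteq> verts F \<and> length p < r \<and> e \<in> edges F \<longrightarrow> (\<lambda>v. g (p @ [v])) ` e \<in> ?E) \<and>
      (\<forall>q. set q \<subseteq> verts F \<and> length q = r \<longrightarrow> T \<union> (\<lambda>i. g (take i q)) ` {1..r} \<in> ?E)" for r T g
  have tree: "\<exists>g. rooted r T g"
    if "r \<le> k" "good T" "card T = k - r" for r T
    using that
  proof (induction r arbitrary: T)
    case 0
    then have "0 < hg_degree H T" using l by (simp add: good_def)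
    then have "{e \<in> ?E. T \<subseteq> e} \<noteq> {}" unfolding hg_degree_def by (metis card.empty less_irrefl)
    then obtain e where e: "e \<in> ?E" "T \<subseteq> e" by blast
    then have "e = T" using kgraph_edge[OF H e(1)] 0 finV finite_subset[of e ?V] card_subset_eq[of e T] by auto
    then show ?case using e by (auto simp: rooted_def)
  next
    case (Suc r)
    let ?X = "{v \<in> ?V - T. good (insert v T)}"
    have "(1 - b) * real n - real k \<le> real (card ?X)" using Suc.prems by (intro extensions) auto
    then have "hg_hom F (?X, {e \<in> ?E. e \<subseteq> ?X})" by (intro copies) auto
    then obtain x where x: "\<And>v. v \<in> verts F \<Longrightarrow> x v \<in> ?X" "\<And>e. e \<in> edges F \<Longrightarrow> x ` e \<in> ?E"
      by (auto simp: hg_hom_def)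
    have "\<forall>v\<in>verts F. \<exists>g. rooted r (insert (x v) T) g"
    proof
      fix v assume v: "v \<in> verts F"
      have "finite T" using Suc.prems finV finite_subset by (auto simp: good_def)
      then have "card (insert (x v) T) = k - r" using x(1)[OF v] Suc.prems by auto
      then show "\<exists>g. rooted r (insert (x v) T) g"
        using x(1)[OF v] Suc.prems by (intro Suc.IH) auto
    qed
    then obtain G where "\<forall>v\<in>verts F. rooted r (insert (x v) T) (G v)" using bchoice by metis
    then have G: "\<And>v p. v \<in> verts F \<Longrightarrow> set p \<subseteq> verts F \<Longrightarrow> p \<noteq> [] \<Longrightarrow> length p \<le> r \<Longrightarrow> G v p \<in> ?V"
      "\<And>v p e. v \<in> verts F \<Longrightarrow> set p \<subseteq> verts F \<Longrightarrow> length p < r \<Longrightarrow> e \<in> edges F \<Longrightarrow> (\<lambda>w. G v (p @ [w])) ` e \<in> ?E"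
      "\<And>v q. v \<in> verts F \<Longrightarrow> set q \<subseteq> verts F \<Longrightarrow> length q = r \<Longrightarrow> insert (x v) T \<union> (\<lambda>i. G v (take i q)) ` {1..r} \<in> ?E"
      unfolding rooted_def by blast+
    define g where "g p = (if tl p = [] then x (hd p) else G (hd p) (tl p))" for p
    have "rooted (Suc r) T g" unfolding rooted_def
    proof (intro conjI allI impI; elim conjE)
      fix p assume p: "set p \<subseteq> verts F" "p \<noteq> []" "length p \<le> Suc r"
      then obtain v s where "p = v # s" by (cases p) auto
      then show "g p \<in> ?V" using p x(1)[of v] G(1)[of v s] by (auto simp: g_def)
    next
      fix p e assume p: "set p \<subseteq> verts F" "length p < Suc r" "e \<in> edges F"
      show "(\<lambda>v. g (p @ [v])) ` e \<in> ?E"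
      proof (cases p)
        case Nil
        then show ?thesis using x(2)[OF p(3)] by (simp add: g_def)
      next
        case (Cons v s)
        then show ?thesis using G(2)[of v s e] p by (simp add: g_def)
      qed
    next
      fix q assume q: "set q \<subseteq> verts F" "length q = Suc r"
      then obtain v s where vs: "q = v # s" by (cases q) auto
      have "{1..Suc r} = insert 1 (Suc ` {1..r})" unfolding image_Suc_atLeastAtMost by auto
      then have "(\<lambda>i. g (take i q)) ` {1..Suc r} = insert (g (take 1 q)) ((\<lambda>i. g (take i q)) ` Suc ` {1..r})"
        by (simp only: image_insert)
      also have "(\<lambda>i. g (take i q)) ` Suc ` {1..r} = (\<lambda>i. G v (take i s)) ` {1..r}"
        unfolding image_image by (rule image_cong) (use q vs in \<open>auto simp: g_def\<close>)
      also have "g (take 1 q) = x v" by (simp add: g_def vs)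
      finally show "T \<union> (\<lambda>i. g (take i q)) ` {1..Suc r} \<in> ?E" using G(3)[of v s] q vs by simp
    qed
    then show ?case by blast
  qed
  have "good {}" using l by (simp add: good_def)
  then obtain g where g: "\<forall>p. set p \<subseteq> verts F \<and> p \<noteq> [] \<and> length p \<le> k \<longrightarrow> g p \<in> ?V"
     "\<forall>p e. set p \<subseteq> verts F \<and> length p < k \<and> e \<in> edges F \<longrightarrow> (\<lambda>v. g (p @ [v])) ` e \<in> ?E"
     "\<forall>q. set q \<subseteq> verts F \<and> length q = k \<longrightarrow> (\<lambda>i. g (take i q)) ` {1..k} \<in> ?E"
    using tree[of k "{}"] by (auto simp: rooted_def)
  show ?thesis unfolding hg_hom_def
    by (rule exI[of _ g]) (use g in \<open>auto simp: Phi_tree_def image_image\<close>)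
qed

text \<open>Passing to \<open>X\<close> loses at most the completions that leave \<open>X\<close>.\<close>

lemma induced_degree:
  assumes H: "kgraph k H" and X: "X \<subseteq> verts H" and dense: "ldense k l c H" and l: "l \<le> k"
    and S: "S \<subseteq> X" "card S = l"
  shows "real (card X) ^ (k - l) - (1 - c) * real (card (verts H)) ^ (k - l)
    \<le> fact (k - l) * real (hg_degree (X, {e \<in> edges H. e \<subseteq> X}) S)"
proof -
  let ?V = "verts H" and ?HX = "(X, {e \<in> edges H. e \<subseteq> X})"
  define m where "m = k - l"
  define n where "n = card ?V"
  have fin: "finite ?V" "finite X" "finite S"
    using kgraph_finite[OF H] X S finite_subset by metis+
  have HX: "kgraph k ?HX" using H fin by (auto simp: kgraph_def)
  define P where "P = {M. M \<subseteq> ?V - S \<and> card M = m}"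
  define Q where "Q = {M. M \<subseteq> X - S \<and> card M = m}"
  define C where "C = {M. M \<subseteq> ?V - S \<and> card M = m \<and> S \<union> M \<in> edges H}"
  have finP: "finite P" using fin by (auto simp: P_def intro: finite_subset[of _ "Pow ?V"])
  have QP: "Q \<subseteq> P" and CP: "C \<subseteq> P" using X by (auto simp: P_def Q_def C_def)
  have degH: "hg_degree H S = card C"
    using degree_eq_card_completions[OF H, of S l] S X l by (auto simp: C_def m_def)
  have degX: "hg_degree ?HX S = card (C \<inter> Q)"
  proof -
    have "hg_degree ?HX S = card {M. M \<subseteq> X - S \<and> card M = m \<and> S \<union> M \<in> edges ?HX}"
      using degree_eq_card_completions[OF HX, of S l] S l by (simp add: m_def)
    also have "{M. M \<subseteq> X - S \<and> card M = m \<and> S \<union> M \<in> edges ?HX} = C \<inter> Q"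
      using S X by (auto simp: C_def Q_def)
    finally show ?thesis .
  qed
  have "C \<subseteq> (C \<inter> Q) \<union> (P - Q)" using CP by auto
  then have "card C \<le> card ((C \<inter> Q) \<union> (P - Q))"
    using finP finite_subset[OF CP] by (intro card_mono) auto
  also have "\<dots> \<le> card (C \<inter> Q) + card (P - Q)" by (rule card_Un_le)
  also have "card (P - Q) = card P - card Q" using finP QP finite_subset by (intro card_Diff_subset) auto
  finally have 1: "card C \<le> card (C \<inter> Q) + (card P - card Q)" .
  have "card Q \<le> card P" using finP QP by (rule card_mono)
  with 1 have "real (card C) \<le> real (card (C \<inter> Q)) + (real (card P) - real (card Q))" by linarith
  then have "fact m * real (card C) \<le> fact m * (real (card (C \<inter> Q)) + (real (card P) - real (card Q)))"
    by (intro mult_left_mono) auto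
  also have "\<dots> = fact m * real (card (C \<inter> Q)) + (fact m * real (card P) - fact m * real (card Q))"
    by (simp only: distrib_left right_diff_distrib)
  also have "fact m * real (card P) - fact m * real (card Q) \<le> real n ^ m - real (card X) ^ m"
  proof -
    have "card P = (n - l) choose m" "card Q = (card X - l) choose m"
      unfolding P_def Q_def n_def using fin S X by (auto simp: n_subsets card_Diff_subset)
    moreover have "card X \<le> n" unfolding n_def using fin(1) X by (rule card_mono)
    ultimately show ?thesis using fact_choose_diff_le[of "card X" n m l] by simp
  qed
  finally have "fact m * real (card C) \<le> fact m * real (card (C \<inter> Q)) + (real n ^ m - real (card X) ^ m)" by simp
  moreover have "c * real n ^ m \<le> fact m * real (card C)"
    using dense S X unfolding ldense_def degH[symmetric] n_def m_def by auto
  ultimately show ?thesis unfolding degX by (simp add: m_def[symmetric] n_def[symmetric] left_diff_distrib)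
qed

text \<open>For the upper bound, a density above \<open>1 - b ^ m\<close> is also above \<open>1 - b0 ^ m\<close> for some \<open>b0 < b\<close>. By
  the equation that defines \<open>b\<close>, a set of relative size about \<open>1 - b0\<close> then induces a density above
  that of \<open>F\<close>, and \<open>Phi_tree_hom\<close> applies.\<close>

theorem Phi_tree_density:
  assumes F: "kgraph k (F :: nat hypergraph)" "edges F \<noteq> {}" and l: "1 \<le> l" "l < k"
    and \<alpha>: "turan_density k l F < 1"
  shows "turan_density k l (Phi_tree k F) = Phi k l (turan_density k l F)"
proof (rule antisym)
  define m where "m = k - l"
  define \<alpha> where "\<alpha> = turan_density k l F"
  let ?F' = "Phi_tree k F"
  obtain e where "e \<in> edges F" using F by auto
  then have "(\<lambda>v. [] @ [v]) ` e \<in> edges ?F'" using l unfolding Phi_tree_def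
    by (simp only: snd_conv) (intro UnI1 CollectI exI[of _ "[]"] exI[of _ e], auto)
  then have F': "kgraph k ?F'" "edges ?F' \<noteq> {}" using Phi_tree_kgraph[OF F(1)] by auto
  have \<alpha>0: "0 \<le> \<alpha>" using ex_ratio_tendsto_density(2)[OF F l(2)] by (simp add: \<alpha>_def)
  obtain b where b: "0 < b" "b < 1" "(1 - \<alpha>) * (1 - b) ^ m = b ^ m" "Phi k l \<alpha> = 1 - b ^ m"
    using Phi_balance[OF l(2) \<alpha>0] \<alpha> unfolding \<alpha>_def m_def by metis
  have m: "0 < m" using l by (simp add: m_def)
  show "Phi k l (turan_density k l F) \<le> turan_density k l ?F'"
  proof (rule ccontr)
    assume "\<not> Phi k l (turan_density k l F) \<le> turan_density k l ?F'"
    then obtain d where d: "turan_density k l ?F' < d" "d < Phi k l (turan_density k l F)"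
      using dense[of "turan_density k l ?F'"] by (auto simp: not_le)
    have "d \<le> turan_density k l ?F'"
      using Phi_tree_lower[OF F l \<alpha> d(2)]
      by (intro density_ge_if_frequently_adm[OF F' l(2)] eventually_frequently) auto
    then show False using d by simp
  qed
  show "turan_density k l ?F' \<le> Phi k l (turan_density k l F)"
  proof (rule density_le_if_hom_forced'[OF F' l(2)])
    fix c assume "Phi k l (turan_density k l F) < c"
    then have c: "1 - b ^ m < c" using b by (simp add: \<alpha>_def)
    obtain b0 where b0: "0 < b0" "b0 < b" "1 - b0 ^ m < c"
    proof -
      have "((\<lambda>t. 1 - t ^ m) \<longlongrightarrow> 1 - b ^ m) (at_left b)" by (intro tendsto_intros)
      then have "\<forall>\<^sub>F t in at_left b. 1 - t ^ m < c" using c by (rule order_tendstoD(2))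
      moreover have "\<forall>\<^sub>F t in at_left b. t \<in> {0<..<b}" using b by (intro eventually_at_leftI[of 0]) auto
      ultimately have "\<forall>\<^sub>F t in at_left b. 1 - t ^ m < c \<and> t \<in> {0<..<b}" by (rule eventually_conj)
      then obtain t where "1 - t ^ m < c \<and> t \<in> {0<..<b}"
        using eventually_happens'[OF trivial_limit_at_left_real] by blast
      then show thesis by (intro that[of t]) auto
    qed
    define b1 where "b1 = (b0 + b) / 2"
    have b1: "b0 < b1" "b1 < b" using b0 by (auto simp: b1_def)
    define \<alpha>1 where "\<alpha>1 = 1 - b0 ^ m / (1 - b1) ^ m"
    have "\<alpha> < \<alpha>1"
    proof -
      have "b0 ^ m < b ^ m" using b0 m by (intro power_strict_mono) auto
      moreover have "(1 - b) ^ m \<le> (1 - b1) ^ m" using b b1 by (intro power_mono) auto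
      moreover have "0 < (1 - b) ^ m" using b by simp
      ultimately have "b0 ^ m / (1 - b1) ^ m < b ^ m / (1 - b) ^ m"
        using b0 by (intro frac_less) auto
      also have "b ^ m / (1 - b) ^ m = 1 - \<alpha>" unfolding b(3)[symmetric] using b(2) by simp
      finally show ?thesis by (simp add: \<alpha>1_def)
    qed
    then have "\<forall>\<^sub>F x in sequentially. \<forall>H :: nat hypergraph. kgraph k H \<and> card (verts H) = x \<and> ldense k l \<alpha>1 H \<longrightarrow> hg_emb F H"
      by (intro emb_if_above_density[OF F l(2)]) (simp add: \<alpha>_def)
    then obtain x0 where x0: "\<And>H :: nat hypergraph. kgraph k H \<Longrightarrow> x0 \<le> card (verts H) \<Longrightarrow> ldense k l \<alpha>1 H \<Longrightarrow> hg_emb F H"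
      unfolding eventually_sequentially by blast
    show "\<forall>\<^sub>F N in sequentially. \<forall>H :: nat hypergraph. kgraph k H \<and> verts H = {..<N} \<and> ldense k l c H \<longrightarrow> hg_hom ?F' H"
      using eventually_gt_at_top[of 0] eventually_ge_at_top[of "nat \<lceil>real k / (b1 - b0)\<rceil>"]
        eventually_ge_at_top[of "nat \<lceil>real x0 / (1 - b1)\<rceil>"]
    proof eventually_elim
      case (elim N)
      show ?case
      proof (intro allI impI, elim conjE)
        fix H :: "nat hypergraph" assume H: "kgraph k H" "verts H = {..<N}" "ldense k l c H"
        have "real k / (b1 - b0) \<le> real N" using elim(2) by linarith
        then have N1: "real k \<le> (b1 - b0) * real N" using b1 by (simp add: divide_le_eq mult.commute)
        have "real x0 / (1 - b1) \<le> real N" using elim(3) by linarith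
        then have N2: "real x0 \<le> (1 - b1) * real N" using b1 b by (simp add: divide_le_eq mult.commute)
        show "hg_hom ?F' H"
        proof (rule Phi_tree_hom[OF H(1) _ _ l _ _ H(3)])
          fix X assume X: "X \<subseteq> verts H" "(1 - b0) * real N - real k \<le> real (card X)"
          have "(1 - b1) * real N \<le> (1 - b0) * real N - real k" using N1 by (simp add: left_diff_distrib)
          then have cX: "(1 - b1) * real N \<le> real (card X)" using X(2) by linarith
          let ?HX = "(X, {e \<in> edges H. e \<subseteq> X})"
          have "kgraph k ?HX" using H X finite_subset[OF X(1)] by (auto simp: kgraph_def)
          moreover have "x0 \<le> card (verts ?HX)" using cX N2 by simp
          moreover have "ldense k l \<alpha>1 ?HX" unfolding ldense_def
          proof (intro allI impI)
            fix S assume S: "S \<subseteq> verts ?HX \<and> card S = l"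
            have "\<alpha>1 * real (card X) ^ m \<le> real (card X) ^ m - (1 - c) * real N ^ m"
            proof -
              have "(1 - c) * real N ^ m \<le> b0 ^ m * real N ^ m" using b0 by (intro mult_right_mono) auto
              also have "\<dots> = b0 ^ m / (1 - b1) ^ m * ((1 - b1) * real N) ^ m"
                using b b1 by (simp add: power_mult_distrib)
              also have "\<dots> \<le> b0 ^ m / (1 - b1) ^ m * real (card X) ^ m"
                using cX b b1 b0 by (intro mult_left_mono power_mono) auto
              finally show ?thesis by (simp add: \<alpha>1_def left_diff_distrib)
            qed
            also have "\<dots> \<le> fact m * real (hg_degree ?HX S)"
              using induced_degree[OF H(1) X(1) H(3), of S] S l H(2) by (simp add: m_def)
            finally show "\<alpha>1 * real (card (verts ?HX)) ^ (k - l) \<le> fact (k - l) * real (hg_degree ?HX S)"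
              by (simp add: m_def)
          qed
          ultimately show "hg_hom F ?HX" using x0 emb_imp_hom by blast
        qed (use H(2) elim(1) b b0 in \<open>auto simp: m_def[symmetric]\<close>)
      qed
    qed
  qed
qed

lemma density_in_spectrum:
  assumes F: "kgraph k (F :: 'a hypergraph)" "edges F \<noteq> {}"
  shows "turan_density k l F \<in> turan_spectrum k l"
proof -
  obtain f :: "'a \<Rightarrow> nat" where f: "inj_on f (verts F)"
    using finite_imp_inj_to_nat_seg[OF kgraph_finite[OF F(1)]] by metis
  have kg: "kgraph k (hg_map f F)" by (rule hg_map_kgraph[OF F(1) f])
  have "hg_free (hg_map f F) H \<longleftrightarrow> hg_free F H" for H :: "nat hypergraph"
    unfolding hg_free_iff_no_emb[OF F(1)] hg_free_iff_no_emb[OF kg]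
    using emb_trans[OF hg_map_emb[OF f], of H] emb_trans[OF hg_map_emb_back[OF F(1) f], of H] by blast
  then have "turan_density k l (hg_map f F) = turan_density k l F"
    by (simp add: turan_density_def ex_degree_def)
  moreover have "edges (hg_map f F) \<noteq> {}" using F by (simp add: hg_map_def)
  ultimately show ?thesis using kg unfolding turan_spectrum_def by (metis (mono_tags, lifting) mem_Collect_eq)
qed

lemma Phi_in_spectrum:
  assumes l: "1 \<le> l" "l < k" and \<alpha>: "\<alpha> \<in> turan_spectrum k l" "\<alpha> < 1"
  shows "Phi k l \<alpha> \<in> turan_spectrum k l"
proof -
  obtain F :: "nat hypergraph" where F: "kgraph k F" "edges F \<noteq> {}" "\<alpha> = turan_density k l F"
    using \<alpha>(1) unfolding turan_spectrum_def by blast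
  obtain e where "e \<in> edges F" using F by auto
  then have "(\<lambda>v. [] @ [v]) ` e \<in> edges (Phi_tree k F)" using l unfolding Phi_tree_def
    by (simp only: snd_conv) (intro UnI1 CollectI exI[of _ "[]"] exI[of _ e], auto)
  then show ?thesis
    using density_in_spectrum[OF Phi_tree_kgraph[OF F(1)], of l] Phi_tree_density[OF F(1,2) l] \<alpha> F(3) by auto
qed

lemma Acc_iff: "x \<in> Acc A \<longleftrightarrow> (\<forall>e>0. \<exists>a\<in>A. a \<noteq> x \<and> \<bar>a - x\<bar> < e)"
  by (simp add: Acc_def islimpt_approachable dist_real_def)

text \<open>Continuity maps nearby densities to nearby densities, and strict monotonicity to different ones.\<close>

theorem Phi_accumulation:
  assumes l: "1 \<le> l" "l < k" and \<beta>: "\<beta> \<in> Acc (turan_spectrum k l)" "\<beta> < 1"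
  shows "Phi k l \<beta> \<in> Acc (turan_spectrum k l)"
  unfolding Acc_iff
proof (intro allI impI)
  fix e :: real assume "0 < e"
  obtain \<delta> where \<delta>: "0 < \<delta>" "\<And>x. \<bar>x - \<beta>\<bar> < \<delta> \<Longrightarrow> \<bar>Phi k l x - Phi k l \<beta>\<bar> < e"
    using Phi_isCont[OF l(2) \<beta>(2)] \<open>0 < e\<close> unfolding continuous_at_eps_delta dist_real_def by blast
  obtain \<alpha> where \<alpha>: "\<alpha> \<in> turan_spectrum k l" "\<alpha> \<noteq> \<beta>" "\<bar>\<alpha> - \<beta>\<bar> < min \<delta> (1 - \<beta>)"
    using \<beta> \<delta>(1) unfolding Acc_iff by (metis diff_gt_0_iff_gt min_less_iff_conj)
  then have "\<alpha> < 1" by linarith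
  moreover have "Phi k l \<alpha> \<noteq> Phi k l \<beta>"
    using Phi_strict_mono[OF l(2), of \<alpha> \<beta>] Phi_strict_mono[OF l(2), of \<beta> \<alpha>] \<alpha>(2) \<beta>(2) \<open>\<alpha> < 1\<close> by fastforce
  ultimately show "\<exists>a\<in>turan_spectrum k l. a \<noteq> Phi k l \<beta> \<and> \<bar>a - Phi k l \<beta>\<bar> < e"
    using Phi_in_spectrum[OF l \<alpha>(1)] \<delta>(2) \<alpha>(3) by (intro bexI[of _ "Phi k l \<alpha>"]) auto
qed

text \<open>If there were finitely many accumulation points, then \<open>Phi\<close> would move the largest one below \<open>1\<close>
  further up.\<close>

lemma infinite_accumulation:
  assumes l: "1 \<le> l" "l < k" and \<gamma>: "\<gamma> \<in> Acc (turan_spectrum k l)" "0 \<le> \<gamma>" "\<gamma> < 1"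
  shows "infinite (Acc (turan_spectrum k l))"
proof
  assume fin: "finite (Acc (turan_spectrum k l))"
  define B where "B = Acc (turan_spectrum k l) \<inter> {0..<1}"
  have B: "finite B" "B \<noteq> {}" using fin \<gamma> by (auto simp: B_def)
  then have M: "Max B \<in> B" by simp
  then have M': "0 \<le> Max B" "Max B < 1" "Max B \<in> Acc (turan_spectrum k l)" by (auto simp: B_def)
  have "Phi k l (Max B) \<in> B"
    using Phi_accumulation[OF l M'(3,2)] Phi_bounds[OF l(2) M'(1,2)] M' by (auto simp: B_def)
  then have "Phi k l (Max B) \<le> Max B" using B by simp
  then show False using Phi_bounds(1)[OF l(2) M'(1,2)] by simp
qed

section \<open>Accumulation at zero for large degree parameters\<close>

text \<open>Simultaneous Diophantine approximation turns a solution modulo a large \<open>q\<close> into small integers that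
  solve the equations exactly, with some \<open>t\<close> between \<open>0\<close> and \<open>q\<close> on the right-hand side. Comparing the
  equations at a largest and at a smallest of these integers determines \<open>t\<close>: all values agree if
  \<open>m < l\<close>, and \<open>t\<close> is \<open>l\<close> times the sum of the two extreme values if \<open>l = m\<close>. Read modulo \<open>q\<close>, this
  makes \<open>t * (B * x - 1)\<close> divisible by the power \<open>q\<close> of \<open>B\<close>, so that \<open>q\<close> divides \<open>t\<close>.\<close>

lemma automaton_equations_unsolvable:
  fixes child :: "nat \<Rightarrow> 's \<Rightarrow> 's"
  assumes fin: "finite A" "A \<noteq> {}" and child: "\<And>s j. s \<in> A \<Longrightarrow> j < m \<Longrightarrow> child j s \<in> A"
    and lm: "1 \<le> m" "m \<le> l" "3 \<le> l + m"
  obtains q :: nat where "0 < q"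
    "\<And>\<gamma> :: 's \<Rightarrow> int. \<exists>s\<in>A. \<not> int q dvd int l * \<gamma> s + (\<Sum>j<m. \<gamma> (child j s)) - 1"
proof -
  define k where "k = l + m"
  define n where "n = card A"
  \<comment> \<open>\<open>K\<close> makes the approximations good enough for the equations to hold without reduction, and \<open>q\<close>
    exceeds twice all possible denominators \<open>t\<close>.\<close>
  define K where "K = 2 * k"
  define B where "B = (if l = m then l else k)"
  define q where "q = B ^ (2 * K ^ n)"
  have B: "2 \<le> B" using lm by (auto simp: B_def k_def)
  have K: "0 < K" using lm by (auto simp: K_def k_def)
  have q: "2 * K ^ n < q"
  proof -
    have "2 * K ^ n < 2 ^ (2 * K ^ n)" by (rule less_exp)
    also have "\<dots> \<le> q" unfolding q_def using B by (rule power_mono) simp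
    finally show ?thesis .
  qed
  have False if sol: "\<forall>s\<in>A. int q dvd int l * \<gamma> s + (\<Sum>j<m. \<gamma> (child j s)) - 1" for \<gamma> :: "'s \<Rightarrow> int"
  proof -
    obtain b where b: "bij_betw b A {0..<n}" using ex_bij_betw_finite_nat[OF fin(1)] unfolding n_def by blast
    define \<theta> where "\<theta> i = real_of_int (\<gamma> (inv_into A b i)) / real q" for i
    obtain t p where t: "0 < t" "t \<le> int (K ^ n)"
      and p: "\<And>i. i < n \<Longrightarrow> \<bar>of_int t * \<theta> i - of_int (p i)\<bar> < 1 / real K"
      using Dirichlet_approx_simult[OF K, of n \<theta>] by blast
    define r where "r s = t * \<gamma> s - int q * p (b s)" for s
    have q0: "0 < real q" using q by simp
    have r: "int K * \<bar>r s\<bar> < int q" if s: "s \<in> A" for s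
    proof -
      have bs: "b s < n" using b s by (auto simp: bij_betw_def)
      have "inv_into A b (b s) = s" using b s by (auto simp: bij_betw_def)
      then have "\<bar>of_int t * (real_of_int (\<gamma> s) / real q) - of_int (p (b s))\<bar> < 1 / real K"
        using p[OF bs] by (simp add: \<theta>_def)
      moreover have "of_int t * (real_of_int (\<gamma> s) / real q) - of_int (p (b s)) = real_of_int (r s) / real q"
        using q0 by (simp add: r_def field_simps)
      ultimately have "real_of_int \<bar>r s\<bar> / real q < 1 / real K" by simp
      then have "real K * real_of_int \<bar>r s\<bar> < real q" using q0 K by (simp add: field_simps)
      then have "real_of_int (int K * \<bar>r s\<bar>) < real_of_int (int q)" by simp
      then show ?thesis by (simp only: of_int_less_iff)
    qed
    have eqn: "int l * r s + (\<Sum>j<m. r (child j s)) = t" if s: "s \<in> A" for s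
    proof -
      define L where "L = int l * r s + (\<Sum>j<m. r (child j s))"
      have "L - t = t * (int l * \<gamma> s + (\<Sum>j<m. \<gamma> (child j s)) - 1)
          - int q * (int l * p (b s) + (\<Sum>j<m. p (b (child j s))))"
        by (simp add: L_def r_def sum_subtractf sum_distrib_left algebra_simps)
      then have dvd: "int q dvd L - t" using sol s by (auto intro: dvd_diff dvd_mult)
      have "int K * \<bar>L\<bar> \<le> int l * (int K * \<bar>r s\<bar>) + (\<Sum>j<m. int K * \<bar>r (child j s)\<bar>)"
      proof -
        have "\<bar>L\<bar> \<le> int l * \<bar>r s\<bar> + (\<Sum>j<m. \<bar>r (child j s)\<bar>)"
          unfolding L_def by (rule order_trans[OF abs_triangle_ineq]) (simp add: abs_mult)
        then have "int K * \<bar>L\<bar> \<le> int K * (int l * \<bar>r s\<bar> + (\<Sum>j<m. \<bar>r (child j s)\<bar>))"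
          by (rule mult_left_mono) simp
        then show ?thesis by (simp add: distrib_left sum_distrib_left mult.left_commute)
      qed
      also have "\<dots> \<le> int l * int q + (\<Sum>j<m. int q)"
        using less_imp_le[OF r] s child by (intro add_mono mult_left_mono sum_mono) auto
      also have "\<dots> = int k * int q" by (simp add: k_def distrib_right)
      finally have "int k * (2 * \<bar>L\<bar>) \<le> int k * int q" by (simp add: K_def mult.assoc mult.left_commute)
      then have "2 * \<bar>L\<bar> \<le> int q" using lm by (simp add: k_def)
      moreover have "2 * t < int q" using t q by linarith
      ultimately have "\<bar>L - t\<bar> < int q" using t by linarith
      then have "L - t = 0" using dvd dvd_imp_le_int[of "L - t" "int q"] by fastforce
      then show ?thesis by (simp add: L_def)
    qed
    have coprime: "coprime (int q) (int B * x - 1)" for x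
    proof -
      have "coprime (int B) (int B * x - 1)"
        by (rule coprimeI) (metis dvd_diff_right_iff dvd_mult2)
      then show ?thesis by (simp add: q_def)
    qed
    have contra: "False" if "int q dvd t * (int B * x - 1)" for x
    proof -
      have "int q dvd t" using that coprime coprime_dvd_mult_left_iff by blast
      then have "int q \<le> t" using t by (intro zdvd_imp_le)
      then show False using t q by linarith
    qed
    obtain s1 where s1: "s1 \<in> A" "\<And>s. s \<in> A \<Longrightarrow> r s \<le> r s1"
    proof -
      have "Max (r ` A) \<in> r ` A" using fin by (intro Max_in) auto
      then obtain s where "s \<in> A" "Max (r ` A) = r s" by auto
      then show thesis using fin by (intro that[of s]) (auto simp flip: \<open>Max (r ` A) = r s\<close>)
    qed
    obtain s2 where s2: "s2 \<in> A" "\<And>s. s \<in> A \<Longrightarrow> r s2 \<le> r s"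
    proof -
      have "Min (r ` A) \<in> r ` A" using fin by (intro Min_in) auto
      then obtain s where "s \<in> A" "Min (r ` A) = r s" by auto
      then show thesis using fin by (intro that[of s]) (auto simp flip: \<open>Min (r ` A) = r s\<close>)
    qed
    have "(\<Sum>j<m. r s2) \<le> (\<Sum>j<m. r (child j s1))" using s1 s2 child by (intro sum_mono) auto
    then have lo: "int l * r s1 + int m * r s2 \<le> t" using eqn[OF s1(1)] by simp
    have "(\<Sum>j<m. r (child j s2)) \<le> (\<Sum>j<m. r s1)" using s1 s2 child by (intro sum_mono) auto
    then have hi: "t \<le> int l * r s2 + int m * r s1" using eqn[OF s2(1)] by simp
    show False
    proof (cases "l = m")
      case True
      then have "t = int l * (r s1 + r s2)" using lo hi by (simp add: distrib_left)
      then have "t * (int B * (\<gamma> s1 + \<gamma> s2) - 1) = int q * (int l * (p (b s1) + p (b s2)))"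
        using True by (simp add: r_def B_def algebra_simps)
      then show False using contra by (metis dvd_triv_left)
    next
      case False
      then have "(int l - int m) * (r s1 - r s2) \<le> 0" using lo hi by (simp add: algebra_simps)
      moreover have "0 < int l - int m" using False lm by simp
      ultimately have "r s1 \<le> r s2" by (simp add: mult_le_0_iff)
      then have const: "r s = r s1" if "s \<in> A" for s using s1(2)[OF that] s2(2)[OF that] by simp
      have "r (child j s1) = r s1" if "j < m" for j by (rule const[OF child[OF s1(1) that]])
      then have "(\<Sum>j<m. r (child j s1)) = (\<Sum>j<m. r s1)" by (intro sum.cong[OF refl]) simp
      then have "t = int k * r s1" using eqn[OF s1(1)] by (simp add: k_def distrib_right)
      then have "t * (int B * \<gamma> s1 - 1) = int q * (int k * p (b s1))"
        using False by (simp add: r_def B_def algebra_simps)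
      then show False using contra by (metis dvd_triv_left)
    qed
  qed
  moreover have "0 < q" using q by simp
  ultimately show thesis using that by blast
qed

text \<open>These hypergraphs have positive density, and a homomorphism into one of them solves a system of
  linear equations modulo \<open>q\<close>.\<close>

definition residue_hypergraph :: "nat \<Rightarrow> nat \<Rightarrow> nat \<Rightarrow> nat hypergraph" where
  "residue_hypergraph k q n = ({..<n}, {e. e \<subseteq> {..<n} \<and> card e = k \<and> \<Sum>e mod q = 1 mod q})"

lemma residue_kgraph: "kgraph k (residue_hypergraph k q n)"
  by (auto simp: residue_hypergraph_def kgraph_def)

lemma card_residue_class:
  assumes "0 < (q::nat)"
  shows "n div q \<le> card {v. v < n \<and> v mod q = r mod q}"
proof -
  have "card {..<n div q} \<le> card {v. v < n \<and> v mod q = r mod q}"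
  proof (rule card_inj_on_le[where f = "\<lambda>i. i * q + r mod q"])
    show "inj_on (\<lambda>i. i * q + r mod q) {..<n div q}" using assms by (auto simp: inj_on_def)
    show "(\<lambda>i. i * q + r mod q) ` {..<n div q} \<subseteq> {v. v < n \<and> v mod q = r mod q}"
    proof clarify
      fix i assume "i < n div q"
      then have "Suc i * q \<le> n div q * q" by (intro mult_le_mono1) auto
      also have "\<dots> \<le> n" by simp
      finally have "i * q + q \<le> n" by simp
      moreover have "r mod q < q" using assms by simp
      ultimately show "i * q + r mod q < n \<and> (i * q + r mod q) mod q = r mod q" by simp
    qed
  qed auto
  then show ?thesis by simp
qed

text \<open>All but one vertex of a completion can be chosen freely, and the last one has to lie in a prescribed
  residue class. Every completion arises in \<open>m\<close> ways.\<close>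

lemma residue_degree:
  assumes q: "0 < q" and m: "0 < m" and S: "S \<subseteq> {..<n}" "card S = l"
  shows "(n div q - (l + m)) * ((n - l) choose (m - 1)) \<le> m * hg_degree (residue_hypergraph (l + m) q n) S"
proof -
  let ?H = "residue_hypergraph (l + m) q n"
  let ?U = "{..<n} - S"
  define C where "C = {M. M \<subseteq> ?U \<and> card M = m \<and> S \<union> M \<in> edges ?H}"
  define P where "P = {M. M \<subseteq> ?U \<and> card M = m - 1}"
  have finS: "finite S" using S finite_subset by blast
  have deg: "hg_degree ?H S = card C"
    using degree_eq_card_completions[OF residue_kgraph, of S "l + m" q n l] S
    by (simp add: C_def) (simp add: residue_hypergraph_def)
  have finC: "finite C" "finite P" by (auto simp: C_def P_def intro: finite_subset[of _ "Pow ?U"])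
  define Z where "Z M = {v. v \<in> ?U - M \<and> insert v M \<in> C}" for M
  have Zcard: "n div q - (l + m) \<le> card (Z M)" if M: "M \<in> P" for M
  proof -
    have finM: "finite M" using M by (auto simp: P_def intro: finite_subset[of _ ?U])
    define s where "s = \<Sum>(S \<union> M)"
    define r where "r = 1 + (q - 1) * s"
    let ?R = "{v. v < n \<and> v mod q = r mod q}"
    have "?R - (S \<union> M) \<subseteq> Z M"
    proof
      fix v assume v: "v \<in> ?R - (S \<union> M)"
      have "\<Sum>(S \<union> insert v M) = v + s" using v finS finM by (simp add: s_def)
      then have "\<Sum>(S \<union> insert v M) mod q = (r + s) mod q" using v by (metis (mono_tags, lifting) DiffD1 mem_Collect_eq mod_add_left_eq)
      also have "r + s = 1 + q * s" using q by (cases q) (auto simp: r_def)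
      also have "(1 + q * s) mod q = 1 mod q" by (rule mod_mult_self2)
      finally have sum1: "\<Sum>(S \<union> insert v M) mod q = 1 mod q" .
      have "card (insert v M) = m" using v finM M m by (auto simp: P_def)
      moreover have "card (S \<union> insert v M) = l + m"
        using S finS finM M v calculation by (subst card_Un_disjoint) (auto simp: P_def)
      ultimately show "v \<in> Z M"
        using sum1 v M S by (auto simp: Z_def C_def P_def residue_hypergraph_def)
    qed
    moreover have "finite (Z M)" by (rule finite_subset[of _ ?U]) (auto simp: Z_def)
    ultimately have "card (?R - (S \<union> M)) \<le> card (Z M)" by (intro card_mono)
    moreover have "card ?R - card (S \<union> M) \<le> card (?R - (S \<union> M))"
      using finS finM by (intro diff_card_le_card_Diff) auto
    moreover have "card (S \<union> M) \<le> l + m"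
      using card_Un_le[of S M] S M by (auto simp: P_def)
    moreover have "n div q \<le> card ?R" by (rule card_residue_class[OF q])
    ultimately show ?thesis by linarith
  qed
  have "(n div q - (l + m)) * card P = (\<Sum>M\<in>P. n div q - (l + m))" by simp
  also have "\<dots> \<le> (\<Sum>M\<in>P. card (Z M))" using Zcard by (rule sum_mono)
  also have "\<dots> = card (Sigma P Z)"
    using finC by (subst card_SigmaI) (auto intro: finite_subset[of _ ?U] simp: Z_def)
  also have "\<dots> \<le> card (Sigma C (\<lambda>M. M))"
  proof (rule card_inj_on_le[where f = "\<lambda>(M, v). (insert v M, v)"])
    show "inj_on (\<lambda>(M, v). (insert v M, v)) (Sigma P Z)"
    proof (rule inj_onI, clarify)
      fix M v M' v' assume "v \<in> Z M" "v \<in> Z M'" "insert v M = insert v M'"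
      then show "M = M' \<and> v = v" using insert_ident[of v M M'] by (simp add: Z_def)
    qed
    show "(\<lambda>(M, v). (insert v M, v)) ` Sigma P Z \<subseteq> Sigma C (\<lambda>M. M)"
      by (auto simp: Z_def)
    show "finite (Sigma C (\<lambda>M. M))"
      using finC by (intro finite_SigmaI) (auto simp: C_def intro: finite_subset[of _ ?U])
  qed
  also have "\<dots> = (\<Sum>M\<in>C. card M)"
    using finC by (intro card_SigmaI) (auto simp: C_def intro: finite_subset[of _ ?U])
  also have "\<dots> = m * card C" by (simp add: C_def)
  finally have "(n div q - (l + m)) * card P \<le> m * card C" .
  moreover have "card P = (n - l) choose (m - 1)"
    unfolding P_def using S finS by (subst n_subsets) (auto simp: card_Diff_subset)
  ultimately show ?thesis by (simp only: deg)
qed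

lemma residue_dense:
  assumes q: "0 < q" and m: "0 < m"
  shows "\<forall>\<^sub>F n in sequentially. ldense (l + m) l (1 / (4 * real q)) (residue_hypergraph (l + m) q n)"
proof -
  have "\<forall>\<^sub>F n in sequentially. 1 / 2 * real n ^ (m - 1) < 1 * (fact (m - 1) * real ((n - l) choose (m - 1)))"
    by (rule eventually_density_slack) simp
  then show ?thesis using eventually_ge_at_top[of "2 * q * (l + m + 1)"]
  proof eventually_elim
    case (elim n)
    show ?case unfolding ldense_def
    proof (intro allI impI)
      let ?H = "residue_hypergraph (l + m) q n"
      fix S assume "S \<subseteq> verts ?H \<and> card S = l"
      then have S: "S \<subseteq> {..<n}" "card S = l" by (auto simp: residue_hypergraph_def)
      define D where "D = hg_degree ?H S"
      have nq: "real n / (2 * real q) \<le> real (n div q - (l + m))"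
      proof -
        have "n < (n div q + 1) * q" using q by (metis add.commute dividend_less_div_times mult_Suc plus_1_eq_Suc)
        then have "real n < real ((n div q + 1) * q)" by (simp only: of_nat_less_iff)
        then have "real n / real q < real (n div q) + 1" using q by (simp add: field_simps)
        moreover have "real (2 * q * (l + m + 1)) \<le> real n" using elim(2) by (simp only: of_nat_le_iff)
        then have "real (l + m) + 1 \<le> real n / (2 * real q)" using q by (simp add: field_simps)
        moreover have "real n / real q = 2 * (real n / (2 * real q))" by simp
        ultimately have "real n / (2 * real q) \<le> real (n div q) - real (l + m)" by linarith
        then show ?thesis by linarith
      qed
      have "real ((n div q - (l + m)) * ((n - l) choose (m - 1))) \<le> real (m * D)"
        unfolding D_def using residue_degree[OF q m S] by (simp only: of_nat_le_iff)
      then have "real n / (2 * real q) * real ((n - l) choose (m - 1)) \<le> real m * real D"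
        using mult_right_mono[OF nq, of "real ((n - l) choose (m - 1))"] by simp
      then have "fact (m - 1) * (real n / (2 * real q) * real ((n - l) choose (m - 1))) \<le> fact (m - 1) * (real m * real D)"
        by (rule mult_left_mono) simp
      moreover have "fact (m - 1) * (real m * real D) = fact m * real D"
        using m by (simp add: fact_reduce)
      moreover have "1 / (4 * real q) * real n ^ m \<le> fact (m - 1) * (real n / (2 * real q) * real ((n - l) choose (m - 1)))"
      proof -
        have "1 / (4 * real q) * real n ^ m = real n / (2 * real q) * (1 / 2 * real n ^ (m - 1))"
          using m by (simp add: power_eq_if)
        also have "\<dots> \<le> real n / (2 * real q) * (fact (m - 1) * real ((n - l) choose (m - 1)))"
          using elim(1) by (intro mult_left_mono) auto
        finally show ?thesis by (simp add: mult.left_commute)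
      qed
      ultimately have "1 / (4 * real q) * real n ^ m \<le> fact m * real D" by linarith
      moreover have "card (verts ?H) = n" by (simp add: residue_hypergraph_def)
      ultimately show "1 / (4 * real q) * real (card (verts ?H)) ^ (l + m - l) \<le> fact (l + m - l) * real (hg_degree ?H S)"
        by (simp only: D_def add_diff_cancel_left')
    qed
  qed
qed

text \<open>The link of an \<open>l\<close>-set has positive density, so it contains boxes. Their sides are given the length
  \<open>l\<close> in order to serve as \<open>l\<close>-sets themselves.\<close>

lemma complete_partite_in_link:
  assumes H: "kgraph (l + m) (H :: nat hypergraph)" "verts H = {..<N}" and dense: "ldense (l + m) l c H" and c: "0 < c"
    and N: "l \<le> N" "0 < N" "1 - c ^ (l ^ m) < (1 - real l / real N) ^ (l * m)"
    and S: "S \<subseteq> {..<N}" "card S = l"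
  obtains ws where "length ws = m" "\<And>w. w \<in> set ws \<Longrightarrow> length w = l \<and> distinct w \<and> set w \<subseteq> {..<N}"
    "\<And>xs. list_all2 (\<lambda>x w. x \<in> set w) xs ws \<Longrightarrow> S \<union> set xs \<in> edges H"
proof -
  let ?V = "{..<N}"
  define \<E> where "\<E> = {M. M \<subseteq> ?V - S \<and> card M = m \<and> S \<union> M \<in> edges H}"
  have deg: "hg_degree H S = card \<E>"
    using degree_eq_card_completions[OF H(1), of S l] S H(2) by (simp add: \<E>_def)
  have "c * real N ^ m \<le> fact m * real (card \<E>)"
    unfolding deg[symmetric] using dense S H(2) by (simp add: ldense_def)
  also have "fact m * real (card \<E>) = real (card {z \<in> {..<m} \<rightarrow>\<^sub>E ?V. z ` {..<m} \<in> \<E>})"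
  proof -
    have "card {z \<in> {..<m} \<rightarrow>\<^sub>E ?V. z ` {..<m} \<in> \<E>} = fact (card {..<m}) * card \<E>"
      by (rule card_funcs_onto_edges) (auto simp: \<E>_def)
    from arg_cong[OF this, of real] show ?thesis by (simp only: card_lessThan of_nat_mult of_nat_fact)
  qed
  also have "\<dots> \<le> real (card {xs \<in> lists_over ?V m. S \<union> set xs \<in> edges H})"
  proof -
    have "card {z \<in> {..<m} \<rightarrow>\<^sub>E ?V. z ` {..<m} \<in> \<E>} \<le> card {xs \<in> lists_over ?V m. S \<union> set xs \<in> edges H}"
    proof (rule card_inj_on_le[where f = "\<lambda>z. map z [0..<m]"])
      show "inj_on (\<lambda>z. map z [0..<m]) {z \<in> {..<m} \<rightarrow>\<^sub>E ?V. z ` {..<m} \<in> \<E>}"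
      proof (rule inj_onI)
        fix z z' assume a: "z \<in> {z \<in> {..<m} \<rightarrow>\<^sub>E ?V. z ` {..<m} \<in> \<E>}" "z' \<in> {z \<in> {..<m} \<rightarrow>\<^sub>E ?V. z ` {..<m} \<in> \<E>}"
          "map z [0..<m] = map z' [0..<m]"
        then have "z i = z' i" if "i \<in> {..<m}" for i using that by simp
        then show "z = z'" using a by (intro PiE_ext[of _ "{..<m}" "\<lambda>_. ?V"]) auto
      qed
      show "(\<lambda>z. map z [0..<m]) ` {z \<in> {..<m} \<rightarrow>\<^sub>E ?V. z ` {..<m} \<in> \<E>} \<subseteq> {xs \<in> lists_over ?V m. S \<union> set xs \<in> edges H}"
        by (auto simp: lists_over_def \<E>_def atLeast0LessThan)
      show "finite {xs \<in> lists_over ?V m. S \<union> set xs \<in> edges H}" using finite_lists_over[of ?V m] by auto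
    qed
    then show ?thesis by (simp only: of_nat_le_iff)
  qed
  finally have "c * real (card ?V) ^ m \<le> real (card {xs \<in> lists_over ?V m. S \<union> set xs \<in> edges H})" by simp
  then obtain ws where ws: "ws \<in> lists_over (lists_over ?V l) m" "\<And>w. w \<in> set ws \<Longrightarrow> distinct w"
    "\<And>xs. list_all2 (\<lambda>x w. x \<in> set w) xs ws \<Longrightarrow> S \<union> set xs \<in> edges H"
    using distinct_box_exists[of ?V l c m "\<lambda>xs. S \<union> set xs \<in> edges H"] N c by (auto simp: mult.commute)
  show thesis by (rule that[of ws]) (use ws in \<open>auto simp: lists_over_def\<close>)
qed

definition automaton_edge :: "(nat \<Rightarrow> 's \<Rightarrow> 's) \<Rightarrow> nat \<Rightarrow> nat \<Rightarrow> 's \<Rightarrow> (nat \<Rightarrow> nat) \<Rightarrow> ('s \<times> nat) set" where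
  "automaton_edge child l m s y = (\<lambda>x. (s, x)) ` {..<l} \<union> (\<lambda>j. (child j s, y j)) ` {..<m}"

text \<open>Every state \<open>s\<close> owns \<open>l\<close> vertices, which form edges with all choices of one vertex from each
  of its \<open>m\<close> children.\<close>

definition automaton_hypergraph :: "'s set \<Rightarrow> (nat \<Rightarrow> 's \<Rightarrow> 's) \<Rightarrow> nat \<Rightarrow> nat \<Rightarrow> ('s \<times> nat) hypergraph" where
  "automaton_hypergraph A child l m = (A \<times> {..<l},
     {automaton_edge child l m s y |s y. s \<in> A \<and> y \<in> {..<m} \<rightarrow>\<^sub>E {..<l}})"

lemma sum_automaton_edge:
  fixes C :: "'s \<times> nat \<Rightarrow> int"
  assumes "card (automaton_edge child l m s y) = l + m"
  shows "(\<Sum>v\<in>automaton_edge child l m s y. C v) = (\<Sum>x<l. C (s, x)) + (\<Sum>j<m. C (child j s, y j))"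
proof -
  let ?A = "(\<lambda>x. (s, x)) ` {..<l}" and ?B = "(\<lambda>j. (child j s, y j)) ` {..<m}"
  have cA: "card ?A \<le> l" and cB: "card ?B \<le> m"
    using card_image_le[of "{..<l}" "\<lambda>x. (s, x)"] card_image_le[of "{..<m}" "\<lambda>j. (child j s, y j)"] by simp_all
  have "card (?A \<union> ?B) + card (?A \<inter> ?B) = card ?A + card ?B"
    by (rule card_Un_Int[symmetric]) auto
  then have "card ?B = m" "card (?A \<inter> ?B) = 0"
    using assms cA cB unfolding automaton_edge_def by linarith+
  then have disj: "?A \<inter> ?B = {}" and injB: "inj_on (\<lambda>j. (child j s, y j)) {..<m}"
    by (auto intro!: eq_card_imp_inj_on)
  have injA: "inj_on (\<lambda>x. (s, x)) {..<l}" by (auto simp: inj_on_def)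
  have "(\<Sum>v\<in>automaton_edge child l m s y. C v) = (\<Sum>v\<in>?A. C v) + (\<Sum>v\<in>?B. C v)"
    unfolding automaton_edge_def using disj by (intro sum.union_disjoint) auto
  then show ?thesis using injA injB by (simp add: sum.reindex)
qed

text \<open>The labels modulo \<open>q\<close> of the vertices would solve the equations of the automaton. The \<open>l\<close> vertices of
  a state that is a child of some state have the same label, because an edge around the parent may
  use any one of them.\<close>

lemma automaton_not_hom_residue:
  fixes A :: "'s set"
  assumes fin: "finite A" "A \<noteq> {}" and child: "\<And>s j. s \<in> A \<Longrightarrow> j < m \<Longrightarrow> child j s \<in> A"
    and lm: "1 \<le> m" "m \<le> l" "3 \<le> l + m"
    and card: "\<And>s y. s \<in> A \<Longrightarrow> y \<in> {..<m} \<rightarrow>\<^sub>E {..<l} \<Longrightarrow> card (automaton_edge child l m s y) = l + m"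
  obtains q where "0 < q" "\<And>n. \<not> hg_hom (automaton_hypergraph A child l m) (residue_hypergraph (l + m) q n)"
proof -
  define A1 where "A1 = (\<lambda>(j, s). child j s) ` ({..<m} \<times> A)"
  obtain s0 where "s0 \<in> A" using fin(2) by blast
  then have "child 0 s0 \<in> A1" using lm(1) by (auto simp: A1_def intro!: image_eqI[of _ _ "(0, s0)"])
  then have A1: "finite A1" "A1 \<noteq> {}" "A1 \<subseteq> A" "\<And>s j. s \<in> A1 \<Longrightarrow> j < m \<Longrightarrow> child j s \<in> A1"
    using fin child by (auto simp: A1_def)
  obtain q :: nat where q: "0 < q"
    "\<And>\<gamma> :: 's \<Rightarrow> int. \<exists>s\<in>A1. \<not> int q dvd int l * \<gamma> s + (\<Sum>j<m. \<gamma> (child j s)) - 1"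
  proof (rule automaton_equations_unsolvable[OF A1(1,2,4) lm])
    fix q :: nat assume "0 < q" "\<And>\<gamma> :: 's \<Rightarrow> int. \<exists>s\<in>A1. \<not> int q dvd int l * \<gamma> s + (\<Sum>j<m. \<gamma> (child j s)) - 1"
    then show thesis by (rule that)
  qed
  have "\<not> hg_hom (automaton_hypergraph A child l m) (residue_hypergraph (l + m) q n)" for n
  proof
    assume "hg_hom (automaton_hypergraph A child l m) (residue_hypergraph (l + m) q n)"
    then obtain \<phi> where \<phi>: "\<And>e. e \<in> edges (automaton_hypergraph A child l m) \<Longrightarrow> \<phi> ` e \<in> edges (residue_hypergraph (l + m) q n)"
      by (auto simp: hg_hom_def)
    define C where "C v = int (\<phi> v)" for v
    have eqn: "int q dvd (\<Sum>x<l. C (s, x)) + (\<Sum>j<m. C (child j s, y j)) - 1"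
      if s: "s \<in> A" and y: "y \<in> {..<m} \<rightarrow>\<^sub>E {..<l}" for s y
    proof -
      let ?e = "automaton_edge child l m s y"
      have "?e \<in> edges (automaton_hypergraph A child l m)" using s y by (auto simp: automaton_hypergraph_def)
      then have e: "card (\<phi> ` ?e) = l + m" "\<Sum>(\<phi> ` ?e) mod q = 1 mod q"
        using \<phi> by (auto simp: residue_hypergraph_def)
      have "finite ?e" by (simp add: automaton_edge_def)
      then have "inj_on \<phi> ?e" using e(1) card[OF s y] by (intro eq_card_imp_inj_on) auto
      then have "\<Sum>(\<phi> ` ?e) = (\<Sum>v\<in>?e. \<phi> v)" by (simp add: sum.reindex)
      then have "int (\<Sum>(\<phi> ` ?e)) = (\<Sum>x<l. C (s, x)) + (\<Sum>j<m. C (child j s, y j))"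
        using sum_automaton_edge[OF card[OF s y], of C] by (simp add: C_def)
      moreover have "int (\<Sum>(\<phi> ` ?e)) mod int q = 1 mod int q"
        using arg_cong[OF e(2), of int] by (simp only: zmod_int of_nat_1)
      ultimately show ?thesis by (metis mod_eq_dvd_iff)
    qed
    have const: "int q dvd C (t, x) - C (t, 0)" if t: "t \<in> A1" and x: "x < l" for t x
    proof -
      obtain j0 s where js: "j0 < m" "s \<in> A" "t = child j0 s" using t by (auto simp: A1_def)
      define y where "y z = (\<lambda>j\<in>{..<m}. if j = j0 then z else 0 :: nat)" for z
      have y: "y z \<in> {..<m} \<rightarrow>\<^sub>E {..<l}" if "z < l" for z using that lm by (auto simp: y_def)
      have sumy: "(\<Sum>j<m. C (child j s, y z j)) = C (t, z) + (\<Sum>j\<in>{..<m} - {j0}. C (child j s, 0))" for z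
      proof -
        have "(\<Sum>j<m. C (child j s, y z j)) = C (child j0 s, y z j0) + (\<Sum>j\<in>{..<m} - {j0}. C (child j s, y z j))"
          using js(1) by (intro sum.remove) auto
        also have "(\<Sum>j\<in>{..<m} - {j0}. C (child j s, y z j)) = (\<Sum>j\<in>{..<m} - {j0}. C (child j s, 0))"
          by (rule sum.cong) (auto simp: y_def)
        finally show ?thesis using js by (simp add: y_def)
      qed
      have "0 < l" using x by simp
      from dvd_diff[OF eqn[OF js(2) y[OF x]] eqn[OF js(2) y[OF this]]]
      show ?thesis unfolding sumy by (simp add: algebra_simps)
    qed
    obtain s where s: "s \<in> A1" "\<not> int q dvd int l * C (s, 0) + (\<Sum>j<m. C (child j s, 0)) - 1"
      using q(2)[of "\<lambda>s. C (s, 0)"] by auto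
    define y where "y = (\<lambda>j\<in>{..<m}. 0 :: nat)"
    have "y \<in> {..<m} \<rightarrow>\<^sub>E {..<l}" using lm by (auto simp: y_def)
    then have "int q dvd (\<Sum>x<l. C (s, x)) + (\<Sum>j<m. C (child j s, y j)) - 1" using s A1(3) by (intro eqn) auto
    moreover have "(\<Sum>j<m. C (child j s, y j)) = (\<Sum>j<m. C (child j s, 0))" by (rule sum.cong) (auto simp: y_def)
    ultimately have 1: "int q dvd (\<Sum>x<l. C (s, x)) + (\<Sum>j<m. C (child j s, 0)) - 1" by simp
    have "int q dvd (\<Sum>x<l. C (s, x) - C (s, 0))" by (rule dvd_sum) (use const s in auto)
    then have 2: "int q dvd (\<Sum>x<l. C (s, x)) - int l * C (s, 0)" by (simp add: sum_subtractf)
    have "(\<Sum>x<l. C (s, x)) + (\<Sum>j<m. C (child j s, 0)) - 1 - ((\<Sum>x<l. C (s, x)) - int l * C (s, 0))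
        = int l * C (s, 0) + (\<Sum>j<m. C (child j s, 0)) - 1" by simp
    with dvd_diff[OF 1 2] show False using s(2) by simp
  qed
  then show thesis using q(1) that by blast
qed

text \<open>One automaton serves all dense hypergraphs on \<open>N\<close> vertices: a state of the product assigns to
  each of them an \<open>l\<close>-tuple of its vertices, and the children of a tuple span a complete
  \<open>m\<close>-partite hypergraph in its link. Projecting to one factor is a homomorphism.\<close>

lemma universal_automaton:
  assumes lm: "1 \<le> m" "m \<le> l" and c: "0 < c"
    and N: "l \<le> N" "1 - c ^ (l ^ m) < (1 - real l / real N) ^ (l * m)" "c * real N ^ m < fact m * real ((N - l) choose m)"
  obtains A :: "(nat hypergraph \<Rightarrow> nat list) set" and child where
    "finite A" "A \<noteq> {}" "\<And>s j. s \<in> A \<Longrightarrow> j < m \<Longrightarrow> child j s \<in> A"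
    "\<And>s y. s \<in> A \<Longrightarrow> y \<in> {..<m} \<rightarrow>\<^sub>E {..<l} \<Longrightarrow> card (automaton_edge child l m s y) = l + m"
    "\<And>H :: nat hypergraph. kgraph (l + m) H \<Longrightarrow> verts H = {..<N} \<Longrightarrow> ldense (l + m) l c H \<Longrightarrow>
      hg_hom (automaton_hypergraph A child l m) H"
proof -
  define \<H> where "\<H> = {H :: nat hypergraph. kgraph (l + m) H \<and> verts H = {..<N} \<and> ldense (l + m) l c H}"
  define St where "St = {s :: nat list. length s = l \<and> distinct s \<and> set s \<subseteq> {..<N}}"
  have fin\<H>: "finite \<H>"
    by (rule finite_subset[of _ "{{..<N}} \<times> Pow (Pow {..<N})"]) (auto simp: \<H>_def kgraph_def subset_iff)
  have "St \<subseteq> {s. set s \<subseteq> {..<N} \<and> length s \<le> l}" by (auto simp: St_def)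
  then have finSt: "finite St" by (rule finite_subset) (auto intro: finite_lists_length_le)
  have "[0..<l] \<in> St" using N by (auto simp: St_def)
  then have neSt: "St \<noteq> {}" by blast
  obtain H0 where H0: "H0 \<in> \<H>"
  proof -
    define K :: "nat hypergraph" where "K = ({..<N}, {e. e \<subseteq> {..<N} \<and> card e = l + m})"
    have K: "kgraph (l + m) K" by (auto simp: K_def kgraph_def)
    have "ldense (l + m) l c K" unfolding ldense_def
    proof (intro allI impI)
      fix S assume "S \<subseteq> verts K \<and> card S = l"
      then have S: "S \<subseteq> {..<N}" "card S = l" by (auto simp: K_def)
      have finS: "finite S" using S finite_subset by blast
      have "hg_degree K S = card {M. M \<subseteq> {..<N} - S \<and> card M = m \<and> S \<union> M \<in> edges K}"
        using degree_eq_card_completions[OF K, of S l] S by (simp add: K_def)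
      also have "{M. M \<subseteq> {..<N} - S \<and> card M = m \<and> S \<union> M \<in> edges K} = {M. M \<subseteq> {..<N} - S \<and> card M = m}"
      proof -
        have "S \<union> M \<in> edges K" if "M \<subseteq> {..<N} - S" "card M = m" for M
        proof -
          have "S \<inter> M = {}" "finite M" using that(1) finite_subset[OF that(1)] by auto
          then have "card (S \<union> M) = l + m" using finS S(2) that(2) by (simp add: card_Un_disjoint)
          then show ?thesis using that(1) S(1) by (auto simp: K_def)
        qed
        then show ?thesis by auto
      qed
      also have "card \<dots> = (N - l) choose m" using S finS by (subst n_subsets) (auto simp: card_Diff_subset)
      finally show "c * real (card (verts K)) ^ (l + m - l) \<le> fact (l + m - l) * real (hg_degree K S)"
        using N(3) by (simp add: K_def)
    qed
    then show thesis using K by (intro that[of K]) (auto simp: \<H>_def K_def)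
  qed
  define good where "good H s ws \<longleftrightarrow> length ws = m \<and> (\<forall>w\<in>set ws. w \<in> St) \<and>
     (\<forall>xs. list_all2 (\<lambda>x w. x \<in> set w) xs ws \<longrightarrow> set s \<union> set xs \<in> edges H)" for H s ws
  have "\<exists>ws. good H s ws" if "H \<in> \<H>" "s \<in> St" for H s
  proof -
    have H: "kgraph (l + m) H" "verts H = {..<N}" "ldense (l + m) l c H" using that(1) by (auto simp: \<H>_def)
    have s: "set s \<subseteq> {..<N}" "card (set s) = l" using that(2) by (auto simp: St_def distinct_card)
    have "0 < N" using lm N(1) by linarith
    obtain ws where ws: "length ws = m" "\<And>w. w \<in> set ws \<Longrightarrow> length w = l \<and> distinct w \<and> set w \<subseteq> {..<N}"
      "\<And>xs. list_all2 (\<lambda>x w. x \<in> set w) xs ws \<Longrightarrow> set s \<union> set xs \<in> edges H"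
    proof (rule complete_partite_in_link[OF H c N(1) \<open>0 < N\<close> N(2) s])
      fix ws assume "length ws = m" "\<And>w. w \<in> set ws \<Longrightarrow> length w = l \<and> distinct w \<and> set w \<subseteq> {..<N}"
        "\<And>xs. list_all2 (\<lambda>x w. x \<in> set w) xs ws \<Longrightarrow> set s \<union> set xs \<in> edges H"
      then show thesis by (rule that)
    qed
    have "\<forall>w\<in>set ws. w \<in> St" using ws(2) unfolding St_def by blast
    moreover have "\<forall>xs. list_all2 (\<lambda>x w. x \<in> set w) xs ws \<longrightarrow> set s \<union> set xs \<in> edges H" using ws(3) by blast
    ultimately have "good H s ws" using ws(1) unfolding good_def by blast
    then show ?thesis by blast
  qed
  then have ex: "good H s (SOME ws. good H s ws)" if "H \<in> \<H>" "s \<in> St" for H s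
    using someI_ex that by metis
  define ws where "ws H s = (SOME ws. good H s ws)" for H s
  note ex = ex[folded ws_def, unfolded good_def]
  have ws: "\<And>H s. H \<in> \<H> \<Longrightarrow> s \<in> St \<Longrightarrow> length (ws H s) = m"
    "\<And>H s w. H \<in> \<H> \<Longrightarrow> s \<in> St \<Longrightarrow> w \<in> set (ws H s) \<Longrightarrow> w \<in> St"
    "\<And>H s xs. H \<in> \<H> \<Longrightarrow> s \<in> St \<Longrightarrow> list_all2 (\<lambda>x w. x \<in> set w) xs (ws H s) \<Longrightarrow> set s \<union> set xs \<in> edges H"
    using ex by simp_all
  define A where "A = (\<Pi>\<^sub>E H\<in>\<H>. St)"
  define child where "child j \<sigma> = (\<lambda>H\<in>\<H>. ws H (\<sigma> H) ! j)" for j and \<sigma> :: "nat hypergraph \<Rightarrow> nat list"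
  have finA: "finite A" using fin\<H> finSt by (auto simp: A_def intro: finite_PiE)
  have neA: "A \<noteq> {}" using neSt by (simp add: A_def PiE_eq_empty_iff)
  have childA: "child j \<sigma> \<in> A" if "\<sigma> \<in> A" "j < m" for j \<sigma>
  proof -
    have "ws H (\<sigma> H) ! j \<in> St" if "H \<in> \<H>" for H
    proof -
      have s: "\<sigma> H \<in> St" using \<open>\<sigma> \<in> A\<close> that unfolding A_def by (rule PiE_mem)
      have "ws H (\<sigma> H) ! j \<in> set (ws H (\<sigma> H))" using ws(1)[OF that s] \<open>j < m\<close> by simp
      then show ?thesis by (rule ws(2)[OF that s])
    qed
    then show ?thesis unfolding A_def child_def by (rule restrict_PiE_iff[THEN iffD2, OF ballI])
  qed
  have image: "(\<lambda>(\<sigma>, x). \<sigma> H ! x) ` automaton_edge child l m \<sigma> y \<in> edges H"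
    if H: "H \<in> \<H>" and \<sigma>: "\<sigma> \<in> A" and y: "y \<in> {..<m} \<rightarrow>\<^sub>E {..<l}" for H \<sigma> y
  proof -
    have s: "\<sigma> H \<in> St" using \<sigma> H unfolding A_def by (rule PiE_mem)
    define xs where "xs = map (\<lambda>j. ws H (\<sigma> H) ! j ! y j) [0..<m]"
    have "list_all2 (\<lambda>x w. x \<in> set w) xs (ws H (\<sigma> H))"
    proof (rule list_all2_all_nthI)
      show "length xs = length (ws H (\<sigma> H))" using ws(1)[OF H s] by (simp add: xs_def)
      fix j assume "j < length xs"
      then have j: "j < m" by (simp add: xs_def)
      then have "ws H (\<sigma> H) ! j \<in> set (ws H (\<sigma> H))" using ws(1)[OF H s] by simp
      then have "ws H (\<sigma> H) ! j \<in> St" by (rule ws(2)[OF H s])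
      then have "length (ws H (\<sigma> H) ! j) = l" by (simp add: St_def)
      moreover have "y j < l" using y j by auto
      ultimately show "xs ! j \<in> set (ws H (\<sigma> H) ! j)" using j by (simp add: xs_def)
    qed
    then have "set (\<sigma> H) \<union> set xs \<in> edges H" by (rule ws(3)[OF H s])
    moreover have "(\<lambda>(\<sigma>, x). \<sigma> H ! x) ` automaton_edge child l m \<sigma> y = set (\<sigma> H) \<union> set xs"
    proof -
      have "(\<lambda>(\<sigma>, x). \<sigma> H ! x) ` (\<lambda>x. (\<sigma>, x)) ` {..<l} = set (\<sigma> H)"
        using s by (auto simp: image_image St_def set_conv_nth)
      moreover have "(\<lambda>(\<sigma>, x). \<sigma> H ! x) ` (\<lambda>j. (child j \<sigma>, y j)) ` {..<m} = set xs"
        using H by (auto simp: image_image xs_def child_def)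
      ultimately show ?thesis unfolding automaton_edge_def by (simp only: image_Un)
    qed
    ultimately show ?thesis by simp
  qed
  have card: "card (automaton_edge child l m \<sigma> y) = l + m" if \<sigma>: "\<sigma> \<in> A" and y: "y \<in> {..<m} \<rightarrow>\<^sub>E {..<l}" for \<sigma> y
  proof (rule antisym)
    have "card (automaton_edge child l m \<sigma> y) \<le> card ((\<lambda>x. (\<sigma>, x)) ` {..<l}) + card ((\<lambda>j. (child j \<sigma>, y j)) ` {..<m})"
      unfolding automaton_edge_def by (rule card_Un_le)
    also have "\<dots> \<le> l + m"
      using card_image_le[of "{..<l}" "\<lambda>x. (\<sigma>, x)"] card_image_le[of "{..<m}" "\<lambda>j. (child j \<sigma>, y j)"]
      by (intro add_mono) simp_all
    finally show "card (automaton_edge child l m \<sigma> y) \<le> l + m" .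
    have fin: "finite (automaton_edge child l m \<sigma> y)" by (simp add: automaton_edge_def)
    have "kgraph (l + m) H0" using H0 by (simp add: \<H>_def)
    then have "l + m = card ((\<lambda>(\<sigma>, x). \<sigma> H0 ! x) ` automaton_edge child l m \<sigma> y)"
      using kgraph_edge image[OF H0 \<sigma> y] by metis
    also have "\<dots> \<le> card (automaton_edge child l m \<sigma> y)" by (rule card_image_le[OF fin])
    finally show "l + m \<le> card (automaton_edge child l m \<sigma> y)" .
  qed
  have hom: "hg_hom (automaton_hypergraph A child l m) H" if "H \<in> \<H>" for H
    unfolding hg_hom_def
  proof (intro exI[of _ "\<lambda>(\<sigma>, x). \<sigma> H ! x"] conjI ballI)
    have "\<sigma> H ! x < N" if "\<sigma> \<in> A" "x < l" for \<sigma> x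
    proof -
      have "\<sigma> H \<in> St" using that(1) \<open>H \<in> \<H>\<close> unfolding A_def by (rule PiE_mem)
      then have "\<sigma> H ! x \<in> set (\<sigma> H)" "set (\<sigma> H) \<subseteq> {..<N}" using that(2) by (auto simp: St_def)
      then show ?thesis by auto
    qed
    then show "(\<lambda>(\<sigma>, x). \<sigma> H ! x) ` verts (automaton_hypergraph A child l m) \<subseteq> verts H"
      using that by (auto simp: automaton_hypergraph_def \<H>_def)
    fix e assume "e \<in> edges (automaton_hypergraph A child l m)"
    then show "(\<lambda>(\<sigma>, x). \<sigma> H ! x) ` e \<in> edges H"
      using image[OF that] by (auto simp: automaton_hypergraph_def)
  qed
  show thesis
  proof (rule that[OF finA neA childA card])
    fix H :: "nat hypergraph" assume "kgraph (l + m) H" "verts H = {..<N}" "ldense (l + m) l c H"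
    then have "H \<in> \<H>" unfolding \<H>_def by blast
    then show "hg_hom (automaton_hypergraph A child l m) H" by (rule hom)
  qed
qed

text \<open>The universal automaton has small density because all dense hypergraphs contain it, and positive
  density because the residue hypergraphs avoid it.\<close>

theorem zero_accumulates:
  assumes lm: "1 \<le> m" "m \<le> l" "3 \<le> l + m"
  shows "0 \<in> Acc (turan_spectrum (l + m) l)"
  unfolding Acc_iff
proof (intro allI impI)
  fix e :: real assume e: "0 < e"
  define d where "d = min (e / 2) (1 / 2)"
  define c where "c = d / 2"
  have cd: "0 < c" "c < d" "d \<le> 1" "c < 1" "d < e" using e by (auto simp: c_def d_def)
  have l: "l < l + m" using lm by simp
  have m: "l + m - l = m" by simp
  define forcing where "forcing N \<longleftrightarrow> (\<forall>F :: ((nat hypergraph \<Rightarrow> nat list) \<times> nat) hypergraph. kgraph (l + m) F \<and>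
    (\<forall>H :: nat hypergraph. kgraph (l + m) H \<and> verts H = {..<N} \<and> ldense (l + m) l c H \<longrightarrow> hg_hom F H) \<longrightarrow>
    (\<forall>\<^sub>F n in sequentially. \<not> adm (l + m) l n d F))" for N
  have "\<forall>\<^sub>F N in sequentially. c * real N ^ m < 1 * (fact m * real ((N - l) choose m))"
    by (rule eventually_density_slack[OF cd(4)])
  with density_le_if_hom_forced[OF l cd(2,3), where ?'b = "(nat hypergraph \<Rightarrow> nat list) \<times> nat"]
    eventually_boxes[OF cd(1), of "l ^ m" l "l * m"] eventually_ge_at_top[of l]
  have "\<forall>\<^sub>F N in sequentially. forcing N \<and> 1 - c ^ (l ^ m) < (1 - real l / real N) ^ (l * m) \<and> l \<le> N \<and>
      c * real N ^ m < fact m * real ((N - l) choose m)"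
    by eventually_elim (simp add: forcing_def)
  from eventually_happens'[OF sequentially_bot this]
  obtain N where N: "forcing N" "l \<le> N" "1 - c ^ (l ^ m) < (1 - real l / real N) ^ (l * m)"
    "c * real N ^ m < fact m * real ((N - l) choose m)" by (elim exE conjE)
  obtain A :: "(nat hypergraph \<Rightarrow> nat list) set" and child where A:
    "finite A" "A \<noteq> {}" "\<And>s j. s \<in> A \<Longrightarrow> j < m \<Longrightarrow> child j s \<in> A"
    "\<And>s y. s \<in> A \<Longrightarrow> y \<in> {..<m} \<rightarrow>\<^sub>E {..<l} \<Longrightarrow> card (automaton_edge child l m s y) = l + m"
    and hom: "\<And>H :: nat hypergraph. kgraph (l + m) H \<Longrightarrow> verts H = {..<N} \<Longrightarrow> ldense (l + m) l c H \<Longrightarrow>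
      hg_hom (automaton_hypergraph A child l m) H"
  proof (rule universal_automaton[OF lm(1,2) cd(1) N(2-4)])
    fix A :: "(nat hypergraph \<Rightarrow> nat list) set" and child
    assume "finite A" "A \<noteq> {}" "\<And>s j. s \<in> A \<Longrightarrow> j < m \<Longrightarrow> child j s \<in> A"
      "\<And>s y. s \<in> A \<Longrightarrow> y \<in> {..<m} \<rightarrow>\<^sub>E {..<l} \<Longrightarrow> card (automaton_edge child l m s y) = l + m"
      "\<And>H :: nat hypergraph. kgraph (l + m) H \<Longrightarrow> verts H = {..<N} \<Longrightarrow> ldense (l + m) l c H \<Longrightarrow>
        hg_hom (automaton_hypergraph A child l m) H"
    then show thesis by (rule that)
  qed
  let ?F = "automaton_hypergraph A child l m"
  have kg: "kgraph (l + m) ?F"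
    unfolding kgraph_def
  proof (intro conjI ballI)
    show "finite (verts ?F)" using A(1) by (simp add: automaton_hypergraph_def)
    fix e assume "e \<in> edges ?F"
    then obtain s y where sy: "s \<in> A" "y \<in> {..<m} \<rightarrow>\<^sub>E {..<l}" "e = automaton_edge child l m s y"
      by (auto simp: automaton_hypergraph_def)
    show "card e = l + m" using sy A(4) by simp
    show "e \<subseteq> verts ?F" using sy A(3) by (auto simp: automaton_hypergraph_def automaton_edge_def)
  qed
  have ne: "edges ?F \<noteq> {}"
  proof -
    obtain s where s: "s \<in> A" using A(2) by blast
    define y where "y = (\<lambda>j\<in>{..<m}. 0 :: nat)"
    have "y \<in> {..<m} \<rightarrow>\<^sub>E {..<l}" using lm by (auto simp: y_def)
    with s have "automaton_edge child l m s y \<in> edges ?F"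
      unfolding automaton_hypergraph_def snd_conv by blast
    then show ?thesis by blast
  qed
  have "\<forall>\<^sub>F n in sequentially. \<not> adm (l + m) l n d ?F"
    using N(1) kg hom unfolding forcing_def by blast
  then have upper: "turan_density (l + m) l ?F \<le> d"
    by (intro density_le_if_eventually_not_adm[OF kg ne l] eventually_frequently) auto
  obtain q where q: "0 < q" "\<And>n. \<not> hg_hom ?F (residue_hypergraph (l + m) q n)"
  proof (rule automaton_not_hom_residue[OF A(1-3) lm A(4)])
    fix q assume "0 < q" "\<And>n. \<not> hg_hom ?F (residue_hypergraph (l + m) q n)"
    then show thesis by (rule that)
  qed
  have "0 < m" using lm by simp
  from residue_dense[OF q(1) this, of l]
  have "\<forall>\<^sub>F n in sequentially. adm (l + m) l n (1 / (4 * real q)) ?F"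
  proof eventually_elim
    case (elim n)
    have "\<not> hg_emb ?F (residue_hypergraph (l + m) q n)" using q(2) emb_imp_hom by blast
    moreover have "card (verts (residue_hypergraph (l + m) q n)) = n" by (simp add: residue_hypergraph_def)
    ultimately show ?case using elim residue_kgraph[of "l + m" q n] unfolding adm_def by blast
  qed
  then have "1 / (4 * real q) \<le> turan_density (l + m) l ?F"
    by (intro density_ge_if_frequently_adm[OF kg ne l] eventually_frequently) auto
  moreover have "0 < 1 / (4 * real q)" using q(1) by simp
  ultimately have "0 < turan_density (l + m) l ?F" by linarith
  then show "\<exists>a\<in>turan_spectrum (l + m) l. a \<noteq> 0 \<and> \<bar>a - 0\<bar> < e"
    using upper cd density_in_spectrum[OF kg ne, of l] by (intro bexI[of _ "turan_density (l + m) l ?F"]) auto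
qed

section \<open>Lifting ordinary densities to larger edges\<close>

text \<open>Even numbers carry the old vertices and odd numbers the pairs of an \<open>l\<close>-set and a vertex of \<open>Q\<close>,
  which keeps the iteration within the natural numbers.\<close>

definition old_vertex :: "nat \<Rightarrow> nat" where
  "old_vertex v = 2 * v"

definition new_vertex :: "nat set \<Rightarrow> nat \<Rightarrow> nat" where
  "new_vertex T q = 2 * prod_encode (set_encode T, q) + 1"

text \<open>Every \<open>l\<close>-set of vertices of \<open>F\<close> receives its own copy of \<open>Q\<close> in its link.\<close>

definition attach :: "nat \<Rightarrow> nat hypergraph \<Rightarrow> nat hypergraph \<Rightarrow> nat hypergraph" where
  "attach l Q F = (old_vertex ` verts F \<union> {new_vertex T q |T q. T \<subseteq> verts F \<and> card T = l \<and> q \<in> verts Q},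
    (\<lambda>e. old_vertex ` e) ` edges F \<union>
    {old_vertex ` T \<union> new_vertex T ` e |T e. T \<subseteq> verts F \<and> card T = l \<and> e \<in> edges Q})"

text \<open>The start, \<open>l\<close> vertices without an edge, is the smallest hypergraph with an \<open>l\<close>-set to attach to.\<close>

definition iterated_attach :: "nat \<Rightarrow> nat hypergraph \<Rightarrow> nat \<Rightarrow> nat hypergraph" where
  "iterated_attach l Q D = (attach l Q ^^ D) ({..<l}, {})"

lemma iterated_attach_0: "iterated_attach l Q 0 = ({..<l}, {})"
  by (simp add: iterated_attach_def)

lemma iterated_attach_Suc: "iterated_attach l Q (Suc D) = attach l Q (iterated_attach l Q D)"
  by (simp add: iterated_attach_def)

lemma old_vertex_inj: "inj_on old_vertex A"
  by (auto simp: inj_on_def old_vertex_def)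

lemma old_new_vertex_disjoint: "old_vertex ` A \<inter> new_vertex T ` B = {}"
proof -
  have "old_vertex v \<noteq> new_vertex T q" for v q unfolding old_vertex_def new_vertex_def by presburger
  then show ?thesis by auto
qed

lemma new_vertex_inj: "inj_on (new_vertex T) A"
  by (auto simp: inj_on_def new_vertex_def)

definition recover :: "(nat \<Rightarrow> 'a) \<Rightarrow> (nat set \<Rightarrow> nat \<Rightarrow> 'a) \<Rightarrow> nat \<Rightarrow> 'a" where
  "recover f g z = (if even z then f (z div 2) else g (set_decode (fst (prod_decode (z div 2)))) (snd (prod_decode (z div 2))))"

lemma recover_old: "recover f g (old_vertex v) = f v"
  by (simp add: recover_def old_vertex_def)

lemma recover_new: "finite T \<Longrightarrow> recover f g (new_vertex T q) = g T q"
  by (simp add: recover_def new_vertex_def)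

lemma attach_kgraph:
  assumes F: "kgraph (l + m) F" and Q: "kgraph m Q"
  shows "kgraph (l + m) (attach l Q F)"
  unfolding kgraph_def
proof (intro conjI ballI)
  have fin: "finite (verts F)" "finite (verts Q)" using F Q kgraph_finite by blast+
  have "{new_vertex T q |T q. T \<subseteq> verts F \<and> card T = l \<and> q \<in> verts Q}
     \<subseteq> (\<lambda>(T, q). new_vertex T q) ` (Pow (verts F) \<times> verts Q)" by auto
  then have "finite {new_vertex T q |T q. T \<subseteq> verts F \<and> card T = l \<and> q \<in> verts Q}"
    by (rule finite_subset) (use fin in auto)
  then show "finite (verts (attach l Q F))" using fin by (simp add: attach_def)
  fix e assume "e \<in> edges (attach l Q F)"
  then consider (old) e' where "e' \<in> edges F" "e = old_vertex ` e'"
    | (new) T e' where "T \<subseteq> verts F" "card T = l" "e' \<in> edges Q" "e = old_vertex ` T \<union> new_vertex T ` e'"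
    by (auto simp: attach_def)
  then have "e \<subseteq> verts (attach l Q F) \<and> card e = l + m"
  proof cases
    case old
    then show ?thesis using kgraph_edge[OF F old(1)] by (auto simp: attach_def card_image[OF old_vertex_inj])
  next
    case new
    have e': "e' \<subseteq> verts Q" "card e' = m" using kgraph_edge[OF Q new(3)] by auto
    have "finite T" "finite e'" using new(1) e'(1) fin finite_subset by blast+
    then have "card e = card T + card e'"
      unfolding new(4) using old_new_vertex_disjoint[of T T e']
      by (simp add: card_Un_disjoint card_image[OF old_vertex_inj] card_image[OF new_vertex_inj])
    then show ?thesis using new e' by (auto simp: attach_def)
  qed
  then show "e \<subseteq> verts (attach l Q F)" "card e = l + m" by auto
qed

lemma iterated_attach_kgraph: "kgraph m Q \<Longrightarrow> kgraph (l + m) (iterated_attach l Q D)"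
  by (induction D) (auto simp: iterated_attach_0 iterated_attach_Suc attach_kgraph, simp add: kgraph_def)

lemma iterated_attach_has_subset:
  "\<exists>T \<subseteq> verts (iterated_attach l Q D). card T = l"
proof (induction D)
  case 0 then show ?case by (intro exI[of _ "{..<l}"]) (simp add: iterated_attach_0)
next
  case (Suc D)
  then obtain T where T: "T \<subseteq> verts (iterated_attach l Q D)" "card T = l" by blast
  then have "old_vertex ` T \<subseteq> verts (attach l Q (iterated_attach l Q D))" by (auto simp: attach_def)
  moreover have "card (old_vertex ` T) = l" using T by (simp add: card_image[OF old_vertex_inj])
  ultimately show ?case unfolding iterated_attach_Suc by blast
qed

lemma iterated_attach_edges:
  assumes "edges Q \<noteq> {}"
  shows "edges (iterated_attach l Q (Suc D)) \<noteq> {}"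
proof -
  obtain T where T: "T \<subseteq> verts (iterated_attach l Q D)" "card T = l" using iterated_attach_has_subset by blast
  obtain e where "e \<in> edges Q" using assms by blast
  then have "old_vertex ` T \<union> new_vertex T ` e \<in> edges (attach l Q (iterated_attach l Q D))"
    using T unfolding attach_def by auto
  then show ?thesis unfolding iterated_attach_Suc by blast
qed

definition link :: "nat \<Rightarrow> 'a hypergraph \<Rightarrow> 'a set \<Rightarrow> 'a hypergraph" where
  "link m H T = (verts H, {M. M \<subseteq> verts H - T \<and> card M = m \<and> T \<union> M \<in> edges H})"

lemma link_kgraph: "kgraph k H \<Longrightarrow> kgraph m (link m H T)"
  by (auto simp: link_def kgraph_def)

lemma link_dense:
  assumes "kgraph (l + m) H" "ldense (l + m) l c H" "T \<subseteq> verts H" "card T = l"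
  shows "ldense m 0 c (link m H T)"
  unfolding ldense_def
proof (intro allI impI)
  fix S assume S: "S \<subseteq> verts (link m H T) \<and> card S = 0"
  have "finite (verts H)" using assms(1) by (rule kgraph_finite)
  then have "S = {}" using S by (auto simp: link_def dest: finite_subset)
  then have "hg_degree (link m H T) S = hg_degree H T"
    using degree_eq_card_completions[OF assms(1,3,4)] by (simp add: hg_degree_def link_def)
  then show "c * real (card (verts (link m H T))) ^ (m - 0) \<le> fact (m - 0) * real (hg_degree (link m H T) S)"
    using assms by (simp add: ldense_def link_def)
qed

lemma hom_attach:
  assumes emb: "hg_emb F G" and F: "kgraph k F" and G: "verts G \<subseteq> verts H" "edges G \<subseteq> edges H"
    and links: "\<And>T. T \<subseteq> verts G \<Longrightarrow> card T = l \<Longrightarrow> hg_hom Q (link m H T)"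
  shows "hg_hom (attach l Q F) H"
proof -
  obtain f where f0: "inj_on f (verts F)" "f ` verts F \<subseteq> verts G" "\<And>e. e \<in> edges F \<Longrightarrow> f ` e \<in> edges G"
    using emb by (auto simp: hg_emb_def)
  then have f: "inj_on f (verts F)" "f ` verts F \<subseteq> verts H" "\<And>e. e \<in> edges F \<Longrightarrow> f ` e \<in> edges H"
    using G by blast+
  have "\<exists>g. g ` verts Q \<subseteq> verts H \<and> (\<forall>e\<in>edges Q. f ` T \<union> g ` e \<in> edges H)"
    if T: "T \<subseteq> verts F" "card T = l" for T
  proof -
    have "f ` T \<subseteq> verts G" "card (f ` T) = l" using f0 T by (auto simp: card_image inj_on_subset)
    then have "hg_hom Q (link m H (f ` T))" by (rule links)
    then show ?thesis by (auto simp: hg_hom_def link_def)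
  qed
  then obtain g where g: "\<And>T. T \<subseteq> verts F \<Longrightarrow> card T = l \<Longrightarrow> g T ` verts Q \<subseteq> verts H"
    "\<And>T e. T \<subseteq> verts F \<Longrightarrow> card T = l \<Longrightarrow> e \<in> edges Q \<Longrightarrow> f ` T \<union> g T ` e \<in> edges H" by metis
  have finF: "finite T" if "T \<subseteq> verts F" for T using that kgraph_finite[OF F] finite_subset by blast
  show ?thesis unfolding hg_hom_def
  proof (intro exI[of _ "recover f g"] conjI ballI)
    show "recover f g ` verts (attach l Q F) \<subseteq> verts H"
    proof
      fix z assume "z \<in> recover f g ` verts (attach l Q F)"
      then consider (old) v where "v \<in> verts F" "z = recover f g (old_vertex v)"
        | (new) T q where "T \<subseteq> verts F" "card T = l" "q \<in> verts Q" "z = recover f g (new_vertex T q)"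
        by (auto simp: attach_def)
      then show "z \<in> verts H"
      proof cases
        case old then show ?thesis using f(2) by (auto simp: recover_old)
      next
        case new then show ?thesis using g(1)[OF new(1,2)] by (auto simp: recover_new[OF finF[OF new(1)]])
      qed
    qed
    fix e assume "e \<in> edges (attach l Q F)"
    then consider (old) e' where "e' \<in> edges F" "e = old_vertex ` e'"
      | (new) T e' where "T \<subseteq> verts F" "card T = l" "e' \<in> edges Q" "e = old_vertex ` T \<union> new_vertex T ` e'"
      by (auto simp: attach_def)
    then show "recover f g ` e \<in> edges H"
    proof cases
      case old then show ?thesis using f(3) by (simp add: image_image recover_old)
    next
      case new
      then show ?thesis using g(2)[OF new(1-3)]
        by (simp add: image_Un image_image recover_old recover_new[OF finF[OF new(1)]])
    qed
  qed
qed

lemma not_adm_above_1: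
  assumes "1 < d" "l \<le> k"
  shows "\<forall>\<^sub>F n in sequentially. \<not> adm k l n d F"
  using eventually_gt_at_top[of l]
proof eventually_elim
  case (elim n)
  show ?case
  proof
    assume "adm k l n d F"
    then obtain H :: "nat hypergraph" where "kgraph k H" "card (verts H) = n" "ldense k l d H" unfolding adm_def by blast
    then show False using ldense_le_1[of k H l d] assms elim by auto
  qed
qed

lemma iterated_attach_0_forced:
  "\<forall>\<^sub>F n in sequentially. \<not> adm (l + m) l n d (iterated_attach l Q 0)"
  using eventually_ge_at_top[of l]
proof eventually_elim
  case (elim n)
  have "hg_emb ({..<l}, {}) H" if H: "kgraph (l + m) H" "card (verts H) = n" for H :: "nat hypergraph"
  proof -
    obtain f where "f ` {..<l} \<subseteq> verts H" "inj_on f {..<l}"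
      using card_le_inj[of "{..<l}" "verts H"] kgraph_finite[OF H(1)] H(2) elim by auto
    then show ?thesis by (auto simp: hg_emb_def)
  qed
  then show ?case by (auto simp: adm_def iterated_attach_0)
qed

text \<open>Above the density of \<open>Q\<close>, all links contain \<open>Q\<close>, so attaching copies of \<open>Q\<close> never stops.\<close>

lemma iterated_attach_forced:
  fixes Q :: "nat hypergraph"
  assumes Q: "kgraph m Q" "edges Q \<noteq> {}" and m: "0 < m" and d: "turan_density m 0 Q < d"
  shows "\<forall>\<^sub>F n in sequentially. \<not> adm (l + m) l n d (iterated_attach l Q D)"
  using d
proof (induction D arbitrary: d)
  case 0
  show ?case by (rule iterated_attach_0_forced)
next
  case (Suc D)
  show ?case
  proof (cases "d \<le> 1")
    case False
    then show ?thesis by (intro not_adm_above_1) auto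
  next
    case True
    let ?F = "iterated_attach l Q D"
    define c where "c = (turan_density m 0 Q + d) / 2"
    have c: "turan_density m 0 Q < c" "c < d" using Suc.prems by (auto simp: c_def)
    have l: "l < l + m" using m by simp
    have "\<forall>\<^sub>F N in sequentially. \<forall>\<^sub>F n in sequentially. \<not> adm (l + m) l n d (attach l Q ?F)"
      using density_le_if_hom_forced[OF l c(2) True, where ?'b = nat] Suc.IH[OF c(1)] emb_if_above_density[OF Q m c(1)]
    proof eventually_elim
      case (elim N)
      have "hg_hom (attach l Q ?F) H" if H: "kgraph (l + m) H" "verts H = {..<N}" "ldense (l + m) l c H" for H :: "nat hypergraph"
      proof (rule hom_attach[OF _ iterated_attach_kgraph[OF Q(1)] order_refl order_refl])
        have "card (verts H) = N" using H(2) by simp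
        then show "hg_emb ?F H" using elim(2) H(1,3) unfolding adm_def by blast
        fix T assume T: "T \<subseteq> verts H" "card T = l"
        have "card (verts (link m H T)) = N" using H(2) by (simp add: link_def)
        then show "hg_hom Q (link m H T)"
          using elim(3) link_dense[OF H(1,3) T] link_kgraph[OF H(1), of m T] emb_imp_hom by blast
      qed
      then show ?case using elim(1) attach_kgraph[OF iterated_attach_kgraph[OF Q(1)] Q(1)] by blast
    qed
    then show ?thesis unfolding iterated_attach_Suc by simp
  qed
qed

text \<open>If each edge is governed by its \<open>l\<close>-subset of lowest level, and the edges governed by \<open>T\<close>
  form a hypergraph in the link of \<open>T\<close> without homomorphism from \<open>Q\<close>, then a copy of \<open>Q\<close> in the
  link of \<open>T\<close> brings in an \<open>l\<close>-set of lower level. So \<open>D\<close> rounds of attaching exhaust \<open>D\<close> levels.\<close>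

lemma iterated_attach_not_emb:
  fixes G :: "nat hypergraph" and level :: "nat set \<Rightarrow> nat"
  assumes Q: "kgraph m Q" and no: "\<not> hg_hom Q J"
    and level: "\<And>T. T \<subseteq> verts G \<Longrightarrow> card T = l \<Longrightarrow> level T < D"
    and inj: "\<And>e. e \<in> edges G \<Longrightarrow> inj_on level {T. T \<subseteq> e \<and> card T = l}"
    and colour: "\<And>T v. T \<subseteq> verts G \<Longrightarrow> card T = l \<Longrightarrow> v \<in> verts G - T \<Longrightarrow> colour T v \<in> verts J"
    and lowest: "\<And>e T. e \<in> edges G \<Longrightarrow> T \<subseteq> e \<Longrightarrow> card T = l \<Longrightarrow>
      (\<And>T'. T' \<subseteq> e \<Longrightarrow> card T' = l \<Longrightarrow> T' \<noteq> T \<Longrightarrow> level T < level T') \<Longrightarrow> colour T ` (e - T) \<in> edges J"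
  shows "\<not> hg_emb (iterated_attach l Q D) G"
proof -
  have claim: "\<exists>T \<subseteq> \<phi> ` verts (iterated_attach l Q i). card T = l \<and> level T + i < D"
    if "inj_on \<phi> (verts (iterated_attach l Q i))" "\<phi> ` verts (iterated_attach l Q i) \<subseteq> verts G"
      "\<And>e. e \<in> edges (iterated_attach l Q i) \<Longrightarrow> \<phi> ` e \<in> edges G" for i \<phi>
    using that
  proof (induction i arbitrary: \<phi>)
    case 0
    then have "card (\<phi> ` {..<l}) = l" "\<phi> ` {..<l} \<subseteq> verts G" by (auto simp: iterated_attach_0 card_image)
    then show ?case using level[of "\<phi> ` {..<l}"] by (intro exI[of _ "\<phi> ` {..<l}"]) (simp add: iterated_attach_0)
  next
    case (Suc i)
    let ?F = "iterated_attach l Q i" and ?F' = "attach l Q (iterated_attach l Q i)"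
    note prems = Suc.prems[unfolded iterated_attach_Suc]
    have oldF: "old_vertex ` verts ?F \<subseteq> verts ?F'" by (auto simp: attach_def)
    have "\<exists>T \<subseteq> (\<phi> \<circ> old_vertex) ` verts ?F. card T = l \<and> level T + i < D"
    proof (rule Suc.IH)
      show "inj_on (\<phi> \<circ> old_vertex) (verts ?F)"
        by (rule comp_inj_on[OF old_vertex_inj inj_on_subset[OF prems(1) oldF]])
      show "(\<phi> \<circ> old_vertex) ` verts ?F \<subseteq> verts G" using prems(2) oldF by auto
      fix e assume "e \<in> edges ?F"
      then have "old_vertex ` e \<in> edges ?F'" by (auto simp: attach_def)
      then show "(\<phi> \<circ> old_vertex) ` e \<in> edges G" unfolding image_comp[symmetric] by (rule prems(3))
    qed
    then obtain T where T: "T \<subseteq> (\<phi> \<circ> old_vertex) ` verts ?F" "card T = l" "level T + i < D" by blast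
    obtain T0 where T0: "T0 \<subseteq> verts ?F" "T = (\<phi> \<circ> old_vertex) ` T0" using T(1) by (auto simp: subset_image_iff)
    have injo: "inj_on (\<phi> \<circ> old_vertex) (verts ?F)"
      by (rule comp_inj_on[OF old_vertex_inj inj_on_subset[OF prems(1) oldF]])
    have cT0: "card T0 = l" using T(2) T0 card_image[OF inj_on_subset[OF injo T0(1)]] by simp
    have "old_vertex ` T0 \<subseteq> verts ?F'" using T0(1) oldF by blast
    then have "\<phi> ` (old_vertex ` T0) \<subseteq> verts G" using prems(2) by blast
    then have TG: "T \<subseteq> verts G" by (simp only: T0(2) image_comp)
    define \<psi> where "\<psi> q = \<phi> (new_vertex T0 q)" for q
    have newF: "new_vertex T0 q \<in> verts ?F'" if "q \<in> verts Q" for q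
      using that T0(1) cT0 by (auto simp: attach_def)
    have \<psi>: "\<psi> q \<in> verts G - T" if q: "q \<in> verts Q" for q
    proof -
      have "\<psi> q \<in> verts G" using prems(2) newF[OF q] by (auto simp: \<psi>_def)
      moreover have "\<psi> q \<notin> T"
      proof
        assume "\<psi> q \<in> T"
        then obtain v where v: "v \<in> T0" "\<phi> (new_vertex T0 q) = \<phi> (old_vertex v)" by (auto simp: \<psi>_def T0(2))
        have "old_vertex v \<in> verts ?F'" using v(1) T0(1) oldF by blast
        then have "new_vertex T0 q = old_vertex v" using inj_onD[OF prems(1) v(2) newF[OF q]] by blast
        then show False using old_new_vertex_disjoint[of "{v}" T0 "{q}"] by auto
      qed
      ultimately show ?thesis by simp
    qed
    have edge: "T \<union> \<psi> ` e \<in> edges G" if e: "e \<in> edges Q" for e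
    proof -
      have "old_vertex ` T0 \<union> new_vertex T0 ` e \<in> edges ?F'" using e T0(1) cT0 by (auto simp: attach_def)
      then have "\<phi> ` (old_vertex ` T0 \<union> new_vertex T0 ` e) \<in> edges G" by (rule prems(3))
      moreover have "\<phi> ` (old_vertex ` T0 \<union> new_vertex T0 ` e) = T \<union> \<psi> ` e"
        by (simp add: image_Un image_image T0(2) \<psi>_def)
      ultimately show ?thesis by simp
    qed
    have "\<exists>e\<in>edges Q. \<exists>T' \<subseteq> T \<union> \<psi> ` e. card T' = l \<and> level T' < level T"
    proof (rule ccontr)
      assume neg: "\<not> (\<exists>e\<in>edges Q. \<exists>T' \<subseteq> T \<union> \<psi> ` e. card T' = l \<and> level T' < level T)"
      have "hg_hom Q J" unfolding hg_hom_def
      proof (intro exI[of _ "\<lambda>q. colour T (\<psi> q)"] conjI ballI)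
        show "(\<lambda>q. colour T (\<psi> q)) ` verts Q \<subseteq> verts J" using colour[OF TG T(2)] \<psi> by auto
        fix e assume e: "e \<in> edges Q"
        have "colour T ` (T \<union> \<psi> ` e - T) \<in> edges J"
        proof (rule lowest[OF edge[OF e]])
          fix T' assume T': "T' \<subseteq> T \<union> \<psi> ` e" "card T' = l" "T' \<noteq> T"
          then have "level T' \<noteq> level T" using inj_onD[OF inj[OF edge[OF e]], of T' T] T(2) by auto
          then show "level T < level T'" using neg e T' by (metis linorder_less_linear)
        qed (use T in auto)
        moreover have "T \<union> \<psi> ` e - T = \<psi> ` e" using \<psi> kgraph_edge[OF Q e] by auto
        ultimately show "(\<lambda>q. colour T (\<psi> q)) ` e \<in> edges J" by (simp add: image_image)
      qed
      then show False using no by simp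
    qed
    then obtain e T' where e: "e \<in> edges Q" "T' \<subseteq> T \<union> \<psi> ` e" "card T' = l" "level T' < level T" by blast
    have "\<psi> ` e \<subseteq> \<phi> ` verts ?F'" using newF kgraph_edge[OF Q e(1)] by (auto simp: \<psi>_def)
    moreover have "T \<subseteq> \<phi> ` verts ?F'" using T0 oldF by auto
    ultimately have "T' \<subseteq> \<phi> ` verts ?F'" using e(2) by blast
    then show ?case unfolding iterated_attach_Suc using e T(3) by (intro exI[of _ T']) auto
  qed
  show ?thesis
  proof
    assume "hg_emb (iterated_attach l Q D) G"
    then obtain \<phi> where "inj_on \<phi> (verts (iterated_attach l Q D))" "\<phi> ` verts (iterated_attach l Q D) \<subseteq> verts G"
      "\<And>e. e \<in> edges (iterated_attach l Q D) \<Longrightarrow> \<phi> ` e \<in> edges G" by (auto simp: hg_emb_def)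
    from claim[OF this] show False by simp
  qed
qed

text \<open>The coordinate \<open>Inl T\<close> holds the level of the \<open>l\<close>-set \<open>T\<close>, and \<open>Inr (T, v)\<close> the colour of \<open>v\<close> as
  seen from \<open>T\<close>.\<close>

type_synonym governing_index = "nat set + nat set \<times> nat"

definition governing_support :: "governing_index \<Rightarrow> nat set" where
  "governing_support i = (case i of Inl T \<Rightarrow> T | Inr (T, v) \<Rightarrow> insert v T)"

definition governing_coords :: "nat \<Rightarrow> nat \<Rightarrow> governing_index set" where
  "governing_coords l N = Inl ` {T. T \<subseteq> {..<N} \<and> card T = l} \<union> Inr ` ({T. T \<subseteq> {..<N} \<and> card T = l} \<times> {..<N})"

definition governing_values :: "nat \<Rightarrow> nat hypergraph \<Rightarrow> governing_index \<Rightarrow> nat set" where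
  "governing_values D J i = (case i of Inl T \<Rightarrow> {..<D} | Inr p \<Rightarrow> verts J)"

definition lowest :: "nat \<Rightarrow> nat set \<Rightarrow> (governing_index \<Rightarrow> nat) \<Rightarrow> nat set \<Rightarrow> bool" where
  "lowest l e \<omega> T \<longleftrightarrow> T \<subseteq> e \<and> card T = l \<and> inj_on (\<lambda>T. \<omega> (Inl T)) {T. T \<subseteq> e \<and> card T = l} \<and>
     (\<forall>T'. T' \<subseteq> e \<and> card T' = l \<and> T' \<noteq> T \<longrightarrow> \<omega> (Inl T) < \<omega> (Inl T'))"

definition governed :: "nat \<Rightarrow> nat hypergraph \<Rightarrow> nat set \<Rightarrow> (governing_index \<Rightarrow> nat) \<Rightarrow> bool" where
  "governed l J e \<omega> \<longleftrightarrow> (\<exists>T. lowest l e \<omega> T \<and> (\<lambda>v. \<omega> (Inr (T, v))) ` (e - T) \<in> edges J)"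

lemma lowest_cong:
  assumes "\<And>T. T \<subseteq> e \<Longrightarrow> card T = l \<Longrightarrow> \<omega> (Inl T) = \<omega>' (Inl T)"
  shows "lowest l e \<omega> T = lowest l e \<omega>' T"
proof -
  have "inj_on (\<lambda>T. \<omega> (Inl T)) {T. T \<subseteq> e \<and> card T = l} = inj_on (\<lambda>T. \<omega>' (Inl T)) {T. T \<subseteq> e \<and> card T = l}"
    by (rule inj_on_cong) (use assms in simp)
  moreover have "(T' \<subseteq> e \<and> card T' = l \<and> T' \<noteq> T \<longrightarrow> \<omega> (Inl T) < \<omega> (Inl T'))
      = (T' \<subseteq> e \<and> card T' = l \<and> T' \<noteq> T \<longrightarrow> \<omega>' (Inl T) < \<omega>' (Inl T'))" if "T \<subseteq> e" "card T = l" for T'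
    using assms[of T'] assms[OF that] by auto
  ultimately show ?thesis unfolding lowest_def by blast
qed

lemma lowest_unique: "lowest l e \<omega> T \<Longrightarrow> lowest l e \<omega> T' \<Longrightarrow> T = T'"
  unfolding lowest_def by (metis order_less_asym)

lemma lowest_exists:
  assumes "finite e" "l \<le> card e" and inj: "inj_on (\<lambda>T. \<omega> (Inl T)) {T. T \<subseteq> e \<and> card T = l}"
  shows "\<exists>T. lowest l e \<omega> T"
proof -
  let ?L = "{T. T \<subseteq> e \<and> card T = l}"
  have fin: "finite ?L" using assms(1) by auto
  obtain T0 where "T0 \<subseteq> e" "card T0 = l" using obtain_subset_with_card_n[OF assms(2)] by blast
  then have "?L \<noteq> {}" by blast
  then obtain T where T: "T \<in> ?L" "\<And>T'. T' \<in> ?L \<Longrightarrow> \<omega> (Inl T) \<le> \<omega> (Inl T')"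
    using ex_min_if_finite[of "(\<lambda>T. \<omega> (Inl T)) ` ?L"] fin by (auto simp: not_less)
  have "\<omega> (Inl T) < \<omega> (Inl T')" if "T' \<in> ?L" "T' \<noteq> T" for T'
    using T(2)[OF that(1)] inj_onD[OF inj _ that(1) T(1)] that(2) by (cases "\<omega> (Inl T) = \<omega> (Inl T')") auto
  then show ?thesis using T(1) inj unfolding lowest_def by blast
qed

lemma governed_cong:
  assumes "\<And>i. governing_support i \<subseteq> e \<Longrightarrow> \<omega> i = \<omega>' i"
  shows "governed l J e \<omega> = governed l J e \<omega>'"
proof -
  have low: "lowest l e \<omega> T = lowest l e \<omega>' T" for T
    by (rule lowest_cong) (use assms in \<open>simp add: governing_support_def\<close>)
  have img: "(\<lambda>v. \<omega> (Inr (T, v))) ` (e - T) = (\<lambda>v. \<omega>' (Inr (T, v))) ` (e - T)" if "T \<subseteq> e" for T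
    by (rule image_cong) (use assms that in \<open>auto simp: governing_support_def\<close>)
  have "(lowest l e \<omega> T \<and> (\<lambda>v. \<omega> (Inr (T, v))) ` (e - T) \<in> edges J)
      = (lowest l e \<omega>' T \<and> (\<lambda>v. \<omega>' (Inr (T, v))) ` (e - T) \<in> edges J)" for T
  proof (cases "lowest l e \<omega>' T")
    case True
    then have "T \<subseteq> e" by (simp add: lowest_def)
    then show ?thesis using low img by simp
  qed (simp add: low)
  then show ?thesis unfolding governed_def by simp
qed

lemma governing_finite:
  assumes "finite (verts J)"
  shows "finite (PiE (governing_coords l N) (governing_values D J))"
proof (rule finite_PiE)
  have "finite {T. T \<subseteq> {..<N} \<and> card T = l}" by (rule finite_subset[of _ "Pow {..<N}"]) auto
  then show "finite (governing_coords l N)" by (simp add: governing_coords_def)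
  show "finite (governing_values D J i)" for i using assms by (simp add: governing_values_def split: sum.split)
qed

text \<open>Two given \<open>l\<close>-sets have the same level with probability at most \<open>1 / D\<close>. Given the levels, the
  colours around the lowest \<open>l\<close>-set are still uniform, and they form an edge of \<open>J\<close> with probability
  at least \<open>c\<close>.\<close>

lemma governed_probability:
  assumes e: "e \<subseteq> {..<N}" "card e = l + m" and S: "S \<subseteq> e" "card S = l"
    and J: "kgraph m J" "verts J \<noteq> {}" "c * real (card (verts J)) ^ m \<le> fact m * real (card (edges J))"
    and c: "0 \<le> c" "c \<le> 1" and D: "0 < D"
  shows "(c - (2 ^ (l + m))\<^sup>2 / real D) * real (card (PiE (governing_coords l N) (governing_values D J)))
    \<le> real (card {\<omega>' \<in> PiE (governing_coords l N) (governing_values D J). governed l J e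
        (override_on \<omega> \<omega>' {i. governing_support i \<subseteq> e \<and> \<not> governing_support i \<subseteq> S})})"
proof -
  define I where "I = governing_coords l N"
  define W where "W = governing_values D J"
  define R where "R = {i. governing_support i \<subseteq> e \<and> \<not> governing_support i \<subseteq> S}"
  define L where "L = {T. T \<subseteq> e \<and> card T = l}"
  define O' where "O' \<omega>' = override_on \<omega> \<omega>' R" for \<omega>'
  let ?\<Omega> = "PiE I W" and ?n = "card (verts J)"
  have finJ: "finite (verts J)" by (rule kgraph_finite[OF J(1)])
  have fin\<Omega>: "finite ?\<Omega>" unfolding I_def W_def by (rule governing_finite[OF finJ])
  have fine: "finite e" using e finite_subset by blast
  have finL: "finite L" using fine by (simp add: L_def)
  have cardL: "card L \<le> 2 ^ (l + m)"
    using card_mono[of "Pow e" L] fine e(2) by (auto simp: L_def card_Pow)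
  have LI: "Inl T \<in> I" if "T \<in> L" for T using that e(1) by (auto simp: L_def I_def governing_coords_def)
  have LR: "Inl T \<in> R" if T: "T \<in> L" "T \<noteq> S" for T
  proof -
    have "\<not> T \<subseteq> S" using card_subset_eq[of S T] T S finite_subset[OF S(1) fine] by (auto simp: L_def)
    then show ?thesis using T by (simp add: L_def R_def governing_support_def)
  qed
  define C where "C T = (\<lambda>v. Inr (T, v) :: governing_index) ` (e - T)" for T
  have CI: "C T \<subseteq> I" if T: "T \<in> L" for T
  proof
    fix i assume "i \<in> C T"
    then obtain v where v: "i = Inr (T, v)" "v \<in> e" by (auto simp: C_def)
    then have "(T, v) \<in> {T. T \<subseteq> {..<N} \<and> card T = l} \<times> {..<N}" using T e(1) by (auto simp: L_def)
    then show "i \<in> I" unfolding I_def governing_coords_def v(1) by blast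
  qed
  have CR: "C T \<subseteq> R" if T: "T \<in> L" for T
  proof
    fix i assume "i \<in> C T"
    then obtain v where v: "i = Inr (T, v)" "v \<in> e" "v \<notin> T" by (auto simp: C_def)
    have "\<not> insert v T \<subseteq> S"
    proof
      assume "insert v T \<subseteq> S"
      then have "card (insert v T) \<le> card S" using S(1) fine finite_subset card_mono by metis
      moreover have "finite T" using T fine finite_subset by (auto simp: L_def)
      ultimately show False using T S(2) v(3) by (simp add: L_def)
    qed
    then show "i \<in> R" using v T by (auto simp: R_def governing_support_def L_def)
  qed
  have agree: "real D * real (card {\<omega>' \<in> ?\<Omega>. O' \<omega>' (Inl T) = O' \<omega>' (Inl T')}) \<le> real (card ?\<Omega>)"
    if T: "T \<in> L" "T' \<in> L" "T \<noteq> T'" "T \<noteq> S" for T T'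
  proof -
    have "card {\<omega>' \<in> ?\<Omega>. \<omega>' (Inl T) = O' \<omega>' (Inl T')} * card (W (Inl T)) \<le> card ?\<Omega>"
    proof (rule card_coordinate_agrees[OF fin\<Omega> LI[OF T(1)]])
      fix \<omega>' x show "O' (fun_upd \<omega>' (Inl T) x) (Inl T') = O' \<omega>' (Inl T')"
        using T(3) by (simp add: O'_def override_on_def)
    qed
    moreover have "O' \<omega>' (Inl T) = \<omega>' (Inl T)" for \<omega>' using LR[OF T(1,4)] by (simp add: O'_def)
    ultimately have "card {\<omega>' \<in> ?\<Omega>. O' \<omega>' (Inl T) = O' \<omega>' (Inl T')} * D \<le> card ?\<Omega>"
      by (simp add: W_def governing_values_def)
    then show ?thesis by (simp only: of_nat_mult[symmetric] of_nat_le_iff mult.commute)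
  qed
  define inj where "inj \<omega>' \<longleftrightarrow> inj_on (\<lambda>T. \<omega>' (Inl T)) L" for \<omega>' :: "governing_index \<Rightarrow> nat"
  have "real D * real (card {\<omega>' \<in> ?\<Omega>. \<not> inj (O' \<omega>')}) \<le> (2 ^ (l + m))\<^sup>2 * real (card ?\<Omega>)"
  proof -
    define X where "X = {(T, T'). T \<in> L \<and> T' \<in> L \<and> T \<noteq> T' \<and> T \<noteq> S}"
    have XL: "X \<subseteq> L \<times> L" by (auto simp: X_def)
    have finX: "finite X" by (rule finite_subset[OF XL]) (use finL in auto)
    have "{\<omega>' \<in> ?\<Omega>. \<not> inj (O' \<omega>')} \<subseteq> (\<Union>p\<in>X. {\<omega>' \<in> ?\<Omega>. O' \<omega>' (Inl (fst p)) = O' \<omega>' (Inl (snd p))})"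
    proof
      fix \<omega>' assume w: "\<omega>' \<in> {\<omega>' \<in> ?\<Omega>. \<not> inj (O' \<omega>')}"
      then obtain T T' where T: "T \<in> L" "T' \<in> L" "T \<noteq> T'" "O' \<omega>' (Inl T) = O' \<omega>' (Inl T')"
        unfolding inj_def inj_on_def by blast
      have "\<exists>p\<in>X. O' \<omega>' (Inl (fst p)) = O' \<omega>' (Inl (snd p))"
      proof (cases "T = S")
        case True then show ?thesis using T by (intro bexI[of _ "(T', T)"]) (simp_all add: X_def)
      next
        case False then show ?thesis using T by (intro bexI[of _ "(T, T')"]) (simp_all add: X_def)
      qed
      then show "\<omega>' \<in> (\<Union>p\<in>X. {\<omega>' \<in> ?\<Omega>. O' \<omega>' (Inl (fst p)) = O' \<omega>' (Inl (snd p))})" using w by blast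
    qed
    then have "card {\<omega>' \<in> ?\<Omega>. \<not> inj (O' \<omega>')} \<le> card (\<Union>p\<in>X. {\<omega>' \<in> ?\<Omega>. O' \<omega>' (Inl (fst p)) = O' \<omega>' (Inl (snd p))})"
      by (rule card_mono[rotated]) (use finX fin\<Omega> in auto)
    also have "\<dots> \<le> (\<Sum>p\<in>X. card {\<omega>' \<in> ?\<Omega>. O' \<omega>' (Inl (fst p)) = O' \<omega>' (Inl (snd p))})"
      by (rule card_UN_le[OF finX])
    finally have "real (card {\<omega>' \<in> ?\<Omega>. \<not> inj (O' \<omega>')})
        \<le> (\<Sum>p\<in>X. real (card {\<omega>' \<in> ?\<Omega>. O' \<omega>' (Inl (fst p)) = O' \<omega>' (Inl (snd p))}))"
      by (simp only: of_nat_sum[symmetric] of_nat_le_iff)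
    then have "real D * real (card {\<omega>' \<in> ?\<Omega>. \<not> inj (O' \<omega>')})
        \<le> real D * (\<Sum>p\<in>X. real (card {\<omega>' \<in> ?\<Omega>. O' \<omega>' (Inl (fst p)) = O' \<omega>' (Inl (snd p))}))"
      by (rule mult_left_mono) simp
    also have "\<dots> = (\<Sum>p\<in>X. real D * real (card {\<omega>' \<in> ?\<Omega>. O' \<omega>' (Inl (fst p)) = O' \<omega>' (Inl (snd p))}))"
      by (rule sum_distrib_left)
    also have "\<dots> \<le> (\<Sum>p\<in>X. real (card ?\<Omega>))"
      by (rule sum_mono, rule agree) (auto simp: X_def)
    also have "\<dots> = real (card X) * real (card ?\<Omega>)" by simp
    also have "\<dots> \<le> (2 ^ (l + m))\<^sup>2 * real (card ?\<Omega>)"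
    proof (rule mult_right_mono)
      have "card X \<le> card L * card L" using card_mono[OF _ XL] finL by (simp add: card_cartesian_product)
      also have "\<dots> \<le> 2 ^ (l + m) * 2 ^ (l + m)" by (rule mult_le_mono[OF cardL cardL])
      finally have "real (card X) \<le> real (2 ^ (l + m) * 2 ^ (l + m))" by (simp only: of_nat_le_iff)
      then show "real (card X) \<le> (2 ^ (l + m))\<^sup>2" by (simp add: power2_eq_square)
    qed simp
    finally show ?thesis .
  qed
  then have notinj: "real (card {\<omega>' \<in> ?\<Omega>. \<not> inj (O' \<omega>')}) \<le> (2 ^ (l + m))\<^sup>2 / real D * real (card ?\<Omega>)"
    using D by (simp add: field_simps)
  have one: "c * real (card {\<omega>' \<in> ?\<Omega>. lowest l e (O' \<omega>') T})
      \<le> real (card {\<omega>' \<in> ?\<Omega>. lowest l e (O' \<omega>') T \<and> (\<lambda>v. O' \<omega>' (Inr (T, v))) ` (e - T) \<in> edges J})"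
    if T: "T \<in> L" for T
  proof -
    define P where "P z \<longleftrightarrow> (\<lambda>v. z (Inr (T, v))) ` (e - T) \<in> edges J" for z :: "governing_index \<Rightarrow> nat"
    have P: "(\<lambda>v. O' \<omega>' (Inr (T, v))) ` (e - T) \<in> edges J \<longleftrightarrow> P (restrict \<omega>' (C T))" for \<omega>'
    proof -
      have "O' \<omega>' (Inr (T, v)) = restrict \<omega>' (C T) (Inr (T, v))" if "v \<in> e - T" for v
      proof -
        have "Inr (T, v) \<in> C T" using that by (simp add: C_def)
        then show ?thesis using CR[OF T] by (auto simp: O'_def override_on_def)
      qed
      then have "(\<lambda>v. O' \<omega>' (Inr (T, v))) ` (e - T) = (\<lambda>v. restrict \<omega>' (C T) (Inr (T, v))) ` (e - T)"
        by (intro image_cong) auto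
      then show ?thesis unfolding P_def by simp
    qed
    have Q: "lowest l e (O' \<omega>1) T = lowest l e (O' \<omega>2) T" if "\<And>i. i \<in> I - C T \<Longrightarrow> \<omega>1 i = \<omega>2 i" for \<omega>1 \<omega>2
    proof (rule lowest_cong)
      fix T' assume T': "T' \<subseteq> e" "card T' = l"
      have "Inl T' \<in> I - C T" using T' LI[of T'] by (auto simp: C_def L_def)
      then show "O' \<omega>1 (Inl T') = O' \<omega>2 (Inl T')" using that[of "Inl T'"] by (simp add: O'_def override_on_def)
    qed
    have finT: "finite (e - T)" "card (e - T) = m"
      using T fine e(2) by (auto simp: L_def card_Diff_subset finite_subset)
    have cardC: "card (C T) = m" unfolding C_def using finT by (subst card_image) (auto simp: inj_on_def)
    have finC: "finite (C T)" using finT by (simp add: C_def)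
    have PiEC: "PiE (C T) W = C T \<rightarrow>\<^sub>E verts J"
      by (rule PiE_cong) (auto simp: C_def W_def governing_values_def)
    have cP: "card (PiE (C T) W) = ?n ^ m" unfolding PiEC using finC cardC by (simp add: card_funcsetE)
    have "z ` C T \<in> edges J \<longleftrightarrow> P z" for z by (simp add: P_def C_def image_image)
    then have "{z \<in> PiE (C T) W. P z} = {z \<in> C T \<rightarrow>\<^sub>E verts J. z ` C T \<in> edges J}"
      unfolding PiEC by simp
    then have "card {z \<in> PiE (C T) W. P z} = fact m * card (edges J)"
      using card_funcs_onto_edges[OF finC finJ, of "edges J"] kgraph_edge[OF J(1)] cardC by simp
    then have cz: "c * real (?n ^ m) \<le> real (card {z \<in> PiE (C T) W. P z})" using J(3) by simp
    define y where "y = card {y \<in> PiE (I - C T) W. lowest l e (O' y) T}"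
    have "card {\<omega>' \<in> ?\<Omega>. True \<and> lowest l e (O' \<omega>') T} = card {z \<in> PiE (C T) W. True} * y"
      unfolding y_def by (rule card_PiE_independent[OF CI[OF T], of _ W "\<lambda>_. True"]) (rule Q)
    then have 1: "card {\<omega>' \<in> ?\<Omega>. lowest l e (O' \<omega>') T} = ?n ^ m * y" using cP by simp
    have "card {\<omega>' \<in> ?\<Omega>. P (restrict \<omega>' (C T)) \<and> lowest l e (O' \<omega>') T} = card {z \<in> PiE (C T) W. P z} * y"
      unfolding y_def by (rule card_PiE_independent[OF CI[OF T]]) (rule Q)
    then have 2: "card {\<omega>' \<in> ?\<Omega>. lowest l e (O' \<omega>') T \<and> (\<lambda>v. O' \<omega>' (Inr (T, v))) ` (e - T) \<in> edges J}
        = card {z \<in> PiE (C T) W. P z} * y" by (simp only: P conj_commute)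
    have "c * real (?n ^ m) * real y \<le> real (card {z \<in> PiE (C T) W. P z}) * real y"
      by (rule mult_right_mono[OF cz]) simp
    then show ?thesis unfolding 1 2 by (simp only: of_nat_mult mult.assoc)
  qed
  have lowL: "T \<in> L" if "lowest l e \<omega>' T" for \<omega>' T using that by (simp add: lowest_def L_def)
  have "real (card {\<omega>' \<in> ?\<Omega>. inj (O' \<omega>')}) \<le> (\<Sum>T\<in>L. real (card {\<omega>' \<in> ?\<Omega>. lowest l e (O' \<omega>') T}))"
  proof -
    have "{\<omega>' \<in> ?\<Omega>. inj (O' \<omega>')} \<subseteq> (\<Union>T\<in>L. {\<omega>' \<in> ?\<Omega>. lowest l e (O' \<omega>') T})"
    proof
      fix \<omega>' assume w: "\<omega>' \<in> {\<omega>' \<in> ?\<Omega>. inj (O' \<omega>')}"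
      then have "\<exists>T. lowest l e (O' \<omega>') T" using lowest_exists[of e l "O' \<omega>'"] fine e(2) by (simp add: inj_def L_def)
      then show "\<omega>' \<in> (\<Union>T\<in>L. {\<omega>' \<in> ?\<Omega>. lowest l e (O' \<omega>') T})" using w lowL by blast
    qed
    then have "card {\<omega>' \<in> ?\<Omega>. inj (O' \<omega>')} \<le> card (\<Union>T\<in>L. {\<omega>' \<in> ?\<Omega>. lowest l e (O' \<omega>') T})"
      by (rule card_mono[rotated]) (use finL fin\<Omega> in auto)
    also have "\<dots> \<le> (\<Sum>T\<in>L. card {\<omega>' \<in> ?\<Omega>. lowest l e (O' \<omega>') T})" by (rule card_UN_le[OF finL])
    finally show ?thesis by (simp only: of_nat_sum[symmetric] of_nat_le_iff)
  qed
  then have "c * real (card {\<omega>' \<in> ?\<Omega>. inj (O' \<omega>')}) \<le> (\<Sum>T\<in>L. c * real (card {\<omega>' \<in> ?\<Omega>. lowest l e (O' \<omega>') T}))"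
    unfolding sum_distrib_left[symmetric] using c by (intro mult_left_mono)
  also have "\<dots> \<le> (\<Sum>T\<in>L. real (card {\<omega>' \<in> ?\<Omega>. lowest l e (O' \<omega>') T \<and> (\<lambda>v. O' \<omega>' (Inr (T, v))) ` (e - T) \<in> edges J}))"
    by (rule sum_mono) (rule one)
  also have "\<dots> = real (card (\<Union>T\<in>L. {\<omega>' \<in> ?\<Omega>. lowest l e (O' \<omega>') T \<and> (\<lambda>v. O' \<omega>' (Inr (T, v))) ` (e - T) \<in> edges J}))"
    unfolding of_nat_sum[symmetric]
    by (subst card_UN_disjoint[OF finL]) (use fin\<Omega> lowest_unique in \<open>blast | simp\<close>)+
  also have "(\<Union>T\<in>L. {\<omega>' \<in> ?\<Omega>. lowest l e (O' \<omega>') T \<and> (\<lambda>v. O' \<omega>' (Inr (T, v))) ` (e - T) \<in> edges J})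
      = {\<omega>' \<in> ?\<Omega>. governed l J e (O' \<omega>')}"
    unfolding governed_def using lowL by blast
  finally have main: "c * real (card {\<omega>' \<in> ?\<Omega>. inj (O' \<omega>')}) \<le> real (card {\<omega>' \<in> ?\<Omega>. governed l J e (O' \<omega>')})" .
  have split: "real (card {\<omega>' \<in> ?\<Omega>. inj (O' \<omega>')}) + real (card {\<omega>' \<in> ?\<Omega>. \<not> inj (O' \<omega>')}) = real (card ?\<Omega>)"
  proof -
    have "card ({\<omega>' \<in> ?\<Omega>. inj (O' \<omega>')} \<union> {\<omega>' \<in> ?\<Omega>. \<not> inj (O' \<omega>')})
        = card {\<omega>' \<in> ?\<Omega>. inj (O' \<omega>')} + card {\<omega>' \<in> ?\<Omega>. \<not> inj (O' \<omega>')}"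
      by (rule card_Un_disjoint) (use fin\<Omega> in auto)
    moreover have "{\<omega>' \<in> ?\<Omega>. inj (O' \<omega>')} \<union> {\<omega>' \<in> ?\<Omega>. \<not> inj (O' \<omega>')} = ?\<Omega>" by blast
    ultimately show ?thesis by (simp only: of_nat_add[symmetric])
  qed
  define G where "G = real (card {\<omega>' \<in> ?\<Omega>. inj (O' \<omega>')})"
  define B where "B = real (card {\<omega>' \<in> ?\<Omega>. \<not> inj (O' \<omega>')})"
  have "c * real (card ?\<Omega>) = c * G + c * B" 
    unfolding split[symmetric] G_def[symmetric] B_def[symmetric] by (rule distrib_left)
  moreover have "c * B \<le> B" using c by (simp add: B_def mult_left_le_one_le)
  moreover have "B \<le> (2 ^ (l + m))\<^sup>2 / real D * real (card ?\<Omega>)" using notinj by (simp only: B_def)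
  ultimately have "(c - (2 ^ (l + m))\<^sup>2 / real D) * real (card ?\<Omega>) \<le> c * G" by (simp only: left_diff_distrib)
  also have "\<dots> \<le> real (card {\<omega>' \<in> ?\<Omega>. governed l J e (O' \<omega>')})" using main by (simp only: G_def)
  finally show ?thesis unfolding O'_def R_def I_def W_def .
qed

text \<open>Random levels and colours yield a dense hypergraph as in \<open>iterated_attach_not_emb\<close>. Only a fraction
  of order \<open>1 / D\<close> of the edges is lost to ties between levels.\<close>

theorem iterated_attach_adm:
  fixes J :: "nat hypergraph"
  assumes Q: "kgraph m Q" and J: "kgraph m J" "verts J \<noteq> {}" "c * real (card (verts J)) ^ m \<le> fact m * real (card (edges J))"
    and no: "\<not> hg_hom Q J" and c: "0 \<le> c" "c \<le> 1" and m: "0 < m" and D: "0 < D"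
    and d: "d < c - (2 ^ (l + m))\<^sup>2 / real D"
  shows "\<forall>\<^sub>F N in sequentially. adm (l + m) l N d (iterated_attach l Q D)"
proof -
  define p where "p = c - (2 ^ (l + m))\<^sup>2 / real D"
  have "0 \<le> (2 ^ (l + m))\<^sup>2 / real D" by simp
  then have p1: "p \<le> 1" using c unfolding p_def by linarith
  define \<epsilon> where "\<epsilon> = min 1 ((p - d) / 2)"
  have \<epsilon>: "0 < \<epsilon>" "\<epsilon> \<le> 1" "d < p - \<epsilon>" using d by (auto simp: \<epsilon>_def p_def min_def field_simps)
  show ?thesis
    using union_bound_tends_to_zero[OF \<epsilon>(1) m, of "1/2" l, simplified] eventually_density_slack[OF \<epsilon>(3), of m l]
  proof eventually_elim
    case (elim N)
    let ?\<Omega> = "PiE (governing_coords l N) (governing_values D J)"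
    have fin\<Omega>: "finite ?\<Omega>" by (rule governing_finite[OF kgraph_finite[OF J(1)]])
    have "governing_values D J i \<noteq> {}" for i using J(2) D by (auto simp: governing_values_def split: sum.split)
    then have ne\<Omega>: "?\<Omega> \<noteq> {}" by (simp add: PiE_eq_empty_iff)
    define bad where "bad = {\<omega> \<in> ?\<Omega>. \<exists>S \<subseteq> {..<N}. card S = l \<and>
      real (card {M. M \<subseteq> {..<N} - S \<and> card M = m \<and> governed l J (S \<union> M) \<omega>}) < (p - \<epsilon>) * real ((N - l) choose m)}"
    have "real (card bad) \<le> 1 / 2 * real (card ?\<Omega>)"
      unfolding bad_def
    proof (rule random_local_hypergraph[where supp = governing_support])
      fix e and \<omega> \<omega>' :: "governing_index \<Rightarrow> nat" assume "\<And>i. governing_support i \<subseteq> e \<Longrightarrow> \<omega> i = \<omega>' i"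
      then show "governed l J e \<omega> = governed l J e \<omega>'" by (rule governed_cong)
    next
      fix S M \<omega> assume SM: "S \<subseteq> {..<N}" "M \<subseteq> {..<N}" "S \<inter> M = {}" "card S = l" "card M = m"
      have fS: "finite S" and fM: "finite M" using SM(1,2) finite_subset[OF _ finite_lessThan] by blast+
      have "card (S \<union> M) = l + m" using card_Un_disjoint[OF fS fM SM(3)] SM(4,5) by simp
      then show "p * real (card ?\<Omega>) \<le> real (card {\<omega>' \<in> ?\<Omega>. governed l J (S \<union> M)
          (override_on \<omega> \<omega>' {i. governing_support i \<subseteq> S \<union> M \<and> \<not> governing_support i \<subseteq> S})})"
        unfolding p_def by (intro governed_probability) (use SM J c D in auto)
    qed (use fin\<Omega> ne\<Omega> m p1 \<epsilon> elim(1) in \<open>simp_all\<close>)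
    moreover have "0 < real (card ?\<Omega>)" using fin\<Omega> ne\<Omega> by (simp add: card_gt_0_iff)
    ultimately have "\<not> ?\<Omega> \<subseteq> bad" using card_mono[of bad ?\<Omega>] fin\<Omega> by (auto simp: bad_def)
    then obtain \<omega> where \<omega>: "\<omega> \<in> ?\<Omega>" "\<omega> \<notin> bad" by blast
    define G :: "nat hypergraph" where "G = ({..<N}, {e. e \<subseteq> {..<N} \<and> card e = l + m \<and> governed l J e \<omega>})"
    have G: "kgraph (l + m) G" "verts G = {..<N}" by (auto simp: G_def kgraph_def)
    have edgeG: "e \<subseteq> {..<N}" "card e = l + m" "governed l J e \<omega>" if "e \<in> edges G" for e
      using that by (simp_all add: G_def)
    have "ldense (l + m) l d G" unfolding ldense_def
    proof (intro allI impI)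
      fix S assume "S \<subseteq> verts G \<and> card S = l"
      then have S: "S \<subseteq> {..<N}" "card S = l" by (simp_all add: G(2))
      define Y where "Y = {M. M \<subseteq> {..<N} - S \<and> card M = m \<and> governed l J (S \<union> M) \<omega>}"
      have fS: "finite S" using S(1) finite_subset by blast
      have "S \<union> M \<in> edges G \<longleftrightarrow> governed l J (S \<union> M) \<omega>" if M: "M \<subseteq> {..<N} - S" "card M = m" for M
      proof -
        have "finite M" "S \<inter> M = {}" using M(1) finite_subset[OF M(1)] by auto
        then have "card (S \<union> M) = l + m" using card_Un_disjoint[OF fS] S(2) M(2) by simp
        then show ?thesis using M(1) S(1) by (auto simp: G_def)
      qed
      then have "{M. M \<subseteq> {..<N} - S \<and> card M = m \<and> S \<union> M \<in> edges G} = Y" unfolding Y_def by blast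
      then have deg: "hg_degree G S = card Y"
        using degree_eq_card_completions[OF G(1), of S l] S G(2) by simp
      have "(p - \<epsilon>) * real ((N - l) choose m) \<le> real (card Y)"
        using \<omega> S unfolding bad_def Y_def by (auto simp: not_less)
      then have "fact m * ((p - \<epsilon>) * real ((N - l) choose m)) \<le> fact m * real (card Y)"
        by (rule mult_left_mono) simp
      moreover have "(p - \<epsilon>) * (fact m * real ((N - l) choose m)) = fact m * ((p - \<epsilon>) * real ((N - l) choose m))"
        by (rule mult.left_commute)
      ultimately have "d * real N ^ m \<le> fact m * real (card Y)" using elim(2) by linarith
      then show "d * real (card (verts G)) ^ (l + m - l) \<le> fact (l + m - l) * real (hg_degree G S)"
        unfolding deg by (simp add: G(2))
    qed
    moreover have "\<not> hg_emb (iterated_attach l Q D) G"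
    proof (rule iterated_attach_not_emb[OF Q no, where level = "\<lambda>T. \<omega> (Inl T)" and colour = "\<lambda>T v. \<omega> (Inr (T, v))"])
      fix T assume T: "T \<subseteq> verts G" "card T = l"
      have "Inl T \<in> governing_coords l N" using T by (simp add: G(2) governing_coords_def)
      from PiE_mem[OF \<omega>(1) this] show "\<omega> (Inl T) < D" by (simp add: governing_values_def)
      fix v assume v: "v \<in> verts G - T"
      then have "Inr (T, v) \<in> governing_coords l N" using T by (auto simp: G(2) governing_coords_def)
      from PiE_mem[OF \<omega>(1) this] show "\<omega> (Inr (T, v)) \<in> verts J" by (simp add: governing_values_def)
    next
      fix e assume e: "e \<in> edges G"
      obtain T where T: "lowest l e \<omega> T" "(\<lambda>v. \<omega> (Inr (T, v))) ` (e - T) \<in> edges J"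
        using edgeG(3)[OF e] unfolding governed_def by blast
      then show inj: "inj_on (\<lambda>T. \<omega> (Inl T)) {T. T \<subseteq> e \<and> card T = l}" by (simp add: lowest_def)
      fix T' assume "T' \<subseteq> e" "card T' = l"
        "\<And>T''. T'' \<subseteq> e \<Longrightarrow> card T'' = l \<Longrightarrow> T'' \<noteq> T' \<Longrightarrow> \<omega> (Inl T') < \<omega> (Inl T'')"
      then have "lowest l e \<omega> T'" using inj unfolding lowest_def by blast
      then have "T' = T" using T(1) by (rule lowest_unique)
      then show "(\<lambda>v. \<omega> (Inr (T', v))) ` (e - T') \<in> edges J" using T(2) by simp
    qed
    ultimately show ?case unfolding adm_def using G by (intro exI[of _ G]) simp
  qed
qed

text \<open>Lower bounds on \<open>turan_density m 0 Q\<close> come from a single hypergraph without a homomorphism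
  from \<open>Q\<close>, and such a hypergraph serves as the pattern \<open>J\<close>.\<close>

lemma iterated_attach_density:
  assumes Q: "kgraph m (Q :: nat hypergraph)" "edges Q \<noteq> {}" and m: "0 < m"
  shows "turan_density (l + m) l (iterated_attach l Q (Suc D)) \<le> turan_density m 0 Q"
    "turan_density m 0 Q - (2 ^ (l + m))\<^sup>2 / real (Suc D) \<le> turan_density (l + m) l (iterated_attach l Q (Suc D))"
proof -
  let ?F = "iterated_attach l Q (Suc D)" and ?c = "turan_density m 0 Q"
  have F: "kgraph (l + m) ?F" "edges ?F \<noteq> {}" and l: "l < l + m"
    using iterated_attach_kgraph[OF Q(1)] iterated_attach_edges[OF Q(2)] m by auto
  show "turan_density (l + m) l ?F \<le> ?c"
  proof (rule dense_ge)
    fix d assume "?c < d"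
    then have "\<forall>\<^sub>F n in sequentially. \<not> adm (l + m) l n d ?F" by (rule iterated_attach_forced[OF Q m])
    then show "turan_density (l + m) l ?F \<le> d"
      by (intro density_le_if_eventually_not_adm[OF F l] eventually_frequently) auto
  qed
  show "?c - (2 ^ (l + m))\<^sup>2 / real (Suc D) \<le> turan_density (l + m) l ?F"
  proof (rule dense_le)
    fix d assume d: "d < ?c - (2 ^ (l + m))\<^sup>2 / real (Suc D)"
    show "d \<le> turan_density (l + m) l ?F"
    proof (cases "0 \<le> d")
      case False
      then show ?thesis using ex_ratio_tendsto_density(2)[OF F l] by linarith
    next
      case True
      define c where "c = (?c + (d + (2 ^ (l + m))\<^sup>2 / real (Suc D))) / 2"
      define K where "K = (2 ^ (l + m))\<^sup>2 / real (Suc D)"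
      have K: "d < ?c - K" using d by (simp only: K_def)
      have c: "c < ?c" using K unfolding c_def K_def[symmetric] by simp
      have "d < c - K" using K unfolding c_def K_def[symmetric] by (simp add: field_simps)
      then have c': "d < c - (2 ^ (l + m))\<^sup>2 / real (Suc D)" by (simp only: K_def)
      have "0 \<le> (2 ^ (l + m))\<^sup>2 / real (Suc D)" by simp
      then have c0: "0 \<le> c" using c' True by linarith
      have c1: "c \<le> 1" using c ex_ratio_tendsto_density(3)[OF Q m] by linarith
      have "\<forall>\<^sub>F n in sequentially. (\<exists>J :: nat hypergraph. kgraph m J \<and> verts J = {..<n} \<and> ldense m 0 c J \<and> \<not> hg_hom Q J) \<and> 0 < n"
        using hom_free_if_below_density[OF Q m c] eventually_gt_at_top[of 0] by eventually_elim blast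
      from eventually_happens'[OF sequentially_bot this]
      obtain n and J :: "nat hypergraph" where J: "kgraph m J" "verts J = {..<n}" "ldense m 0 c J" "\<not> hg_hom Q J" "0 < n"
        by blast
      have "c * real (card (verts J)) ^ m \<le> fact m * real (card (edges J))"
        using J(3)[unfolded ldense_def, rule_format, of "{}"] by (simp add: hg_degree_def)
      moreover have "verts J \<noteq> {}" using J(2,5) by auto
      ultimately have "\<forall>\<^sub>F N in sequentially. adm (l + m) l N d ?F"
        by (intro iterated_attach_adm[OF Q(1) J(1) _ _ J(4) c0 c1 m _ c']) auto
      then show ?thesis by (intro density_ge_if_frequently_adm[OF F l] eventually_frequently) auto
    qed
  qed
qed

lemma iterated_attach_tendsto:
  assumes "kgraph m (Q :: nat hypergraph)" "edges Q \<noteq> {}" "0 < m"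
  shows "(\<lambda>D. turan_density (l + m) l (iterated_attach l Q (Suc D))) \<longlonglongrightarrow> turan_density m 0 Q"
proof (rule tendsto_sandwich)
  have "(\<lambda>D. (2 ^ (l + m))\<^sup>2 / real (Suc D)) \<longlonglongrightarrow> 0" by (rule LIMSEQ_Suc[OF lim_const_over_n])
  from tendsto_diff[OF tendsto_const this]
  show "(\<lambda>D. turan_density m 0 Q - (2 ^ (l + m))\<^sup>2 / real (Suc D)) \<longlonglongrightarrow> turan_density m 0 Q" by simp
  show "\<forall>\<^sub>F D in sequentially. turan_density m 0 Q - (2 ^ (l + m))\<^sup>2 / real (Suc D) \<le> turan_density (l + m) l (iterated_attach l Q (Suc D))"
    by (rule always_eventually, rule allI, rule iterated_attach_density(2)[OF assms])
  show "\<forall>\<^sub>F D in sequentially. turan_density (l + m) l (iterated_attach l Q (Suc D)) \<le> turan_density m 0 Q"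
    by (rule always_eventually, rule allI, rule iterated_attach_density(1)[OF assms])
qed (rule tendsto_const)

text \<open>Each density \<open>\<alpha>\<close> near \<open>\<beta>\<close> is the limit of densities for larger edges, which end up closer to \<open>\<alpha>\<close>
  than \<open>\<beta>\<close> is.\<close>

theorem lift_accumulation:
  assumes m: "0 < m" and \<beta>: "\<beta> \<in> Acc (turan_spectrum m 0)"
  shows "\<beta> \<in> Acc (turan_spectrum (l + m) l)"
  unfolding Acc_iff
proof (intro allI impI)
  fix e :: real assume e: "0 < e"
  obtain \<alpha> where \<alpha>: "\<alpha> \<in> turan_spectrum m 0" "\<alpha> \<noteq> \<beta>" "\<bar>\<alpha> - \<beta>\<bar> < e" using \<beta> e unfolding Acc_iff by blast
  obtain Q :: "nat hypergraph" where Q: "kgraph m Q" "edges Q \<noteq> {}" "\<alpha> = turan_density m 0 Q"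
    using \<alpha>(1) unfolding turan_spectrum_def by blast
  let ?a = "\<lambda>D. turan_density (l + m) l (iterated_attach l Q (Suc D))"
  have "(?a \<longlongrightarrow> \<alpha>) sequentially" unfolding Q(3) by (rule iterated_attach_tendsto[OF Q(1,2) m])
  moreover have "0 < min \<bar>\<alpha> - \<beta>\<bar> (e - \<bar>\<alpha> - \<beta>\<bar>)" using \<alpha> by simp
  ultimately have "\<forall>\<^sub>F D in sequentially. dist (?a D) \<alpha> < min \<bar>\<alpha> - \<beta>\<bar> (e - \<bar>\<alpha> - \<beta>\<bar>)" by (rule tendstoD)
  from eventually_happens'[OF sequentially_bot this]
  obtain D where D: "\<bar>?a D - \<alpha>\<bar> < min \<bar>\<alpha> - \<beta>\<bar> (e - \<bar>\<alpha> - \<beta>\<bar>)" by (auto simp: dist_real_def)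
  then have "?a D \<noteq> \<beta>" "\<bar>?a D - \<beta>\<bar> < e" by (auto simp: abs_minus_commute)
  moreover have "?a D \<in> turan_spectrum (l + m) l"
    using iterated_attach_kgraph[OF Q(1)] iterated_attach_edges[OF Q(2)] by (rule density_in_spectrum)
  ultimately show "\<exists>a\<in>turan_spectrum (l + m) l. a \<noteq> \<beta> \<and> \<bar>a - \<beta>\<bar> < e" by blast
qed

section \<open>Turan densities and vertex degrees\<close>

lemma ldense_vertices_imp_ldense:
  assumes H: "kgraph k H" and k: "1 \<le> k" and dense: "ldense k 1 d H"
  shows "ldense k 0 d H"
  unfolding ldense_def
proof (intro allI impI)
  fix S assume "S \<subseteq> verts H \<and> card S = 0"
  then have S: "S = {}" using kgraph_finite[OF H] by (auto dest: finite_subset)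
  obtain j where j: "k = Suc j" using k by (cases k) auto
  let ?n = "real (card (verts H))"
  have "d * ?n ^ k = (\<Sum>v\<in>verts H. d * ?n ^ j)" by (simp add: j)
  also have "\<dots> \<le> (\<Sum>v\<in>verts H. fact j * real (hg_degree H (insert v {})))"
    using dense by (intro sum_mono) (auto simp: ldense_def j)
  also have "\<dots> = fact j * real (\<Sum>v\<in>verts H - {}. hg_degree H (insert v {}))"
    by (simp add: sum_distrib_left)
  also have "\<dots> = fact k * real (hg_degree H {})"
    by (subst sum_degrees_insert[OF H]) (simp_all add: j algebra_simps)
  finally show "d * ?n ^ (k - 0) \<le> fact (k - 0) * real (hg_degree H S)" by (simp add: S)
qed

text \<open>Deleting vertices of small degree one after the other: as long as the hypergraph has no copy
  of \<open>F\<close>, there is such a vertex.\<close>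

lemma edges_le_if_vertex_degrees_force:
  fixes F :: "'b hypergraph"
  assumes k: "1 \<le> k" and d: "0 \<le> d"
    and force: "\<And>n. n0 \<le> n \<Longrightarrow> \<not> adm k 1 n d F"
    and H: "kgraph k (H :: nat hypergraph)" "\<not> hg_emb F H"
  shows "fact k * real (card (edges H)) \<le> real n0 ^ k + d * (real (card (verts H)) + 1) ^ k"
  using H
proof (induction "card (verts H)" arbitrary: H rule: less_induct)
  case less
  let ?n = "card (verts H)"
  have fin: "finite (verts H)" "finite (edges H)" using less.prems(1) kgraph_finite kgraph_finite_edges by blast+
  show ?case
  proof (cases "n0 \<le> ?n")
    case False
    have "fact k * real (card (edges H)) \<le> real ?n ^ k"
      using degree_le[OF less.prems(1), of "{}" 0] by (simp add: hg_degree_def)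
    also have "\<dots> \<le> real n0 ^ k" using False by (intro power_mono) auto
    also have "\<dots> \<le> real n0 ^ k + d * (real ?n + 1) ^ k" using d by simp
    finally show ?thesis .
  next
    case True
    then have "\<not> ldense k 1 d H" using force[OF True] less.prems unfolding adm_def by blast
    then obtain S where S: "S \<subseteq> verts H" "card S = 1" "fact (k - 1) * real (hg_degree H S) < d * real ?n ^ (k - 1)"
      unfolding ldense_def by (auto simp: not_le)
    then obtain v where v: "S = {v}" using card_1_singletonE by blast
    define H' where "H' = (verts H - {v}, {e \<in> edges H. v \<notin> e})"
    have vH: "v \<in> verts H" using S(1) v by simp
    have H': "kgraph k H'" using less.prems(1) by (auto simp: H'_def kgraph_def)
    have "hg_emb H' H" unfolding hg_emb_def by (rule exI[of _ id]) (auto simp: H'_def)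
    then have no: "\<not> hg_emb F H'" using less.prems(2) emb_trans by blast
    have card': "card (verts H') = ?n - 1" "0 < ?n"
      using vH fin by (auto simp: H'_def card_gt_0_iff)
    then have card'': "real (card (verts H')) + 1 = real ?n" by simp
    have "card (verts H') < ?n" using card' by simp
    from less.hyps[OF this H' no]
    have IH: "fact k * real (card (edges H')) \<le> real n0 ^ k + d * real ?n ^ k" unfolding card'' .
    have "edges H = edges H' \<union> {e \<in> edges H. {v} \<subseteq> e}" by (auto simp: H'_def)
    then have "card (edges H) = card (edges H') + hg_degree H {v}"
      unfolding hg_degree_def
      by (subst card_Un_disjoint[symmetric]) (use fin in \<open>auto simp: H'_def\<close>)
    then have "fact k * real (card (edges H)) = fact k * real (card (edges H')) + real k * (fact (k - 1) * real (hg_degree H {v}))"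
      using k by (simp add: algebra_simps fact_reduce)
    also have "\<dots> \<le> (real n0 ^ k + d * real ?n ^ k) + real k * (d * real ?n ^ (k - 1))"
      using IH S(3) v by (intro add_mono mult_left_mono) auto
    also have "\<dots> = real n0 ^ k + d * (real ?n ^ k + real k * real ?n ^ (k - 1) * ((real ?n + 1) - real ?n))"
      by (simp add: algebra_simps)
    also have "\<dots> \<le> real n0 ^ k + d * (real ?n + 1) ^ k"
      using d by (intro add_left_mono mult_left_mono power_above_tangent) auto
    finally show ?thesis .
  qed
qed

lemma eventually_edges_slack:
  assumes "c < (d :: real)" "1 \<le> k"
  shows "\<forall>\<^sub>F n in sequentially. a + c * (real n + 1) ^ k < d * real n ^ k"
proof -
  have inv: "(\<lambda>n. 1 / real n) \<longlonglongrightarrow> 0" by (rule lim_const_over_n)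
  have "(\<lambda>n. a * (1 / real n) ^ k + c * (1 + 1 / real n) ^ k) \<longlonglongrightarrow> a * 0 ^ k + c * (1 + 0) ^ k"
    by (intro tendsto_intros inv)
  then have "(\<lambda>n. a * (1 / real n) ^ k + c * (1 + 1 / real n) ^ k) \<longlonglongrightarrow> c" using assms(2) by (simp add: power_0_left)
  from order_tendstoD(2)[OF this assms(1)] show ?thesis
    using eventually_gt_at_top[of 0]
  proof eventually_elim
    case (elim n)
    have "(a * (1 / real n) ^ k + c * (1 + 1 / real n) ^ k) * real n ^ k < d * real n ^ k"
      using elim by (intro mult_strict_right_mono) auto
    moreover have "(1 / real n) ^ k * real n ^ k = 1" "(1 + 1 / real n) ^ k * real n ^ k = (real n + 1) ^ k"
      using elim(2) by (simp_all add: power_mult_distrib[symmetric] algebra_simps)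
    ultimately show ?case by (simp add: distrib_right mult.assoc)
  qed
qed

text \<open>One inequality is averaging over the vertices, the other is the deletion of vertices.\<close>

theorem vertex_degree_density_eq:
  assumes F: "kgraph k (F :: nat hypergraph)" "edges F \<noteq> {}" and k: "1 < k"
  shows "turan_density k 0 F = turan_density k 1 F"
proof (rule antisym)
  have k0: "0 < k" using k by simp
  show "turan_density k 1 F \<le> turan_density k 0 F"
  proof (rule dense_ge)
    fix d assume "turan_density k 0 F < d"
    from emb_if_above_density[OF F k0 this]
    have "\<forall>\<^sub>F n in sequentially. \<not> adm k 1 n d F"
    proof eventually_elim
      case (elim n)
      then show ?case using ldense_vertices_imp_ldense k0 unfolding adm_def by (metis One_nat_def Suc_leI)
    qed
    then show "turan_density k 1 F \<le> d"
      by (intro density_le_if_eventually_not_adm[OF F k] eventually_frequently) auto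
  qed
  show "turan_density k 0 F \<le> turan_density k 1 F"
  proof (rule dense_ge)
    fix d assume d: "turan_density k 1 F < d"
    define c where "c = (turan_density k 1 F + d) / 2"
    have c: "turan_density k 1 F < c" "c < d" using d by (simp_all add: c_def)
    have c0: "0 \<le> c" using c(1) ex_ratio_tendsto_density(2)[OF F k] by linarith
    have "\<forall>\<^sub>F n in sequentially. \<not> adm k 1 n c F"
      using emb_if_above_density[OF F k c(1)] unfolding adm_def by eventually_elim blast
    then obtain n0 where n0: "\<And>n. n0 \<le> n \<Longrightarrow> \<not> adm k 1 n c F" unfolding eventually_sequentially by blast
    have "1 \<le> k" using k by simp
    from eventually_edges_slack[OF c(2) this, of "real n0 ^ k"]
    have "\<forall>\<^sub>F n in sequentially. \<not> adm k 0 n d F"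
    proof eventually_elim
      case (elim n)
      show ?case
      proof
        assume "adm k 0 n d F"
        then obtain H :: "nat hypergraph" where H: "kgraph k H" "card (verts H) = n" "ldense k 0 d H" "\<not> hg_emb F H"
          unfolding adm_def by blast
        have "d * real n ^ k \<le> fact k * real (card (edges H))"
          using H(3)[unfolded ldense_def, rule_format, of "{}"] H(2) by (simp add: hg_degree_def)
        also have "\<dots> \<le> real n0 ^ k + c * (real n + 1) ^ k"
          using edges_le_if_vertex_degrees_force[OF \<open>1 \<le> k\<close> c0 n0 H(1,4)] H(2) by simp
        finally show False using elim by simp
      qed
    qed
    then show "turan_density k 0 F \<le> d"
      by (intro density_le_if_eventually_not_adm[OF F k0] eventually_frequently) auto
  qed
qed

corollary vertex_degree_spectrum_eq:
  assumes "1 < k"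
  shows "turan_spectrum k 0 = turan_spectrum k 1"
  unfolding turan_spectrum_def using vertex_degree_density_eq[OF _ _ assms] by metis

section \<open>Three-uniform hypergraphs below one half\<close>

lemma sum_onto_sets:
  assumes "finite X" and P: "\<And>e. e \<in> P \<Longrightarrow> e \<subseteq> X \<and> card e = q"
  shows "(\<Sum>xs\<in>lists_over X q. of_bool (set xs \<in> P)) = fact q * real (card P)"
proof -
  have finP: "finite P" by (rule finite_subset[of _ "Pow X"]) (use assms in auto)
  have one: "card {xs \<in> lists_over X q. set xs = e} = fact q" if e: "e \<in> P" for e
  proof -
    have fine: "finite e" using P[OF e] assms(1) finite_subset by blast
    have "{xs \<in> lists_over X q. set xs = e} = {xs. length xs = q \<and> distinct xs \<and> set xs \<subseteq> e}"
    proof (intro set_eqI iffI)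
      fix xs assume "xs \<in> {xs \<in> lists_over X q. set xs = e}"
      then show "xs \<in> {xs. length xs = q \<and> distinct xs \<and> set xs \<subseteq> e}"
        using P[OF e] by (auto simp: lists_over_def intro: card_distinct)
    next
      fix xs assume xs: "xs \<in> {xs. length xs = q \<and> distinct xs \<and> set xs \<subseteq> e}"
      then have "set xs = e" using P[OF e] fine by (intro card_subset_eq) (auto simp: distinct_card)
      then show "xs \<in> {xs \<in> lists_over X q. set xs = e}" using xs P[OF e] by (simp add: lists_over_def)
    qed
    also have "card \<dots> = \<Prod>{card e - q + 1..card e}"
      using P[OF e] by (intro card_lists_distinct_length_eq fine) simp
    also have "\<dots> = fact q" using P[OF e] by (simp add: fact_prod)
    finally show ?thesis .
  qed
  have "(\<Sum>xs\<in>lists_over X q. of_bool (set xs \<in> P)) = real (card {xs \<in> lists_over X q. set xs \<in> P})"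
    using finite_lists_over[OF assms(1)] by (simp add: of_bool_def sum.If_cases Int_def)
  also have "{xs \<in> lists_over X q. set xs \<in> P} = (\<Union>e\<in>P. {xs \<in> lists_over X q. set xs = e})" by auto
  also have "card \<dots> = (\<Sum>e\<in>P. card {xs \<in> lists_over X q. set xs = e})"
    by (rule card_UN_disjoint) (use finP finite_lists_over[OF assms(1)] in auto)
  also have "\<dots> = card P * fact q" using one by simp
  finally show ?thesis by simp
qed

definition triangle :: "nat hypergraph" where
  "triangle = ({0, 1, 2}, {{0, 1}, {0, 2}, {1, 2}})"

lemma triangle_kgraph: "kgraph 2 triangle" "edges triangle \<noteq> {}"
  by (auto simp: triangle_def kgraph_def)

lemma hom_triangleI:
  assumes "x \<in> verts G" "y \<in> verts G" "z \<in> verts G" "{x, y} \<in> edges G" "{x, z} \<in> edges G" "{y, z} \<in> edges G"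
  shows "hg_hom triangle G"
  unfolding hg_hom_def
  by (rule exI[of _ "\<lambda>i. if i = 0 then x else if i = 1 then y else z"]) (use assms in \<open>auto simp: triangle_def insert_commute\<close>)

text \<open>Adjacent vertices of a triangle-free graph have disjoint neighbourhoods; summing over all
  edges bounds the sum of the squares of the degrees.\<close>

lemma triangle_free_degree_squares:
  fixes g :: "'a \<Rightarrow> 'a \<Rightarrow> bool"
  assumes sym: "\<And>v w. v \<in> V \<Longrightarrow> w \<in> V \<Longrightarrow> g v w = g w v"
    and free: "\<And>v w x. v \<in> V \<Longrightarrow> w \<in> V \<Longrightarrow> x \<in> V \<Longrightarrow> g v w \<Longrightarrow> g v x \<Longrightarrow> \<not> g w x"
  shows "2 * (\<Sum>v\<in>V. (\<Sum>w\<in>V. of_bool (g v w))\<^sup>2) \<le> real (card V) * (\<Sum>v\<in>V. \<Sum>w\<in>V. of_bool (g v w))"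
proof -
  define h :: "'a \<Rightarrow> 'a \<Rightarrow> real" where "h v w = of_bool (g v w)" for v w
  define dg where "dg v = (\<Sum>w\<in>V. h v w)" for v
  have sq: "(\<Sum>v\<in>V. \<Sum>w\<in>V. h v w * dg v) = (\<Sum>v\<in>V. (dg v)\<^sup>2)"
    by (simp add: sum_distrib_right[symmetric] dg_def[symmetric] power2_eq_square)
  have "(\<Sum>v\<in>V. \<Sum>w\<in>V. h v w * dg w) = (\<Sum>w\<in>V. \<Sum>v\<in>V. h v w * dg w)" by (rule sum.swap)
  also have "\<dots> = (\<Sum>w\<in>V. \<Sum>v\<in>V. h w v * dg w)"
    by (intro sum.cong refl) (simp add: h_def sym)
  finally have sq': "(\<Sum>v\<in>V. \<Sum>w\<in>V. h v w * dg w) = (\<Sum>v\<in>V. (dg v)\<^sup>2)" using sq by simp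
  have "h v w * (dg v + dg w) \<le> real (card V) * h v w" if vw: "v \<in> V" "w \<in> V" for v w
  proof (cases "g v w")
    case True
    have "h v x + h w x \<le> 1" if "x \<in> V" for x using free[OF vw that True] by (auto simp: h_def)
    then have "(\<Sum>x\<in>V. h v x + h w x) \<le> (\<Sum>x\<in>V. 1)" by (rule sum_mono)
    then show ?thesis using True by (simp add: h_def dg_def sum.distrib)
  qed (simp add: h_def)
  then have "(\<Sum>v\<in>V. \<Sum>w\<in>V. h v w * (dg v + dg w)) \<le> (\<Sum>v\<in>V. \<Sum>w\<in>V. real (card V) * h v w)"
    by (intro sum_mono)
  then show ?thesis using sq sq' by (simp add: distrib_left sum.distrib sum_distrib_left[symmetric] h_def dg_def)
qed

text \<open>Mantel's bound: the sum of the squares of the degrees is at least the square of their sum divided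
  by the number of vertices.\<close>

lemma triangle_density_le_half: "turan_density 2 0 triangle \<le> 1 / 2"
proof (rule density_le_if_hom_forced'[OF triangle_kgraph])
  fix c :: real assume c: "1 / 2 < c"
  show "\<forall>\<^sub>F N in sequentially. \<forall>H :: nat hypergraph. kgraph 2 H \<and> verts H = {..<N} \<and> ldense 2 0 c H \<longrightarrow> hg_hom triangle H"
    using eventually_gt_at_top[of 0]
  proof eventually_elim
    case (elim N)
    show ?case
    proof (intro allI impI, elim conjE, rule ccontr)
      fix H :: "nat hypergraph" assume H: "kgraph 2 H" "verts H = {..<N}" "ldense 2 0 c H" "\<not> hg_hom triangle H"
      define s :: real where "s = (\<Sum>v<N. \<Sum>w<N. of_bool ({v, w} \<in> edges H))"
      have "s = (\<Sum>xs\<in>lists_over {..<N} (Suc (Suc 0)). of_bool (set xs \<in> edges H))"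
        unfolding sum_lists_over_Suc s_def by (simp add: lists_over_0)
      also have "\<dots> = fact (Suc (Suc 0)) * real (card (edges H))"
        by (rule sum_onto_sets) (use kgraph_edge[OF H(1)] H(2) in \<open>auto simp: numeral_2_eq_2\<close>)
      finally have "c * real N ^ 2 \<le> s"
        using H(3)[unfolded ldense_def, rule_format, of "{}"] H(2) by (simp add: hg_degree_def)
      moreover have "1 / 2 * real N ^ 2 < c * real N ^ 2" using c elim by simp
      ultimately have s: "real N ^ 2 < 2 * s" by linarith
      define q :: real where "q = (\<Sum>v<N. (\<Sum>w<N. of_bool ({v, w} \<in> edges H))\<^sup>2)"
      have "2 * q \<le> real (card {..<N}) * s"
        unfolding s_def q_def
      proof (rule triangle_free_degree_squares)
        fix v w x assume "v \<in> {..<N}" "w \<in> {..<N}" "x \<in> {..<N}" "{v, w} \<in> edges H" "{v, x} \<in> edges H"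
        then show "{w, x} \<notin> edges H" using hom_triangleI[of v H w x] H(2,4) by auto
      qed (simp add: insert_commute)
      then have q: "2 * q \<le> real N * s" by simp
      have "(s / real (card {..<N})) ^ 2 \<le> q / real (card {..<N})"
        unfolding s_def q_def by (rule power_of_mean_le) (use elim in \<open>auto intro!: sum_nonneg\<close>)
      then have "s * s \<le> real N * q" using elim by (simp add: field_simps power2_eq_square)
      also have "\<dots> \<le> real N * (real N * s / 2)" using q by (intro mult_left_mono) auto
      finally have "2 * s * s \<le> real N ^ 2 * s" by (simp add: power2_eq_square)
      moreover have "0 < s" using s zero_le_power2[of "real N"] by linarith
      ultimately show False using s by (simp add: mult_le_cancel_right)
    qed
  qed
qed simp

lemma card_3_sum:
  assumes "finite X" "\<And>e. e \<in> P \<Longrightarrow> e \<subseteq> X \<and> card e = 3"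
  shows "(\<Sum>u\<in>X. \<Sum>v\<in>X. \<Sum>w\<in>X. of_bool ({u, v, w} \<in> P)) = 6 * real (card P)"
proof -
  have "(\<Sum>u\<in>X. \<Sum>v\<in>X. \<Sum>w\<in>X. of_bool ({u, v, w} \<in> P)) = (\<Sum>xs\<in>lists_over X (Suc (Suc (Suc 0))). (of_bool (set xs \<in> P) :: real))"
    unfolding sum_lists_over_Suc by (simp add: lists_over_0)
  also have "\<dots> = fact (Suc (Suc (Suc 0))) * real (card P)"
    by (rule sum_onto_sets) (use assms in \<open>auto simp: numeral_3_eq_3\<close>)
  finally show ?thesis by simp
qed

lemma codegree_sum:
  assumes H: "kgraph 3 H" and u: "u \<in> verts H"
  shows "(\<Sum>v\<in>verts H. \<Sum>w\<in>verts H. of_bool ({u, v, w} \<in> edges H)) = 2 * real (hg_degree H {u})"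
proof -
  define P where "P = {M. M \<subseteq> verts H - {u} \<and> card M = 2 \<and> {u} \<union> M \<in> edges H}"
  have "{u, v, w} \<in> edges H \<longleftrightarrow> {v, w} \<in> P" if "v \<in> verts H" "w \<in> verts H" for v w
  proof
    assume e: "{u, v, w} \<in> edges H"
    then have "card {u, v, w} = 3" using kgraph_edge[OF H] by blast
    then have "u \<noteq> v" "u \<noteq> w" "v \<noteq> w" by (auto simp: card_insert_if split: if_splits)
    then show "{v, w} \<in> P" using e that by (simp add: P_def)
  qed (simp add: P_def)
  then have "(\<Sum>v\<in>verts H. \<Sum>w\<in>verts H. of_bool ({u, v, w} \<in> edges H))
      = (\<Sum>v\<in>verts H. \<Sum>w\<in>verts H. (of_bool ({v, w} \<in> P) :: real))"
    by (intro sum.cong refl) simp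
  also have "\<dots> = (\<Sum>xs\<in>lists_over (verts H) (Suc (Suc 0)). of_bool (set xs \<in> P))"
    unfolding sum_lists_over_Suc by (simp add: lists_over_0)
  also have "\<dots> = fact (Suc (Suc 0)) * real (card P)"
    by (rule sum_onto_sets) (auto simp: P_def numeral_2_eq_2 kgraph_finite[OF H])
  also have "card P = hg_degree H {u}"
    unfolding P_def using degree_eq_card_completions[OF H, of "{u}" 1] u by simp
  finally show ?thesis by simp
qed

text \<open>A triangle-free link of density close to \<open>1 / 2\<close> is nearly regular. If \<open>u\<close>, \<open>v\<close>, \<open>w\<close> form an edge and
  all have triangle-free links, then the three common neighbourhoods are disjoint, so their codegrees
  cannot all be near \<open>n / 2\<close>. Thus the set \<open>B\<close> of such vertices spans few edges, while the pairs
  meeting \<open>B\<close> have codegree near \<open>n / 2\<close>. Counting edges by their intersection with \<open>B\<close> shows that the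
  rest would have to be denser than \<open>1 / 2\<close> unless \<open>B\<close> is small.\<close>

lemma few_triangle_free_links:
  fixes H :: "'a hypergraph"
  assumes H: "kgraph 3 H" and dense: "ldense 3 1 (1 / 2 - \<tau>\<^sup>2) H" and \<tau>: "0 < \<tau>" "\<tau> \<le> 1"
    and n: "n = real (card (verts H))" "0 < n"
    and B: "B \<subseteq> verts H" "\<And>u. u \<in> B \<Longrightarrow> \<not> hg_hom triangle (link 2 H {u})"
    and rest: "6 * real (card {e \<in> edges H. e \<subseteq> verts H - B}) \<le> (1 / 2 + \<tau>) * real (card (verts H - B)) ^ 3 + \<tau> * n ^ 3"
  shows "real (card B) ^ 3 \<le> 48 * \<tau> * n ^ 3"
proof -
  let ?V = "verts H" and ?A = "verts H - B"
  have fin: "finite ?V" "finite B" "finite ?A" using kgraph_finite[OF H] B(1) finite_subset by auto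
  define h :: "'a \<Rightarrow> 'a \<Rightarrow> 'a \<Rightarrow> real" where "h u v w = of_bool ({u, v, w} \<in> edges H)" for u v w
  have h_perm: "h u v w = h v u w" "h u v w = h u w v" for u v w
    by (simp_all add: h_def insert_commute)
  define c where "c u v = (\<Sum>w\<in>?V. h u v w)" for u v
  have c_sym: "c u v = c v u" for u v unfolding c_def by (rule sum.cong) (simp_all add: h_perm(1))
  define g where "g u v = (c u v - n / 2)\<^sup>2" for u v
  have degree: "(1 / 2 - \<tau>\<^sup>2) * n\<^sup>2 \<le> (\<Sum>v\<in>?V. c u v)" if u: "u \<in> ?V" for u
  proof -
    have "(1 / 2 - \<tau>\<^sup>2) * n\<^sup>2 \<le> 2 * real (hg_degree H {u})"
      using dense[unfolded ldense_def, rule_format, of "{u}"] u by (simp add: n)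
    then show ?thesis using codegree_sum[OF H u] by (simp add: c_def h_def)
  qed
  have no_triangle: "\<not> {u, w, x} \<in> edges H"
    if u: "u \<in> B" and vwx: "v \<in> ?V" "w \<in> ?V" "x \<in> ?V" and e: "{u, v, w} \<in> edges H" "{u, v, x} \<in> edges H" for u v w x
  proof
    assume e': "{u, w, x} \<in> edges H"
    have pair: "{y, z} \<in> edges (link 2 H {u})" if "{u, y, z} \<in> edges H" for y z
    proof -
      have "card {u, y, z} = 3" "{u, y, z} \<subseteq> ?V" using that kgraph_edge[OF H] by blast+
      then show ?thesis using that by (auto simp: link_def card_insert_if split: if_splits)
    qed
    have "hg_hom triangle (link 2 H {u})"
      by (rule hom_triangleI[of v _ w x]) (use vwx pair e e' in \<open>simp_all add: link_def\<close>)
    then show False using B(2)[OF u] by simp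
  qed
  have variance: "(\<Sum>v\<in>?V. g u v) \<le> \<tau>\<^sup>2 * n ^ 3 / 2" if u: "u \<in> B" for u
  proof -
    have "2 * (\<Sum>v\<in>?V. (c u v)\<^sup>2) \<le> real (card ?V) * (\<Sum>v\<in>?V. c u v)"
      unfolding c_def h_def
    proof (rule triangle_free_degree_squares)
      fix v w x assume "v \<in> ?V" "w \<in> ?V" "x \<in> ?V" "{u, v, w} \<in> edges H" "{u, v, x} \<in> edges H"
      then show "{u, w, x} \<notin> edges H" by (rule no_triangle[OF u])
    qed (simp add: insert_commute)
    then have "2 * (\<Sum>v\<in>?V. (c u v)\<^sup>2) \<le> n * (\<Sum>v\<in>?V. c u v)" by (simp only: n)
    moreover have "(\<Sum>v\<in>?V. g u v) = (\<Sum>v\<in>?V. (c u v)\<^sup>2) - n * (\<Sum>v\<in>?V. c u v) + n ^ 3 / 4"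
    proof -
      have "(\<Sum>v\<in>?V. g u v) = (\<Sum>v\<in>?V. (c u v)\<^sup>2 - n * c u v + n\<^sup>2 / 4)"
        by (rule sum.cong) (simp_all add: g_def power2_eq_square field_simps)
      also have "\<dots> = (\<Sum>v\<in>?V. (c u v)\<^sup>2) - n * (\<Sum>v\<in>?V. c u v) + real (card ?V) * (n\<^sup>2 / 4)"
        by (simp add: sum.distrib sum_subtractf sum_distrib_left)
      finally show ?thesis by (simp add: n power2_eq_square power3_eq_cube)
    qed
    moreover have "n * ((1 / 2 - \<tau>\<^sup>2) * n\<^sup>2) \<le> n * (\<Sum>v\<in>?V. c u v)"
      using degree[of u] u B(1) n(2) by (intro mult_left_mono) auto
    then have "n ^ 3 / 2 - \<tau>\<^sup>2 * n ^ 3 \<le> n * (\<Sum>v\<in>?V. c u v)" by (simp add: algebra_simps power2_eq_square power3_eq_cube)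
    ultimately show ?thesis by simp
  qed
  have deviation: "\<bar>(\<Sum>v\<in>X. c u v) - real (card X) * (n / 2)\<bar> \<le> \<tau> * n\<^sup>2" if u: "u \<in> B" and X: "X \<subseteq> ?V" for u X
  proof -
    have "(\<Sum>v\<in>X. c u v) - real (card X) * (n / 2) = (\<Sum>v\<in>X. c u v - n / 2)" by (simp add: sum_subtractf)
    also have "\<bar>\<dots>\<bar> \<le> (\<Sum>v\<in>X. \<bar>c u v - n / 2\<bar>)" by (rule sum_abs)
    also have "\<dots> \<le> (\<Sum>v\<in>?V. \<bar>c u v - n / 2\<bar>)" by (rule sum_mono2[OF fin(1) X]) simp
    finally have 1: "\<bar>(\<Sum>v\<in>X. c u v) - real (card X) * (n / 2)\<bar> \<le> (\<Sum>v\<in>?V. \<bar>c u v - n / 2\<bar>)" .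
    have "2 * \<tau> * n * (\<Sum>v\<in>?V. \<bar>c u v - n / 2\<bar>) = (\<Sum>v\<in>?V. 2 * \<tau> * n * \<bar>c u v - n / 2\<bar>)" by (rule sum_distrib_left)
    also have "\<dots> \<le> (\<Sum>v\<in>?V. g u v + (\<tau> * n)\<^sup>2)"
    proof (rule sum_mono)
      fix v
      have "0 \<le> (\<bar>c u v - n / 2\<bar> - \<tau> * n)\<^sup>2" by simp
      also have "\<dots> = \<bar>c u v - n / 2\<bar>\<^sup>2 + (\<tau> * n)\<^sup>2 - 2 * \<bar>c u v - n / 2\<bar> * (\<tau> * n)" by (rule power2_diff)
      finally show "2 * \<tau> * n * \<bar>c u v - n / 2\<bar> \<le> g u v + (\<tau> * n)\<^sup>2" by (simp add: g_def mult_ac)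
    qed
    also have "\<dots> = (\<Sum>v\<in>?V. g u v) + n * (\<tau> * n)\<^sup>2" by (simp add: sum.distrib n)
    also have "\<dots> \<le> \<tau>\<^sup>2 * n ^ 3 / 2 + n * (\<tau> * n)\<^sup>2" using variance[OF u] by simp
    also have "\<dots> = 2 * \<tau> * n * (3 / 4 * \<tau> * n\<^sup>2)" by (simp add: power2_eq_square power3_eq_cube)
    finally have "(\<Sum>v\<in>?V. \<bar>c u v - n / 2\<bar>) \<le> 3 / 4 * \<tau> * n\<^sup>2" using \<tau> n by simp
    also have "\<dots> \<le> \<tau> * n\<^sup>2" using \<tau> by simp
    finally show ?thesis using 1 by linarith
  qed
  define T where "T X Y Z = (\<Sum>u\<in>X. \<Sum>v\<in>Y. \<Sum>w\<in>Z. h u v w)" for X Y Z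
  have T_swap12: "T X Y Z = T Y X Z" for X Y Z
  proof -
    have "T X Y Z = (\<Sum>v\<in>Y. \<Sum>u\<in>X. \<Sum>w\<in>Z. h u v w)" unfolding T_def by (rule sum.swap)
    then show ?thesis unfolding T_def by (simp only: h_perm(1))
  qed
  have T_swap23: "T X Y Z = T X Z Y" for X Y Z
  proof -
    have "(\<Sum>v\<in>Y. \<Sum>w\<in>Z. h u v w) = (\<Sum>w\<in>Z. \<Sum>v\<in>Y. h u v w)" for u by (rule sum.swap)
    then have "(\<Sum>v\<in>Y. \<Sum>w\<in>Z. h u v w) = (\<Sum>w\<in>Z. \<Sum>v\<in>Y. h u w v)" for u by (simp only: h_perm(2))
    then show ?thesis by (simp only: T_def)
  qed
  have T_split: "T ?V Y Z = T ?A Y Z + T B Y Z" for Y Z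
    unfolding T_def using sum.subset_diff[OF B(1) fin(1)] by simp
  have V_split: "T X ?V Z = T X ?A Z + T X B Z" "T X Y ?V = T X Y ?A + T X Y B" for X Y Z
    using T_split T_swap12 T_swap23 by metis+
  have decomposition: "T ?A ?V ?V = T ?A ?A ?A + 2 * T B ?A ?V - T B B ?V + T B B B"
  proof -
    have "T ?A ?V ?V = T ?A ?A ?A + T ?A ?A B + T ?A B ?V" by (simp add: V_split)
    moreover have "T ?A B ?V = T B ?A ?V" by (rule T_swap12)
    moreover have "T ?A ?A B = T B ?A ?A" by (metis T_swap12 T_swap23)
    moreover have "T B ?A ?V = T B ?A ?A + T B ?A B" by (rule V_split)
    moreover have "T B ?A B = T B B ?A" by (rule T_swap23)
    moreover have "T B B ?V = T B B ?A + T B B B" by (rule V_split)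
    ultimately show ?thesis by simp
  qed
  define x where "x = real (card B)"
  have xn: "0 \<le> x" "x \<le> n" using card_mono[OF fin(1) B(1)] by (simp_all add: x_def n)
  have a: "real (card ?A) = n - x"
    using card_Diff_subset[OF fin(2) B(1)] card_mono[OF fin(1) B(1)] by (simp add: n x_def of_nat_diff)
  have AVV: "(n - x) * ((1 / 2 - \<tau>\<^sup>2) * n\<^sup>2) \<le> T ?A ?V ?V"
  proof -
    have "(\<Sum>u\<in>?A. (1 / 2 - \<tau>\<^sup>2) * n\<^sup>2) \<le> (\<Sum>u\<in>?A. \<Sum>v\<in>?V. c u v)" by (rule sum_mono) (simp add: degree)
    then show ?thesis by (simp add: T_def c_def a)
  qed
  have AAA: "T ?A ?A ?A \<le> (1 / 2 + \<tau>) * (n - x) ^ 3 + \<tau> * n ^ 3"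
  proof -
    have "T ?A ?A ?A = (\<Sum>u\<in>?A. \<Sum>v\<in>?A. \<Sum>w\<in>?A. of_bool ({u, v, w} \<in> {e \<in> edges H. e \<subseteq> ?A}))"
      unfolding T_def h_def by (intro sum.cong refl) auto
    also have "\<dots> = 6 * real (card {e \<in> edges H. e \<subseteq> ?A})"
      by (rule card_3_sum[OF fin(3)]) (use kgraph_edge[OF H] in auto)
    finally show ?thesis using rest a by simp
  qed
  have BAV: "T B ?A ?V \<le> x * ((n - x) * (n / 2) + \<tau> * n\<^sup>2)"
  proof -
    have "T B ?A ?V \<le> (\<Sum>u\<in>B. (n - x) * (n / 2) + \<tau> * n\<^sup>2)"
      unfolding T_def c_def[symmetric]
      by (rule sum_mono) (use deviation[of _ ?A] a in \<open>force simp: abs_le_iff\<close>)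
    then show ?thesis by (simp add: x_def)
  qed
  have BBV: "x * (x * (n / 2) - \<tau> * n\<^sup>2) \<le> T B B ?V"
  proof -
    have "(\<Sum>u\<in>B. x * (n / 2) - \<tau> * n\<^sup>2) \<le> T B B ?V"
      unfolding T_def c_def[symmetric]
      by (rule sum_mono) (use deviation[OF _ B(1)] in \<open>force simp: abs_le_iff x_def\<close>)
    then show ?thesis by (simp add: x_def)
  qed
  have BBB: "T B B B \<le> 18 * \<tau>\<^sup>2 * x\<^sup>2 * n"
  proof -
    have gB: "(\<Sum>v\<in>B. g u v) \<le> \<tau>\<^sup>2 * n ^ 3 / 2" if "u \<in> B" for u
    proof -
      have "(\<Sum>v\<in>B. g u v) \<le> (\<Sum>v\<in>?V. g u v)" by (rule sum_mono2[OF fin(1) B(1)]) (simp add: g_def)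
      then show ?thesis using variance[OF that] by simp
    qed
    have "(\<Sum>u\<in>B. \<Sum>v\<in>B. g u v) \<le> (\<Sum>u\<in>B. \<tau>\<^sup>2 * n ^ 3 / 2)" by (rule sum_mono) (rule gB)
    then have gBB: "(\<Sum>u\<in>B. \<Sum>v\<in>B. g u v) \<le> x * (\<tau>\<^sup>2 * n ^ 3 / 2)" by (simp add: x_def)
    \<comment> \<open>Along an edge inside \<open>B\<close> the three codegrees sum to at most \<open>n\<close>, so they deviate from \<open>n / 2\<close> by
      \<open>n / 2\<close> in total.\<close>
    have "n\<^sup>2 / 12 * h u v w \<le> g u v + g u w + g v w" if uvw: "u \<in> B" "v \<in> B" "w \<in> B" for u v w
    proof (cases "{u, v, w} \<in> edges H")
      case True
      have V: "u \<in> ?V" "v \<in> ?V" "w \<in> ?V" using uvw B(1) by auto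
      have "h u v y + h u w y + h v w y \<le> 1" if y: "y \<in> ?V" for y
      proof -
        have "\<not> ({u, v, y} \<in> edges H \<and> {u, w, y} \<in> edges H)"
          using no_triangle[OF uvw(1) V(2,3) y True] by blast
        moreover have "\<not> ({u, v, y} \<in> edges H \<and> {v, w, y} \<in> edges H)"
          using no_triangle[OF uvw(2) V(1,3) y] True by (metis insert_commute)
        moreover have "\<not> ({u, w, y} \<in> edges H \<and> {v, w, y} \<in> edges H)"
          using no_triangle[OF uvw(3) V(1,2) y] True by (metis insert_commute)
        ultimately show ?thesis by (auto simp: h_def)
      qed
      then have "(\<Sum>y\<in>?V. h u v y + h u w y + h v w y) \<le> (\<Sum>y\<in>?V. 1)" by (rule sum_mono)
      then have sum: "c u v + c u w + c v w \<le> n" by (simp add: c_def sum.distrib n)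
      define p q r where "p = n / 2 - c u v" and "q = n / 2 - c u w" and "r = n / 2 - c v w"
      have "n / 2 \<le> p + q + r" using sum by (simp add: p_def q_def r_def)
      then have "(n / 2)\<^sup>2 \<le> (p + q + r)\<^sup>2" using n by (intro power_mono) auto
      also have "\<dots> \<le> 3 * (p\<^sup>2 + q\<^sup>2 + r\<^sup>2)"
      proof -
        have "3 * (p\<^sup>2 + q\<^sup>2 + r\<^sup>2) - (p + q + r)\<^sup>2 = (p - q)\<^sup>2 + (p - r)\<^sup>2 + (q - r)\<^sup>2"
          by (simp add: power2_eq_square algebra_simps)
        then show ?thesis by (smt (verit) zero_le_power2)
      qed
      finally have "n\<^sup>2 / 12 \<le> p\<^sup>2 + q\<^sup>2 + r\<^sup>2" by (simp add: power_divide)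
      then show ?thesis using True by (simp add: h_def g_def p_def q_def r_def power2_commute)
    qed (simp add: h_def g_def)
    then have "(\<Sum>u\<in>B. \<Sum>v\<in>B. \<Sum>w\<in>B. n\<^sup>2 / 12 * h u v w) \<le> (\<Sum>u\<in>B. \<Sum>v\<in>B. \<Sum>w\<in>B. g u v + g u w + g v w)"
      by (intro sum_mono)
    also have "(\<Sum>u\<in>B. \<Sum>v\<in>B. \<Sum>w\<in>B. g u v + g u w + g v w) = 3 * (x * (\<Sum>u\<in>B. \<Sum>v\<in>B. g u v))"
    proof -
      have "(\<Sum>u\<in>B. \<Sum>v\<in>B. \<Sum>w\<in>B. g u v) = x * (\<Sum>u\<in>B. \<Sum>v\<in>B. g u v)"
        by (simp add: x_def sum_distrib_left)
      moreover have "(\<Sum>u\<in>B. \<Sum>v\<in>B. \<Sum>w\<in>B. g u w) = x * (\<Sum>u\<in>B. \<Sum>v\<in>B. g u v)"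
        by (simp add: x_def sum_distrib_left)
      moreover have "(\<Sum>u\<in>B. \<Sum>v\<in>B. \<Sum>w\<in>B. g v w) = x * (\<Sum>u\<in>B. \<Sum>v\<in>B. g u v)"
        by (simp add: x_def)
      ultimately show ?thesis by (simp add: sum.distrib)
    qed
    also have "\<dots> \<le> 3 * (x * (x * (\<tau>\<^sup>2 * n ^ 3 / 2)))" using gBB xn by (intro mult_left_mono) auto
    also have "(\<Sum>u\<in>B. \<Sum>v\<in>B. \<Sum>w\<in>B. n\<^sup>2 / 12 * h u v w) = n\<^sup>2 / 12 * T B B B"
      unfolding T_def sum_distrib_left by (rule refl)
    also have "3 * (x * (x * (\<tau>\<^sup>2 * n ^ 3 / 2))) = n\<^sup>2 / 12 * (18 * \<tau>\<^sup>2 * x\<^sup>2 * n)"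
      by (simp add: power2_eq_square power3_eq_cube)
    finally have "n\<^sup>2 / 12 * T B B B \<le> n\<^sup>2 / 12 * (18 * \<tau>\<^sup>2 * x\<^sup>2 * n)" .
    moreover have "0 < n\<^sup>2 / 12" using n(2) by simp
    ultimately show ?thesis by (simp only: mult_le_cancel_left_pos)
  qed
  have main: "(n - x) * ((1 / 2 - \<tau>\<^sup>2) * n\<^sup>2) \<le> (1 / 2 + \<tau>) * (n - x) ^ 3 + \<tau> * n ^ 3
      + 2 * (x * ((n - x) * (n / 2) + \<tau> * n\<^sup>2)) - x * (x * (n / 2) - \<tau> * n\<^sup>2) + 18 * \<tau>\<^sup>2 * x\<^sup>2 * n"
    using AVV AAA BAV BBV BBB decomposition by linarith
  have "(1 / 2 + \<tau>) * (n - x) ^ 3 + \<tau> * n ^ 3 + 2 * (x * ((n - x) * (n / 2) + \<tau> * n\<^sup>2))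
      - x * (x * (n / 2) - \<tau> * n\<^sup>2) + 18 * \<tau>\<^sup>2 * x\<^sup>2 * n - (n - x) * ((1 / 2 - \<tau>\<^sup>2) * n\<^sup>2)
      = \<tau> * ((n - x) ^ 3 + n ^ 3 + 3 * (x * n\<^sup>2) + \<tau> * (18 * x\<^sup>2 * n) + \<tau> * ((n - x) * n\<^sup>2)) - x ^ 3 / 2"
    by (simp add: power2_eq_square power3_eq_cube field_simps)
  with main have "x ^ 3 / 2 \<le> \<tau> * ((n - x) ^ 3 + n ^ 3 + 3 * (x * n\<^sup>2) + \<tau> * (18 * x\<^sup>2 * n) + \<tau> * ((n - x) * n\<^sup>2))"
    by linarith
  also have "\<dots> \<le> \<tau> * (n ^ 3 + n ^ 3 + 3 * (n * n\<^sup>2) + 1 * (18 * n\<^sup>2 * n) + 1 * (n * n\<^sup>2))"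
    using \<tau> xn n by (intro mult_left_mono add_mono mult_mono power_mono) auto
  also have "\<dots> = 24 * \<tau> * n ^ 3" by (simp add: power2_eq_square power3_eq_cube)
  finally show ?thesis by (simp add: x_def)
qed

text \<open>If few vertices have a triangle-free link, then the other vertices span a hypergraph that is dense
  enough to contain \<open>F\<close>, and each of them has a triangle in its link. The set of exceptional vertices
  is small by \<open>few_triangle_free_links\<close>, since a hypergraph without the larger configuration has edge
  density at most about \<open>1 / 2\<close>.\<close>

lemma attach_triangle_below_half:
  fixes F :: "nat hypergraph"
  assumes F: "kgraph 3 F" and above: "\<And>d. 1 / 2 < d \<Longrightarrow> \<forall>\<^sub>F n in sequentially. \<not> adm 3 1 n d (attach 1 triangle F)"
    and below: "0 < \<epsilon>" "\<forall>\<^sub>F n in sequentially. \<not> adm 3 1 n (1 / 2 - \<epsilon>) F"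
  shows "\<exists>\<delta>>0. \<forall>\<^sub>F n in sequentially. \<not> adm 3 1 n (1 / 2 - \<delta>) (attach 1 triangle F)"
proof -
  let ?F' = "attach 1 triangle F"
  define \<epsilon>' where "\<epsilon>' = min \<epsilon> 1"
  define \<beta> where "\<beta> = \<epsilon>' / 4"
  have \<beta>: "0 < \<beta>" "\<beta> \<le> 1 / 4" using below(1) by (simp_all add: \<beta>_def \<epsilon>'_def)
  \<comment> \<open>With this \<open>\<tau>\<close> the conclusion of \<open>few_triangle_free_links\<close> says that \<open>card B \<le> \<beta> * n\<close>.\<close>
  define \<tau> where "\<tau> = \<beta> ^ 3 / 48"
  have "\<beta> ^ 3 \<le> \<beta> ^ 1" using \<beta> by (intro power_decreasing) auto
  then have \<tau>: "0 < \<tau>" "\<tau> \<le> \<beta>" "\<tau> \<le> 1" using \<beta> unfolding \<tau>_def by auto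
  have "\<tau>\<^sup>2 \<le> \<tau>" using \<tau> by (simp add: power2_eq_square mult_left_le)
  then have \<tau>2: "\<tau>\<^sup>2 \<le> \<beta>" using \<tau> by linarith
  have F': "kgraph 3 ?F'" using attach_kgraph[of 1 2 F triangle] F triangle_kgraph(1) by (simp add: numeral_3_eq_3)
  obtain n1 where n1: "\<And>n. n1 \<le> n \<Longrightarrow> \<not> adm 3 1 n (1 / 2 - \<epsilon>) F"
    using below(2) unfolding eventually_sequentially by blast
  have "1 / 2 < 1 / 2 + \<tau>" using \<tau> by simp
  from above[OF this] obtain n0 where n0: "\<And>n. n0 \<le> n \<Longrightarrow> \<not> adm 3 1 n (1 / 2 + \<tau>) ?F'"
    unfolding eventually_sequentially by blast
  define N0 where "N0 = max (Suc (2 * n1)) (nat \<lceil>(real n0 ^ 3 + 14) / \<tau>\<rceil>)"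
  have hom: "hg_hom ?F' H" if N: "N0 \<le> N" and H: "kgraph 3 H" "verts H = {..<N}" "ldense 3 1 (1 / 2 - \<tau>\<^sup>2) H"
    for N and H :: "nat hypergraph"
  proof (rule ccontr)
    assume no: "\<not> hg_hom ?F' H"
    define n where "n = real (card (verts H))"
    have nN: "n = real N" by (simp add: n_def H(2))
    have n: "1 \<le> n" "2 * real n1 \<le> n" "(real n0 ^ 3 + 14) / \<tau> \<le> n"
      using N unfolding nN N0_def by (linarith, linarith, simp add: nat_le_iff ceiling_le_iff)
    define B where "B = {u \<in> verts H. \<not> hg_hom triangle (link 2 H {u})}"
    let ?A = "verts H - B"
    have fin: "finite (verts H)" "finite B" using H(2) by (simp_all add: B_def)
    have BV: "B \<subseteq> verts H" by (auto simp: B_def)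
    define HA where "HA = (?A, {e \<in> edges H. e \<subseteq> ?A})"
    have HA: "kgraph 3 HA" using H(1) by (auto simp: HA_def kgraph_def)
    have a: "real (card ?A) = n - real (card B)" "card B \<le> card (verts H)"
      using card_Diff_subset[OF fin(2) BV] card_mono[OF fin(1) BV] by (simp_all add: n_def of_nat_diff)
    have "hg_emb HA H" unfolding hg_emb_def by (rule exI[of _ id]) (auto simp: HA_def)
    then have noA: "\<not> hg_emb ?F' HA" using no emb_trans emb_imp_hom by blast
    have "real (card B) ^ 3 \<le> 48 * \<tau> * n ^ 3"
    proof (rule few_triangle_free_links[OF H(1,3) \<tau>(1,3) n_def])
      show "0 < n" using n by simp
      show "\<And>u. u \<in> B \<Longrightarrow> \<not> hg_hom triangle (link 2 H {u})" by (simp add: B_def)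
      have "0 \<le> 1 / 2 + \<tau>" using \<tau> by simp
      from edges_le_if_vertex_degrees_force[OF _ this n0 HA noA]
      have "6 * real (card {e \<in> edges H. e \<subseteq> ?A}) \<le> real n0 ^ 3 + (1 / 2 + \<tau>) * (real (card ?A) + 1) ^ 3"
        by (simp add: HA_def fact_numeral)
      also have "(real (card ?A) + 1) ^ 3 \<le> real (card ?A) ^ 3 + 7 * n\<^sup>2"
      proof -
        define y where "y = real (card ?A)"
        have y: "0 \<le> y" "y \<le> n" using a by (simp_all add: y_def)
        have "y * 1 \<le> n * n" "y\<^sup>2 \<le> n\<^sup>2" "1 * 1 \<le> n * n" using y n by (intro mult_mono power_mono; simp)+
        moreover have "(y + 1) ^ 3 = y ^ 3 + 3 * y\<^sup>2 + 3 * y + 1" by (simp add: power2_eq_square power3_eq_cube algebra_simps)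
        ultimately show ?thesis unfolding y_def[symmetric] power2_eq_square by linarith
      qed
      then have "(1 / 2 + \<tau>) * (real (card ?A) + 1) ^ 3 \<le> (1 / 2 + \<tau>) * (real (card ?A) ^ 3 + 7 * n\<^sup>2)"
        using \<tau> by (intro mult_left_mono) auto
      also have "\<dots> = (1 / 2 + \<tau>) * real (card ?A) ^ 3 + (1 / 2 + \<tau>) * (7 * n\<^sup>2)" by (rule distrib_left)
      also have "(1 / 2 + \<tau>) * (7 * n\<^sup>2) \<le> 2 * (7 * n\<^sup>2)" using \<tau> by (intro mult_right_mono) auto
      also have "real n0 ^ 3 + ((1 / 2 + \<tau>) * real (card ?A) ^ 3 + 2 * (7 * n\<^sup>2)) \<le> (1 / 2 + \<tau>) * real (card ?A) ^ 3 + \<tau> * n ^ 3"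
      proof -
        have "real n0 ^ 3 * 1 \<le> real n0 ^ 3 * n\<^sup>2" using n by (intro mult_left_mono) auto
        moreover have "(real n0 ^ 3 + 14) * n\<^sup>2 \<le> (\<tau> * n) * n\<^sup>2"
          using n(3) \<tau> by (intro mult_right_mono) (auto simp: field_simps)
        ultimately show ?thesis by (simp add: algebra_simps power2_eq_square power3_eq_cube)
      qed
      finally show "6 * real (card {e \<in> edges H. e \<subseteq> ?A}) \<le> (1 / 2 + \<tau>) * real (card ?A) ^ 3 + \<tau> * n ^ 3" by simp
    qed (rule BV)
    also have "\<dots> = (\<beta> * n) ^ 3" by (simp add: \<tau>_def power_mult_distrib)
    finally have "real (card B) \<le> \<beta> * n" using \<beta> n by (subst (asm) power_mono_iff) auto
    then have big: "(1 - \<beta>) * n \<le> real (card ?A)" using a by (simp add: algebra_simps)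
    have "ldense 3 1 (1 / 2 - \<epsilon>) HA" unfolding ldense_def
    proof (intro allI impI)
      fix S assume "S \<subseteq> verts HA \<and> card S = 1"
      then have S: "S \<subseteq> ?A" "card S = 1" by (simp_all add: HA_def)
      have "real (card ?A) ^ (3 - 1) - (1 - (1 / 2 - \<tau>\<^sup>2)) * real (card (verts H)) ^ (3 - 1)
          \<le> fact (3 - 1) * real (hg_degree HA S)"
        unfolding HA_def by (rule induced_degree[OF H(1) _ H(3) _ S]) auto
      then have dHA: "real (card ?A) ^ 2 - (1 / 2 + \<tau>\<^sup>2) * n\<^sup>2 \<le> 2 * real (hg_degree HA S)" by (simp add: n_def)
      have "(1 / 2 + \<tau>\<^sup>2) * n\<^sup>2 \<le> (1 / 2 + \<epsilon>') * real (card ?A) ^ 2"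
      proof -
        have \<epsilon>': "\<epsilon>' = 4 * \<beta>" by (simp add: \<beta>_def)
        have "1 / 2 + \<tau>\<^sup>2 \<le> 1 / 2 + \<beta>" using \<tau>2 by simp
        also have "\<dots> \<le> (1 / 2 + 4 * \<beta>) * (1 - 2 * \<beta>)"
        proof -
          have "\<beta> * \<beta> \<le> \<beta> * (1 / 4)" using \<beta> by (intro mult_left_mono) auto
          then show ?thesis by (simp add: algebra_simps)
        qed
        also have "\<dots> \<le> (1 / 2 + \<epsilon>') * (1 - \<beta>)\<^sup>2"
          unfolding \<epsilon>' using \<beta> by (intro mult_left_mono) (auto simp: power2_eq_square algebra_simps)
        finally have "(1 / 2 + \<tau>\<^sup>2) * n\<^sup>2 \<le> (1 / 2 + \<epsilon>') * (1 - \<beta>)\<^sup>2 * n\<^sup>2" by (rule mult_right_mono) simp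
        also have "\<dots> = (1 / 2 + \<epsilon>') * ((1 - \<beta>) * n)\<^sup>2" by (simp add: power_mult_distrib)
        also have "\<dots> \<le> (1 / 2 + \<epsilon>') * real (card ?A) ^ 2"
          using big \<beta> n \<epsilon>' by (intro mult_left_mono power_mono) auto
        finally show ?thesis .
      qed
      moreover have "\<epsilon>' * real (card ?A) ^ 2 \<le> \<epsilon> * real (card ?A) ^ 2" by (intro mult_right_mono) (auto simp: \<epsilon>'_def)
      ultimately have "(1 / 2 - \<epsilon>) * real (card ?A) ^ 2 \<le> 2 * real (hg_degree HA S)" using dHA by (simp add: algebra_simps)
      then show "(1 / 2 - \<epsilon>) * real (card (verts HA)) ^ (3 - 1) \<le> fact (3 - 1) * real (hg_degree HA S)"
        by (simp add: HA_def)
    qed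
    moreover have "n1 \<le> card (verts HA)"
    proof -
      have "real n1 \<le> 1 / 2 * n" using n(2) by simp
      also have "\<dots> \<le> (1 - \<beta>) * n" using \<beta> n by (intro mult_right_mono) auto
      also have "\<dots> \<le> real (card (verts HA))" using big by (simp add: HA_def)
      finally show ?thesis by simp
    qed
    ultimately have emb: "hg_emb F HA" using n1 HA unfolding adm_def by blast
    have "hg_hom ?F' H"
    proof (rule hom_attach[OF emb F])
      fix T assume T: "T \<subseteq> verts HA" "card T = 1"
      then obtain u where "T = {u}" using card_1_singletonE by blast
      then show "hg_hom triangle (link 2 H T)" using T(1) by (simp add: HA_def B_def)
    qed (auto simp: HA_def)
    then show False using no by simp
  qed
  have one_less_three: "1 < (3 :: nat)" by simp
  have half: "1 / 2 - \<tau>\<^sup>2 < 1 / 2 - \<tau>\<^sup>2 / 2" "1 / 2 - \<tau>\<^sup>2 / 2 \<le> 1" using zero_less_power[OF \<tau>(1), of 2] by linarith+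
  have "\<forall>\<^sub>F N in sequentially. \<forall>\<^sub>F n in sequentially. \<not> adm 3 1 n (1 / 2 - \<tau>\<^sup>2 / 2) ?F'"
    using density_le_if_hom_forced[OF one_less_three half, where ?'b = nat] eventually_ge_at_top[of N0]
  proof eventually_elim
    case (elim N)
    then show ?case using hom[OF elim(2)] F' by blast
  qed
  then have "\<forall>\<^sub>F n in sequentially. \<not> adm 3 1 n (1 / 2 - \<tau>\<^sup>2 / 2) ?F'" by simp
  then show ?thesis using \<tau> by (intro exI[of _ "\<tau>\<^sup>2 / 2"]) simp
qed

lemma iterated_triangles_below_half:
  "\<exists>\<epsilon>>0. \<forall>\<^sub>F n in sequentially. \<not> adm 3 1 n (1 / 2 - \<epsilon>) (iterated_attach 1 triangle D)"
proof (induction D)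
  case 0
  have "\<forall>\<^sub>F n in sequentially. \<not> adm (1 + 2) 1 n (1 / 2 - 1) (iterated_attach 1 triangle 0)"
    by (rule iterated_attach_0_forced)
  then show ?case by (intro exI[of _ 1]) (simp add: numeral_3_eq_3)
next
  case (Suc D)
  then obtain \<epsilon> :: real where \<epsilon>: "0 < \<epsilon>" "\<forall>\<^sub>F n in sequentially. \<not> adm 3 1 n (1 / 2 - \<epsilon>) (iterated_attach 1 triangle D)" by blast
  show ?case unfolding iterated_attach_Suc
  proof (rule attach_triangle_below_half[OF _ _ \<epsilon>])
    show "kgraph 3 (iterated_attach 1 triangle D)" using iterated_attach_kgraph[OF triangle_kgraph(1), of 1] by (simp add: numeral_3_eq_3)
    fix d :: real assume "1 / 2 < d"
    then have "turan_density 2 0 triangle < d" using triangle_density_le_half by linarith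
    from iterated_attach_forced[OF triangle_kgraph _ this, of 1 "Suc D"]
    show "\<forall>\<^sub>F n in sequentially. \<not> adm 3 1 n d (attach 1 triangle (iterated_attach 1 triangle D))"
      by (simp add: iterated_attach_Suc numeral_3_eq_3)
  qed
qed

text \<open>Bipartite links give the iterates densities that tend to \<open>1 / 2\<close>, but each of these densities is
  smaller than \<open>1 / 2\<close>.\<close>

theorem half_accumulates: "1 / 2 \<in> Acc (turan_spectrum 3 1)"
  unfolding Acc_iff
proof (intro allI impI)
  fix e :: real assume e: "0 < e"
  have "(\<lambda>D. 64 / real (Suc D)) \<longlonglongrightarrow> 0" by (rule LIMSEQ_Suc[OF lim_const_over_n])
  from order_tendstoD(2)[OF this e] obtain D where D: "64 / real (Suc D) < e"
    by (auto dest: eventually_happens'[OF sequentially_bot])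
  let ?F = "iterated_attach 1 triangle (Suc D)"
  have F: "kgraph 3 ?F" "edges ?F \<noteq> {}"
    using iterated_attach_kgraph[OF triangle_kgraph(1), of 1 "Suc D"] iterated_attach_edges[OF triangle_kgraph(2), of 1 D]
    by (simp_all add: numeral_3_eq_3)
  obtain \<epsilon> :: real where \<epsilon>: "0 < \<epsilon>" "\<forall>\<^sub>F n in sequentially. \<not> adm 3 1 n (1 / 2 - \<epsilon>) ?F"
    using iterated_triangles_below_half by blast
  have "turan_density 3 1 ?F \<le> 1 / 2 - \<epsilon>"
    by (intro density_le_if_eventually_not_adm[OF F] eventually_frequently \<epsilon>(2)) auto
  then have upper: "turan_density 3 1 ?F < 1 / 2" using \<epsilon>(1) by linarith
  have "d \<le> turan_density 3 1 ?F" if d: "d < 1 / 2 - 64 / real (Suc D)" for d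
  proof -
    \<comment> \<open>A single edge has density \<open>1 / 2\<close> as a pattern for bipartite links.\<close>
    define J :: "nat hypergraph" where "J = ({0, 1}, {{0, 1}})"
    have J: "kgraph 2 J" "verts J \<noteq> {}" by (auto simp: J_def kgraph_def)
    have "\<not> hg_hom triangle J"
    proof
      assume "hg_hom triangle J"
      then obtain f :: "nat \<Rightarrow> nat" where f: "f ` verts triangle \<subseteq> verts J" "\<forall>e\<in>edges triangle. f ` e \<in> edges J"
        unfolding hg_hom_def by blast
      have "f 0 \<in> {0, 1}" "f 1 \<in> {0, 1}" "f 2 \<in> {0, 1}" using f(1) by (simp_all add: triangle_def J_def)
      moreover have "{f 0, f 1} = {0, 1}" "{f 0, f 2} = {0, 1}" "{f 1, f 2} = {0, 1}"
        using f(2) by (simp_all add: triangle_def J_def)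
      ultimately show False by (auto simp: doubleton_eq_iff)
    qed
    then have "\<forall>\<^sub>F N in sequentially. adm (1 + 2) 1 N d ?F"
      by (intro iterated_attach_adm[OF triangle_kgraph(1) J, where c = "1 / 2"]) (use d in \<open>auto simp: J_def\<close>)
    then have "\<forall>\<^sub>F N in sequentially. adm 3 1 N d ?F" by (simp add: numeral_3_eq_3)
    then have freq: "\<exists>\<^sub>F N in sequentially. adm 3 1 N d ?F" by (rule eventually_frequently[OF sequentially_bot])
    have "1 < (3 :: nat)" by simp
    from density_ge_if_frequently_adm[OF F this freq] show ?thesis .
  qed
  then have lower: "1 / 2 - 64 / real (Suc D) \<le> turan_density 3 1 ?F" by (rule dense_le)
  show "\<exists>a\<in>turan_spectrum 3 1. a \<noteq> 1 / 2 \<and> \<bar>a - 1 / 2\<bar> < e"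
  proof (intro bexI conjI)
    show "turan_density 3 1 ?F \<in> turan_spectrum 3 1" by (rule density_in_spectrum[OF F])
    show "turan_density 3 1 ?F \<noteq> 1 / 2" using upper by (rule less_imp_neq)
    show "\<bar>turan_density 3 1 ?F - 1 / 2\<bar> < e" using upper lower D unfolding abs_less_iff by linarith
  qed
qed

section \<open>Infinitely many accumulation points\<close>

text \<open>Lifting enlarges the edges by one vertex at the price of passing from \<open>l = 0\<close> to \<open>l = 1\<close>, and these
  two cases have the same spectrum.\<close>

lemma accumulation_without_vertex_degrees:
  assumes "3 \<le> m"
  shows "1 / 2 \<in> Acc (turan_spectrum m 0)"
  using assms
proof (induction m rule: dec_induct)
  case base
  show ?case using half_accumulates vertex_degree_spectrum_eq[of 3] by simp
next
  case (step m)
  have "1 / 2 \<in> Acc (turan_spectrum (1 + m) 1)" using step by (intro lift_accumulation) auto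
  then show ?case using vertex_degree_spectrum_eq[of "Suc m"] step by simp
qed

lemma accumulation_below_1:
  assumes k: "3 \<le> k" and l: "1 \<le> l" "l < k"
  shows "\<exists>\<gamma>. \<gamma> \<in> Acc (turan_spectrum k l) \<and> 0 \<le> \<gamma> \<and> \<gamma> < 1"
proof -
  define m where "m = k - l"
  have m: "1 \<le> m" "k = l + m" using l by (simp_all add: m_def)
  show ?thesis
  proof (cases "m \<le> l")
    case True
    then have "0 \<in> Acc (turan_spectrum k l)" unfolding m(2) using m k by (intro zero_accumulates) auto
    then show ?thesis by (intro exI[of _ 0]) simp
  next
    case False
    have "1 / 2 \<in> Acc (turan_spectrum k l)"
    proof (cases "m = 2")
      case True
      then have "k = 3" "l = 1" using False l m by auto
      then show ?thesis using half_accumulates by simp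
    next
      case m2: False
      then have "3 \<le> m" using False l by linarith
      then show ?thesis unfolding m(2) using m by (intro lift_accumulation accumulation_without_vertex_degrees) auto
    qed
    then show ?thesis by (intro exI[of _ "1 / 2"]) simp
  qed
qed

theorem theorem1p2:
  "(\<forall>(k::nat) (l::nat) (\<beta>::real).
      1 \<le> l \<and> l < k \<and> \<beta> \<in> Acc (turan_spectrum k l) \<inter> {0..<1} \<longrightarrow>
      Phi k l \<beta> \<in> Acc (turan_spectrum k l)) \<and>
   (\<forall>(k::nat) (l::nat).
      3 \<le> k \<and> 1 \<le> l \<and> l < k \<longrightarrow> infinite (Acc (turan_spectrum k l)))"
proof (intro conjI allI impI)
  fix k l :: nat and \<beta> :: real
  assume "1 \<le> l \<and> l < k \<and> \<beta> \<in> Acc (turan_spectrum k l) \<inter> {0..<1}"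
  then show "Phi k l \<beta> \<in> Acc (turan_spectrum k l)" by (intro Phi_accumulation) auto
next
  fix k l :: nat
  assume kl: "3 \<le> k \<and> 1 \<le> l \<and> l < k"
  then obtain \<gamma> where "\<gamma> \<in> Acc (turan_spectrum k l)" "0 \<le> \<gamma>" "\<gamma> < 1"
    using accumulation_below_1[of k l] by blast
  then show "infinite (Acc (turan_spectrum k l))" using kl by (intro infinite_accumulation) auto
qed

end
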